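(* Let $\Bbbk$ be a field of characteristic zero. The localized bialgebra $\mathcal H_c=\Bbbk\mathcal G[\bullet^{-1}]$ of finite mixed quivers is a graded commutative Hopf algebra. Its unit is $\eta(1)=\emptyset$ (the empty mixed quiver); its counit is given by $\epsilon(G)=1$ if $E_G=\emptyset$ and $\epsilon(G)=0$ if $E_G\neq\emptyset$, together with $\epsilon(\bullet^{-1})=1$; its antipode $S$ satisfies $S(\bullet^m)=\bullet^{-m}$ for all $m\in\mathbb Z$, and for every connected mixed quiver $G$ with $E_G\neq\emptyset$, $$S(G)=-\Bigl(\sum_{H\preceq G,\ H\neq G}S(H)\,(G/H)\Bigr)\bullet^{-1}.$$ The antipode is extended multiplicatively to arbitrary mixed quivers.
   Context: For a set $X$, let $X^{\{\{2\}\}}$ be the set of multisets of size two with entries in $X$, and $X^{\langle 2\rangle}:=X^2\sqcup X^{\{\{2\}\}}$. A (finite) mixed quiver is a triple $G=(V_G,E_G,\rho_G)$ with finite sets $V_G$ of vertices and $E_G$ of edges and an incidence map $\rho_G:E_G\to V_G^{\langle2\rangle}$; an edge with image $(i,j)\in V_G^2$ is directed from $i$ to $j$, and an edge with image a multiset is undirected. Multiple edges, directed cycles and self-loops are allowed. The empty mixed quiver $\emptyset$ is allowed; connectedness refers to the underlying undirected graph (with nonempty vertex set). A cut-sub-mixed quiver $H\preceq G$ is $H=(V_G,E_H,\rho_G|_{E_H})$ with $E_H\subseteq E_G$ arbitrary (all vertices of $G$ are retained). For $H\preceq G$, let $\sim_H$ be the equivalence relation on $V_G$ generated by identifying the endpoints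 of every edge of $H$ and $\pi_H:V_G\to V_G/{\sim_H}$ the quotient map; the contraction is $G/H:=(V_G/{\sim_H},\,E_G\setminus E_H,\,\pi_H^{\langle2\rangle}\circ\rho_G|_{E_G\setminus E_H})$, where $\pi_H^{\langle 2\rangle}$ is the map induced on ordered pairs and on multisets of size two. $\mathcal G$ is the commutative monoid of isomorphism classes of finite mixed quivers under disjoint union, and $\Bbbk\mathcal G$ is its monoid algebra (product $G_1G_2=G_1\sqcup G_2$, unit $\emptyset$). The coproduct is $\Delta(G)=\sum_{H\preceq G}H\otimes(G/H)$, extended linearly, and the counit is $\epsilon$ as in the claim. The grading is by the number of edges $|E_G|$. The element $\bullet$ is the one-vertex mixed quiver without edges; $\mathcal H_c=\Bbbk\mathcal G[\bullet^{-1}]$ is the localization of $\Bbbk\mathcal G$ at $\{\bullet^n:n\ge0\}$, with $\Delta(\bullet^{-1})=\bullet^{-1}\otimes\bullet^{-1}$, $\epsilon(\bullet^{-1})=1$, and $\bullet^{-1}$ of degree $0$. *)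

theory Defs
  imports Complex_Main "HOL-Library.Poly_Mapping" "HOL-Library.Multiset" "HOL-Library.FuncSet"
    "HOL-Algebra.Module"
begin

section \<open>Mixed quivers\<close>

text \<open>Left injections are ordered pairs (directed edges), right injections are multisets of
  size two (undirected edges).\<close>

definition ends_space :: "'v set \<Rightarrow> ('v \<times> 'v + 'v multiset) set" where
  "ends_space X = (X \<times> X) <+> {M. set_mset M \<subseteq> X \<and> size M = 2}"

definition map_ends :: "('v \<Rightarrow> 'w) \<Rightarrow> 'v \<times> 'v + 'v multiset \<Rightarrow> 'w \<times> 'w + 'w multiset" where
  "map_ends f = map_sum (map_prod f f) (image_mset f)"

definition ends_set :: "'v \<times> 'v + 'v multiset \<Rightarrow> 'v set" where
  "ends_set = case_sum (\<lambda>(i, j). {i, j}) set_mset"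

record ('v, 'e) mquiver =
  verts :: "'v set"
  edges :: "'e set"
  incid :: "'e \<Rightarrow> 'v \<times> 'v + 'v multiset"

text \<open>The incidence map is extensional, so that equality of records is equality of mixed quivers.\<close>

definition mixed_quiver :: "('v, 'e) mquiver \<Rightarrow> bool" where
  "mixed_quiver G \<longleftrightarrow> finite (verts G) \<and> finite (edges G) \<and>
     incid G \<in> edges G \<rightarrow>\<^sub>E ends_space (verts G)"

definition quiver_iso :: "('v, 'e) mquiver \<Rightarrow> ('w, 'f) mquiver \<Rightarrow> bool" where
  "quiver_iso G G' \<longleftrightarrow> (\<exists>f g. bij_betw f (verts G) (verts G') \<and> bij_betw g (edges G) (edges G') \<and>
     (\<forall>e\<in>edges G. incid G' (g e) = map_ends f (incid G e)))"

definition cut_sub :: "('v, 'e) mquiver \<Rightarrow> ('v, 'e) mquiver \<Rightarrow> bool" (infix \<open>\<preceq>\<close> 50) where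
  "H \<preceq> G \<longleftrightarrow> verts H = verts G \<and> edges H \<subseteq> edges G \<and> incid H = restrict (incid G) (edges H)"

text \<open>The equivalence relation on the vertices generated by identifying the endpoints of each edge.\<close>

definition conn_rel :: "('v, 'e) mquiver \<Rightarrow> ('v \<times> 'v) set" where
  "conn_rel H = Id_on (verts H) \<union> (\<Union>e\<in>edges H. ends_set (incid H e) \<times> ends_set (incid H e))\<^sup>+"

definition connected_quiver :: "('v, 'e) mquiver \<Rightarrow> bool" where
  "connected_quiver G \<longleftrightarrow> verts G \<noteq> {} \<and> (\<forall>u\<in>verts G. \<forall>v\<in>verts G. (u, v) \<in> conn_rel G)"

definition contract :: "('v, 'e) mquiver \<Rightarrow> ('v, 'e) mquiver \<Rightarrow> ('v set, 'e) mquiver" where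
  "contract G H = \<lparr>verts = verts G // conn_rel H, edges = edges G - edges H,
     incid = restrict (map_ends (\<lambda>v. conn_rel H `` {v}) \<circ> incid G) (edges G - edges H)\<rparr>"

definition disj_union :: "('v, 'e) mquiver \<Rightarrow> ('w, 'f) mquiver \<Rightarrow> ('v + 'w, 'e + 'f) mquiver" where
  "disj_union G G' = \<lparr>verts = verts G <+> verts G', edges = edges G <+> edges G',
     incid = restrict (case_sum (map_ends Inl \<circ> incid G) (map_ends Inr \<circ> incid G'))
       (edges G <+> edges G')\<rparr>"

definition empty_quiver :: "(nat, nat) mquiver" where
  "empty_quiver = \<lparr>verts = {}, edges = {}, incid = (\<lambda>_. undefined)\<rparr>"

definition point_quiver :: "(nat, nat) mquiver" where
  "point_quiver = \<lparr>verts = {0}, edges = {}, incid = (\<lambda>_. undefined)\<rparr>"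


section \<open>The monoid of isomorphism classes\<close>

lemma map_ends_comp: "map_ends f (map_ends g x) = map_ends (f \<circ> g) x"
  by (cases x) (auto simp: map_ends_def multiset.map_comp)

lemma map_ends_id: "map_ends id x = x"
  by (cases x) (auto simp: map_ends_def)

lemma map_ends_cong:
  assumes "x \<in> ends_space X" "\<And>v. v \<in> X \<Longrightarrow> f v = g v"
  shows "map_ends f x = map_ends g x"
  using assms by (cases x) (auto simp: map_ends_def ends_space_def intro!: image_mset_cong)

lemma map_ends_in: "x \<in> ends_space X \<Longrightarrow> f ` X \<subseteq> Y \<Longrightarrow> map_ends f x \<in> ends_space Y"
  by (cases x) (auto simp: map_ends_def ends_space_def image_subset_iff subset_iff)

lemma incid_in: "mixed_quiver G \<Longrightarrow> e \<in> edges G \<Longrightarrow> incid G e \<in> ends_space (verts G)"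
  by (auto simp: mixed_quiver_def)

lemma quiver_iso_refl: "quiver_iso G G"
  unfolding quiver_iso_def
  by (rule exI[of _ id], rule exI[of _ id]) (simp add: map_ends_id)

lemma quiver_iso_sym:
  assumes "mixed_quiver G" "quiver_iso G G'"
  shows "quiver_iso G' G"
proof -
  obtain f g where f: "bij_betw f (verts G) (verts G')" and g: "bij_betw g (edges G) (edges G')"
    and e: "\<forall>e\<in>edges G. incid G' (g e) = map_ends f (incid G e)"
    using assms(2) unfolding quiver_iso_def by blast
  define f' where "f' = inv_into (verts G) f"
  define g' where "g' = inv_into (edges G) g"
  have "incid G (g' d) = map_ends f' (incid G' d)" if "d \<in> edges G'" for d
  proof -
    have d: "g' d \<in> edges G" "g (g' d) = d"
      using that g unfolding g'_def
      by (metis bij_betw_def inv_into_into, metis bij_betw_inv_into_right)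
    have "map_ends f' (incid G' d) = map_ends (f' \<circ> f) (incid G (g' d))"
      using e d by (metis map_ends_comp)
    also have "\<dots> = map_ends id (incid G (g' d))"
      by (rule map_ends_cong[OF incid_in[OF assms(1) d(1)]])
        (use f in \<open>auto simp: f'_def bij_betw_def\<close>)
    finally show ?thesis by (simp add: map_ends_id)
  qed
  moreover have "bij_betw f' (verts G') (verts G)" "bij_betw g' (edges G') (edges G)"
    using f g by (auto simp: f'_def g'_def bij_betw_inv_into)
  ultimately show ?thesis unfolding quiver_iso_def by blast
qed

lemma quiver_iso_trans:
  assumes "quiver_iso G G'" "quiver_iso G' G''"
  shows "quiver_iso G G''"
proof -
  obtain f g where 1: "bij_betw f (verts G) (verts G')" "bij_betw g (edges G) (edges G')"
    "\<forall>e\<in>edges G. incid G' (g e) = map_ends f (incid G e)"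
    using assms(1) unfolding quiver_iso_def by blast
  obtain f' g' where 2: "bij_betw f' (verts G') (verts G'')" "bij_betw g' (edges G') (edges G'')"
    "\<forall>e\<in>edges G'. incid G'' (g' e) = map_ends f' (incid G' e)"
    using assms(2) unfolding quiver_iso_def by blast
  have "\<forall>e\<in>edges G. incid G'' ((g' \<circ> g) e) = map_ends (f' \<circ> f) (incid G e)"
    using 1 2 by (auto simp: map_ends_comp[symmetric] dest: bij_betwE)
  then show ?thesis unfolding quiver_iso_def
    using bij_betw_trans[OF 1(1) 2(1)] bij_betw_trans[OF 1(2) 2(2)] by blast
qed

lemma exists_nat_copy:
  fixes G :: "('v, 'e) mquiver"
  assumes "mixed_quiver G"
  shows "\<exists>Q :: (nat, nat) mquiver. mixed_quiver Q \<and> quiver_iso G Q"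
proof -
  obtain f where f: "bij_betw f (verts G) {0..<card (verts G)}"
    using assms ex_bij_betw_finite_nat unfolding mixed_quiver_def by blast
  obtain g where g: "bij_betw g (edges G) {0..<card (edges G)}"
    using assms ex_bij_betw_finite_nat unfolding mixed_quiver_def by blast
  define Q where "Q = \<lparr>verts = {0..<card (verts G)}, edges = {0..<card (edges G)},
    incid = restrict (\<lambda>d. map_ends f (incid G (inv_into (edges G) g d))) {0..<card (edges G)}\<rparr>"
  have "incid Q d \<in> ends_space (verts Q)" if "d \<in> edges Q" for d
  proof -
    have "inv_into (edges G) g d \<in> edges G"
      using that g by (metis Q_def bij_betw_def inv_into_into mquiver.select_convs(2))
    from map_ends_in[OF incid_in[OF assms this], of f "verts Q"]
    show ?thesis using f that by (auto simp: Q_def bij_betw_def)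
  qed
  then have "mixed_quiver Q" by (auto simp: mixed_quiver_def Q_def)
  moreover have "quiver_iso G Q"
    unfolding quiver_iso_def
    by (intro exI[of _ f] exI[of _ g])
      (use f g in \<open>auto simp: Q_def bij_betw_inv_into_left dest: bij_betwE\<close>)
  ultimately show ?thesis by blast
qed

text \<open>Every finite mixed quiver has a copy on natural numbers; an isomorphism class is represented
  by the set of these copies.\<close>

typedef iso_class =
  "{{Q :: (nat, nat) mquiver. mixed_quiver Q \<and> quiver_iso G Q} |G :: (nat, nat) mquiver. mixed_quiver G}"
  by (rule exI[of _ "{Q. mixed_quiver Q \<and> quiver_iso empty_quiver Q}"])
    (auto simp: mixed_quiver_def empty_quiver_def intro!: exI[of _ empty_quiver])

definition quiver_class :: "('v, 'e) mquiver \<Rightarrow> iso_class" where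
  "quiver_class G = Abs_iso_class {Q. mixed_quiver Q \<and> quiver_iso G Q}"

definition quiver_rep :: "iso_class \<Rightarrow> (nat, nat) mquiver" where
  "quiver_rep C = (SOME Q. Q \<in> Rep_iso_class C)"

lemma quiver_class_mem:
  fixes G :: "('v, 'e) mquiver"
  assumes "mixed_quiver G"
  shows "Rep_iso_class (quiver_class G) = {Q. mixed_quiver Q \<and> quiver_iso G Q}"
proof -
  obtain R :: "(nat, nat) mquiver" where R: "mixed_quiver R" "quiver_iso G R"
    using exists_nat_copy[OF assms] by blast
  have "{Q :: (nat, nat) mquiver. mixed_quiver Q \<and> quiver_iso G Q} = {Q. mixed_quiver Q \<and> quiver_iso R Q}"
    using quiver_iso_trans[OF R(2)] quiver_iso_trans[OF quiver_iso_sym[OF assms R(2)]] by blast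
  then show ?thesis
    unfolding quiver_class_def using R(1) by (subst Abs_iso_class_inverse) blast+
qed

lemma quiver_class_eq_iff:
  fixes G :: "('v, 'e) mquiver" and G' :: "('w, 'f) mquiver"
  assumes "mixed_quiver G" "mixed_quiver G'"
  shows "quiver_class G = quiver_class G' \<longleftrightarrow> quiver_iso G G'"
proof
  assume eq: "quiver_class G = quiver_class G'"
  obtain Q :: "(nat, nat) mquiver" where Q: "mixed_quiver Q" "quiver_iso G Q"
    using exists_nat_copy[OF assms(1)] by blast
  then have "quiver_iso G' Q"
    using eq quiver_class_mem[OF assms(1)] quiver_class_mem[OF assms(2)] by auto
  from quiver_iso_trans[OF Q(2) quiver_iso_sym[OF assms(2) this]]
  show "quiver_iso G G'" .
next
  assume iso: "quiver_iso G G'"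
  have "quiver_iso G Q \<longleftrightarrow> quiver_iso G' Q" for Q :: "(nat, nat) mquiver"
    using quiver_iso_trans[OF iso] quiver_iso_trans[OF quiver_iso_sym[OF assms(1) iso]] by blast
  then show "quiver_class G = quiver_class G'" by (simp add: quiver_class_def)
qed

lemma quiver_rep: "mixed_quiver (quiver_rep C)" "quiver_class (quiver_rep C) = C"
proof -
  obtain G :: "(nat, nat) mquiver" where G: "mixed_quiver G"
    "Rep_iso_class C = {Q. mixed_quiver Q \<and> quiver_iso G Q}"
    using Rep_iso_class[of C] by blast
  have "quiver_rep C \<in> Rep_iso_class C"
    unfolding quiver_rep_def by (rule someI[of _ G]) (simp add: G quiver_iso_refl)
  with G have *: "mixed_quiver (quiver_rep C)" "quiver_iso G (quiver_rep C)" by auto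
  have "C = quiver_class G"
    using quiver_class_mem[OF G(1)] G(2) Rep_iso_class_inject by blast
  then show "mixed_quiver (quiver_rep C)" "quiver_class (quiver_rep C) = C"
    using * quiver_class_eq_iff[OF G(1) *(1)] by auto
qed

lemma mixed_quiver_disj_union:
  assumes "mixed_quiver G" "mixed_quiver G'"
  shows "mixed_quiver (disj_union G G')"
  using assms unfolding mixed_quiver_def disj_union_def
  by (auto intro!: map_ends_in)

lemma bij_betw_map_sum:
  assumes "bij_betw a A C" "bij_betw b B D"
  shows "bij_betw (map_sum a b) (A <+> B) (C <+> D)"
  using assms bij_betwE[OF bij_betw_inv_into[OF assms(1)]] bij_betwE[OF bij_betw_inv_into[OF assms(2)]]
  by (intro bij_betw_byWitness[where f' = "map_sum (inv_into A a) (inv_into B b)"])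
    (auto simp: bij_betw_inv_into_left bij_betw_inv_into_right bij_betwE)

lemma quiver_iso_disj_union:
  assumes "mixed_quiver G" "mixed_quiver G'" "quiver_iso G H" "quiver_iso G' H'"
  shows "quiver_iso (disj_union G G') (disj_union H H')"
proof -
  obtain f g where 1: "bij_betw f (verts G) (verts H)" "bij_betw g (edges G) (edges H)"
    "\<forall>e\<in>edges G. incid H (g e) = map_ends f (incid G e)"
    using assms(3) unfolding quiver_iso_def by blast
  obtain f' g' where 2: "bij_betw f' (verts G') (verts H')" "bij_betw g' (edges G') (edges H')"
    "\<forall>e\<in>edges G'. incid H' (g' e) = map_ends f' (incid G' e)"
    using assms(4) unfolding quiver_iso_def by blast
  have comp: "map_sum f f' \<circ> Inl = Inl \<circ> f" "map_sum f f' \<circ> Inr = Inr \<circ> f'" by auto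
  have "\<forall>e\<in>edges (disj_union G G').
      incid (disj_union H H') (map_sum g g' e) = map_ends (map_sum f f') (incid (disj_union G G') e)"
    using 1 2 bij_betwE[OF 1(2)] bij_betwE[OF 2(2)]
    by (auto simp: disj_union_def map_ends_comp comp)
  moreover have "bij_betw (map_sum f f') (verts (disj_union G G')) (verts (disj_union H H'))"
    using bij_betw_map_sum[OF 1(1) 2(1)] by (simp add: disj_union_def)
  moreover have "bij_betw (map_sum g g') (edges (disj_union G G')) (edges (disj_union H H'))"
    using bij_betw_map_sum[OF 1(2) 2(2)] by (simp add: disj_union_def)
  ultimately show ?thesis unfolding quiver_iso_def by blast
qed

instantiation iso_class :: comm_monoid_add
begin

definition zero_iso_class :: iso_class where
  "0 = quiver_class empty_quiver"

definition plus_iso_class :: "iso_class \<Rightarrow> iso_class \<Rightarrow> iso_class" where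
  "C + D = quiver_class (disj_union (quiver_rep C) (quiver_rep D))"

lemma quiver_class_disj_union_aux:
  assumes "mixed_quiver G" "mixed_quiver G'"
  shows "quiver_class (disj_union G G') = quiver_class G + quiver_class G'"
proof -
  have "quiver_iso G (quiver_rep (quiver_class G))" "quiver_iso G' (quiver_rep (quiver_class G'))"
    using assms quiver_rep quiver_class_eq_iff by metis+
  then show ?thesis
    unfolding plus_iso_class_def
    by (subst quiver_class_eq_iff)
      (auto intro!: mixed_quiver_disj_union quiver_iso_disj_union assms quiver_rep)
qed

instance
proof
  fix A B C :: iso_class
  let ?a = "quiver_rep A" and ?b = "quiver_rep B" and ?c = "quiver_rep C"
  note q = quiver_rep mixed_quiver_disj_union
  have "quiver_iso (disj_union (disj_union ?a ?b) ?c) (disj_union ?a (disj_union ?b ?c))"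
    unfolding quiver_iso_def
  proof (intro exI conjI)
    let ?as = "case_sum (case_sum Inl (Inr \<circ> Inl)) (Inr \<circ> Inr)"
    show "bij_betw ?as (verts (disj_union (disj_union ?a ?b) ?c))
        (verts (disj_union ?a (disj_union ?b ?c)))"
      by (rule bij_betw_byWitness[where f' = "case_sum (Inl \<circ> Inl) (case_sum (Inl \<circ> Inr) Inr)"]) (auto simp: disj_union_def)
    let ?es = "case_sum (case_sum Inl (Inr \<circ> Inl)) (Inr \<circ> Inr)"
    show "bij_betw ?es (edges (disj_union (disj_union ?a ?b) ?c))
        (edges (disj_union ?a (disj_union ?b ?c)))"
      by (rule bij_betw_byWitness[where f' = "case_sum (Inl \<circ> Inl) (case_sum (Inl \<circ> Inr) Inr)"]) (auto simp: disj_union_def)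
    have c: "?as \<circ> (Inl \<circ> Inl) = Inl" "?as \<circ> (Inl \<circ> Inr) = Inr \<circ> Inl" "?as \<circ> Inr = Inr \<circ> Inr"
      by (auto simp: fun_eq_iff)
    show "\<forall>e\<in>edges (disj_union (disj_union ?a ?b) ?c).
       incid (disj_union ?a (disj_union ?b ?c)) (?es e) =
         map_ends ?as (incid (disj_union (disj_union ?a ?b) ?c) e)"
      by (auto simp: disj_union_def map_ends_comp c comp_assoc)
  qed
  then have "quiver_class (disj_union (disj_union ?a ?b) ?c) = quiver_class (disj_union ?a (disj_union ?b ?c))"
    by (simp only: quiver_class_eq_iff q)
  then show "A + B + C = A + (B + C)"
    by (simp only: quiver_class_disj_union_aux q)
  have "quiver_iso (disj_union ?a ?b) (disj_union ?b ?a)"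
    unfolding quiver_iso_def
  proof (intro exI conjI)
    let ?as = "case_sum Inr Inl"
    show "bij_betw ?as (verts (disj_union ?a ?b)) (verts (disj_union ?b ?a))"
      by (rule bij_betw_byWitness[where f' = "case_sum Inr Inl"]) (auto simp: disj_union_def)
    show "bij_betw (case_sum Inr Inl) (edges (disj_union ?a ?b)) (edges (disj_union ?b ?a))"
      by (rule bij_betw_byWitness[where f' = "case_sum Inr Inl"]) (auto simp: disj_union_def)
    have c: "?as \<circ> Inl = Inr" "?as \<circ> Inr = Inl" by auto
    show "\<forall>e\<in>edges (disj_union ?a ?b). incid (disj_union ?b ?a) (case_sum Inr Inl e) =
        map_ends ?as (incid (disj_union ?a ?b) e)"
      by (auto simp: disj_union_def map_ends_comp c)
  qed
  then have "quiver_class (disj_union ?a ?b) = quiver_class (disj_union ?b ?a)"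
    by (simp only: quiver_class_eq_iff q)
  then show "A + B = B + A"
    by (simp only: quiver_class_disj_union_aux q)
  have e: "mixed_quiver empty_quiver" by (simp add: mixed_quiver_def empty_quiver_def)
  have "quiver_iso ?a (disj_union empty_quiver ?a)"
    unfolding quiver_iso_def
    by (rule exI[of _ Inr], rule exI[of _ Inr])
      (auto simp: disj_union_def empty_quiver_def bij_betw_def)
  then have "quiver_class ?a = quiver_class (disj_union empty_quiver ?a)"
    using quiver_class_eq_iff q e by blast
  then show "0 + A = A"
    unfolding zero_iso_class_def by (metis quiver_class_disj_union_aux e quiver_rep)
qed

end

lemma quiver_class_disj_union:
  assumes "mixed_quiver G" "mixed_quiver G'"
  shows "quiver_class (disj_union G G') = quiver_class G + quiver_class G'"
  using assms by (rule quiver_class_disj_union_aux)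


section \<open>The localized monoid algebra\<close>

text \<open>The monoid of isomorphism classes is written additively, so that its monoid algebra
  is the convolution ring of \<^theory>\<open>HOL-Library.Poly_Mapping\<close>.\<close>

type_synonym 'k quiver_algebra = "iso_class \<Rightarrow>\<^sub>0 'k"

definition bullet :: "'k::field quiver_algebra" where
  "bullet = Poly_Mapping.single (quiver_class point_quiver) 1"

text \<open>The pair (a, m) stands for the fraction of a by the m-th power of the bullet.\<close>

definition frac_rel :: "'k::field quiver_algebra \<times> nat \<Rightarrow> 'k quiver_algebra \<times> nat \<Rightarrow> bool" where
  "frac_rel = (\<lambda>(a, m) (b, n). \<exists>l. bullet ^ l * (bullet ^ n * a - bullet ^ m * b) = 0)"

lemma frac_rel_iff:
  "frac_rel (a, m) (b, n) \<longleftrightarrow> (\<exists>l. bullet ^ l * (bullet ^ n * a) = bullet ^ l * (bullet ^ m * b))"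
  by (simp add: frac_rel_def algebra_simps)

lemma equivp_frac_rel: "equivp (frac_rel :: 'k::field quiver_algebra \<times> nat \<Rightarrow> _)"
proof (rule equivpI)
  show "reflp (frac_rel :: 'k quiver_algebra \<times> nat \<Rightarrow> _)" by (auto simp: reflp_def frac_rel_iff)
  show "symp (frac_rel :: 'k quiver_algebra \<times> nat \<Rightarrow> _)" by (simp add: symp_def frac_rel_iff) metis
  have "frac_rel (a, m) (c, p)" if *: "frac_rel (a, m) (b, n)" "frac_rel (b, n) (c, p)"
    for a b c :: "'k quiver_algebra" and m n p
  proof -
    obtain l where l: "bullet ^ l * (bullet ^ n * a) = bullet ^ l * (bullet ^ m * b)"
      using *(1) unfolding frac_rel_iff by blast
    obtain k where k: "bullet ^ k * (bullet ^ p * b) = bullet ^ k * (bullet ^ n * c)"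
      using *(2) unfolding frac_rel_iff by blast
    have "bullet ^ (l + k + n) * (bullet ^ p * a) = bullet ^ k * bullet ^ p * (bullet ^ l * (bullet ^ n * a))"
      by (simp add: power_add mult_ac)
    also have "\<dots> = bullet ^ l * bullet ^ m * (bullet ^ k * (bullet ^ p * b))"
      unfolding l by (simp add: mult_ac)
    also have "\<dots> = bullet ^ (l + k + n) * (bullet ^ m * c)"
      unfolding k by (simp add: power_add mult_ac)
    finally show ?thesis unfolding frac_rel_iff by blast
  qed
  then show "transp (frac_rel :: 'k quiver_algebra \<times> nat \<Rightarrow> _)" unfolding transp_def split_paired_All by blast
qed

quotient_type (overloaded) 'k quiver_loc = "'k::field quiver_algebra \<times> nat" / frac_rel
  by (rule equivp_frac_rel)

definition frac :: "'k::field quiver_algebra \<Rightarrow> nat \<Rightarrow> 'k quiver_loc" where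
  "frac a m = abs_quiver_loc (a, m)"

lemma frac_eq_iff:
  "frac a m = frac b n \<longleftrightarrow> (\<exists>l. bullet ^ l * (bullet ^ n * a) = bullet ^ l * (bullet ^ m * b))"
  by (simp add: frac_def quiver_loc.abs_eq_iff frac_rel_iff)

lemma frac_cases: obtains a m where "x = frac a m"
  unfolding frac_def using quiver_loc.abs_induct[of "\<lambda>y. \<exists>a m. y = abs_quiver_loc (a, m)" x] by auto

instantiation quiver_loc :: (field) comm_ring_1
begin

lift_definition zero_quiver_loc :: "'a quiver_loc" is "(0, 0)" .

lift_definition one_quiver_loc :: "'a quiver_loc" is "(1, 0)" .

lift_definition plus_quiver_loc :: "'a quiver_loc \<Rightarrow> 'a quiver_loc \<Rightarrow> 'a quiver_loc"
  is "\<lambda>(a, m) (b, n). (bullet ^ n * a + bullet ^ m * b, m + n)"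
proof (clarsimp simp: frac_rel_iff)
  fix a a' b b' :: "'a quiver_algebra" and m m' n n' l k :: nat
  assume l: "bullet ^ l * (bullet ^ m' * a) = bullet ^ l * (bullet ^ m * a')"
    and k: "bullet ^ k * (bullet ^ n' * b) = bullet ^ k * (bullet ^ n * b')"
  have "bullet ^ (l + k) * (bullet ^ (m' + n') * (bullet ^ n * a + bullet ^ m * b)) =
      bullet ^ (k + n + n') * (bullet ^ l * (bullet ^ m' * a)) +
      bullet ^ (l + m + m') * (bullet ^ k * (bullet ^ n' * b))"
    by (simp add: power_add algebra_simps)
  also have "\<dots> = bullet ^ (l + k) * (bullet ^ (m + n) * (bullet ^ n' * a' + bullet ^ m' * b'))"
    unfolding l k by (simp add: power_add algebra_simps)
  finally show "\<exists>l. bullet ^ l * (bullet ^ (m' + n') * (bullet ^ n * a + bullet ^ m * b)) =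
      bullet ^ l * (bullet ^ (m + n) * (bullet ^ n' * a' + bullet ^ m' * b'))" by blast
qed

lift_definition uminus_quiver_loc :: "'a quiver_loc \<Rightarrow> 'a quiver_loc"
  is "\<lambda>(a, m). (- a, m)"
  by (auto simp: frac_rel_iff)

definition minus_quiver_loc :: "'a quiver_loc \<Rightarrow> 'a quiver_loc \<Rightarrow> 'a quiver_loc" where
  "x - y = x + - (y :: 'a quiver_loc)"

lift_definition times_quiver_loc :: "'a quiver_loc \<Rightarrow> 'a quiver_loc \<Rightarrow> 'a quiver_loc"
  is "\<lambda>(a, m) (b, n). (a * b, m + n)"
proof (clarsimp simp: frac_rel_iff)
  fix a a' b b' :: "'a quiver_algebra" and m m' n n' l k :: nat
  assume l: "bullet ^ l * (bullet ^ m' * a) = bullet ^ l * (bullet ^ m * a')"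
    and k: "bullet ^ k * (bullet ^ n' * b) = bullet ^ k * (bullet ^ n * b')"
  have "bullet ^ (l + k) * (bullet ^ (m' + n') * (a * b)) =
      (bullet ^ l * (bullet ^ m' * a)) * (bullet ^ k * (bullet ^ n' * b))"
    by (simp add: power_add mult_ac)
  also have "\<dots> = bullet ^ (l + k) * (bullet ^ (m + n) * (a' * b'))"
    unfolding l k by (simp add: power_add mult_ac)
  finally show "\<exists>l. bullet ^ l * (bullet ^ (m' + n') * (a * b)) =
      bullet ^ l * (bullet ^ (m + n) * (a' * b'))" by blast
qed

lemma frac_ops:
  "0 = frac 0 0" "1 = frac 1 0"
  "frac a m + frac b n = frac (bullet ^ n * a + bullet ^ m * b) (m + n)"
  "- frac a m = frac (- a) m"
  "frac a m * frac b n = frac (a * b) (m + n)"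
  by (simp_all add: frac_def zero_quiver_loc.abs_eq one_quiver_loc.abs_eq plus_quiver_loc.abs_eq
    uminus_quiver_loc.abs_eq times_quiver_loc.abs_eq)

lemma one_neq_zero_frac: "(0 :: 'a quiver_loc) \<noteq> 1"
proof -
  have "(bullet :: 'a quiver_algebra) ^ l = Poly_Mapping.single (((+) (quiver_class point_quiver) ^^ l) 0) 1" for l
    by (induction l) (simp_all add: bullet_def mult_single)
  then have "(bullet :: 'a quiver_algebra) ^ l \<noteq> 0" for l
    by (metis lookup_single_eq lookup_zero zero_neq_one)
  then show ?thesis by (simp add: frac_ops frac_eq_iff)
qed

instance
proof
  fix x y z :: "'a quiver_loc"
  obtain a m where x: "x = frac a m" by (rule frac_cases)
  obtain b n where y: "y = frac b n" by (rule frac_cases)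
  obtain c p where z: "z = frac c p" by (rule frac_cases)
  show "x + y + z = x + (y + z)" "x + y = y + x" "0 + x = x" "x * y * z = x * (y * z)"
    "x * y = y * x" "1 * x = x"
    unfolding x y z by (simp_all add: frac_ops algebra_simps power_add)
  show "- x + x = 0" unfolding x by (simp add: frac_ops frac_eq_iff algebra_simps)
  show "x - y = x + - y" by (rule minus_quiver_loc_def)
  show "(x + y) * z = x * z + y * z"
    unfolding x y z by (simp add: frac_ops frac_eq_iff algebra_simps power_add)
  show "(0 :: 'a quiver_loc) \<noteq> 1" by (rule one_neq_zero_frac)
qed

end

definition loc_scale :: "'k::field \<Rightarrow> 'k quiver_loc \<Rightarrow> 'k quiver_loc" where
  "loc_scale c x = frac (Poly_Mapping.single 0 c) 0 * x"

definition quiver_elem :: "('v, 'e) mquiver \<Rightarrow> 'k::field quiver_loc" where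
  "quiver_elem G = frac (Poly_Mapping.single (quiver_class G) 1) 0"

lemma quiver_elem_disj_union:
  "mixed_quiver G \<Longrightarrow> mixed_quiver G' \<Longrightarrow>
    (quiver_elem (disj_union G G') :: 'k::field quiver_loc) = quiver_elem G * quiver_elem G'"
  by (simp add: quiver_elem_def frac_ops mult_single quiver_class_disj_union)

definition bullet_pow :: "int \<Rightarrow> 'k::field quiver_loc" where
  "bullet_pow m = (if m \<ge> 0 then frac (bullet ^ nat m) 0 else frac 1 (nat (- m)))"

definition edge_grade :: "nat \<Rightarrow> 'k::field quiver_loc set" where
  "edge_grade n = Modules.module.span loc_scale
     {frac (Poly_Mapping.single (quiver_class G) 1) m |(G :: (nat, nat) mquiver) m.
        mixed_quiver G \<and> card (edges G) = n}"


section \<open>Tensor products\<close>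

definition type_algebra :: "('k \<Rightarrow> 'a \<Rightarrow> 'a) \<Rightarrow> ('k, 'a::comm_ring_1) module" where
  "type_algebra scale = \<lparr>carrier = UNIV, monoid.mult = (*), one = 1, ring.zero = 0, add = (+),
     smult = scale\<rparr>"

abbreviation pm_scale :: "'k::field \<Rightarrow> ('x \<Rightarrow>\<^sub>0 'k) \<Rightarrow> ('x \<Rightarrow>\<^sub>0 'k)" where
  "pm_scale c \<equiv> Poly_Mapping.map ((*) c)"

abbreviation gen :: "'a \<Rightarrow> 'b \<Rightarrow> ('a \<times> 'b) \<Rightarrow>\<^sub>0 'k::field" where
  "gen x y \<equiv> Poly_Mapping.single (x, y) 1"

text \<open>The tensor product of M and N is the free vector space on pairs modulo the span of
  the bilinearity relations; its elements are cosets of that span.\<close>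

definition free_pairs :: "('k::field, 'a) module \<Rightarrow> ('k, 'b) module \<Rightarrow> (('a \<times> 'b) \<Rightarrow>\<^sub>0 'k) set" where
  "free_pairs M N = {t. Poly_Mapping.keys t \<subseteq> carrier M \<times> carrier N}"

definition bilinear_relations ::
    "('k::field, 'a) module \<Rightarrow> ('k, 'b) module \<Rightarrow> (('a \<times> 'b) \<Rightarrow>\<^sub>0 'k) set" where
  "bilinear_relations M N =
     {gen (x \<oplus>\<^bsub>M\<^esub> x') y - gen x y - gen x' y |x x' y.
        x \<in> carrier M \<and> x' \<in> carrier M \<and> y \<in> carrier N} \<union>
     {gen x (y \<oplus>\<^bsub>N\<^esub> y') - gen x y - gen x y' |x y y'.
        x \<in> carrier M \<and> y \<in> carrier N \<and> y' \<in> carrier N} \<union>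
     {gen (c \<odot>\<^bsub>M\<^esub> x) y - pm_scale c (gen x y) |c x y. x \<in> carrier M \<and> y \<in> carrier N} \<union>
     {gen x (c \<odot>\<^bsub>N\<^esub> y) - pm_scale c (gen x y) |c x y. x \<in> carrier M \<and> y \<in> carrier N}"

definition tensor_class :: "('k::field, 'a) module \<Rightarrow> ('k, 'b) module \<Rightarrow>
    (('a \<times> 'b) \<Rightarrow>\<^sub>0 'k) \<Rightarrow> (('a \<times> 'b) \<Rightarrow>\<^sub>0 'k) set" where
  "tensor_class M N t = {u. u - t \<in> Modules.module.span pm_scale (bilinear_relations M N)}"

definition pure_tensor :: "('k::field, 'a) module \<Rightarrow> ('k, 'b) module \<Rightarrow>
    'a \<Rightarrow> 'b \<Rightarrow> (('a \<times> 'b) \<Rightarrow>\<^sub>0 'k) set" where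
  "pure_tensor M N x y = tensor_class M N (gen x y)"

definition free_mult :: "('k::field, 'a) module \<Rightarrow> ('k, 'b) module \<Rightarrow>
    (('a \<times> 'b) \<Rightarrow>\<^sub>0 'k) \<Rightarrow> (('a \<times> 'b) \<Rightarrow>\<^sub>0 'k) \<Rightarrow> (('a \<times> 'b) \<Rightarrow>\<^sub>0 'k)" where
  "free_mult M N t u = (\<Sum>(x, y)\<in>Poly_Mapping.keys t. \<Sum>(x', y')\<in>Poly_Mapping.keys u.
     Poly_Mapping.single (x \<otimes>\<^bsub>M\<^esub> x', y \<otimes>\<^bsub>N\<^esub> y')
       (Poly_Mapping.lookup t (x, y) * Poly_Mapping.lookup u (x', y')))"

definition tensor :: "('k::field, 'a) module \<Rightarrow> ('k, 'b) module \<Rightarrow>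
    ('k, (('a \<times> 'b) \<Rightarrow>\<^sub>0 'k) set) module" where
  "tensor M N = \<lparr>carrier = tensor_class M N ` free_pairs M N,
     monoid.mult = (\<lambda>T U. \<Union>t\<in>T. \<Union>u\<in>U. tensor_class M N (free_mult M N t u)),
     one = pure_tensor M N \<one>\<^bsub>M\<^esub> \<one>\<^bsub>N\<^esub>,
     ring.zero = tensor_class M N 0,
     add = (\<lambda>T U. \<Union>t\<in>T. \<Union>u\<in>U. tensor_class M N (t + u)),
     smult = (\<lambda>c T. \<Union>t\<in>T. tensor_class M N (pm_scale c t))\<rparr>"

text \<open>For bilinear f, the linear map on the tensor product sending each pure tensor of
  x and y to f x y; all members of a coset give the same value.\<close>

definition tensor_lift :: "('k::field, 'c) module \<Rightarrow> ('a \<Rightarrow> 'b \<Rightarrow> 'c) \<Rightarrow>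
    (('a \<times> 'b) \<Rightarrow>\<^sub>0 'k) set \<Rightarrow> 'c" where
  "tensor_lift P f T = the_elem ((\<lambda>t. \<Oplus>\<^bsub>P\<^esub>p\<in>Poly_Mapping.keys t.
     Poly_Mapping.lookup t p \<odot>\<^bsub>P\<^esub> f (fst p) (snd p)) ` T)"

definition tensor_map :: "('k::field, 'c) module \<Rightarrow> ('k, 'd) module \<Rightarrow> ('a \<Rightarrow> 'c) \<Rightarrow> ('b \<Rightarrow> 'd) \<Rightarrow>
    (('a \<times> 'b) \<Rightarrow>\<^sub>0 'k) set \<Rightarrow> (('c \<times> 'd) \<Rightarrow>\<^sub>0 'k) set" where
  "tensor_map M N f g = tensor_lift (tensor M N) (\<lambda>x y. pure_tensor M N (f x) (g y))"

definition tensor_assoc :: "('k::field, 'a) module \<Rightarrow> ('k, 'b) module \<Rightarrow> ('k, 'c) module \<Rightarrow>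
    ((((('a \<times> 'b) \<Rightarrow>\<^sub>0 'k) set \<times> 'c) \<Rightarrow>\<^sub>0 'k) set) \<Rightarrow> (('a \<times> (('b \<times> 'c) \<Rightarrow>\<^sub>0 'k) set) \<Rightarrow>\<^sub>0 'k) set" where
  "tensor_assoc L M N = tensor_lift (tensor L (tensor M N))
     (\<lambda>T z. tensor_lift (tensor L (tensor M N))
        (\<lambda>x y. pure_tensor L (tensor M N) x (pure_tensor M N y z)) T)"


section \<open>Hopf algebras\<close>

definition linear_map :: "('k::field, 'a) module \<Rightarrow> ('k, 'b) module \<Rightarrow> ('a \<Rightarrow> 'b) \<Rightarrow> bool" where
  "linear_map M N f \<longleftrightarrow> f \<in> carrier M \<rightarrow> carrier N \<and>
     (\<forall>x\<in>carrier M. \<forall>y\<in>carrier M. f (x \<oplus>\<^bsub>M\<^esub> y) = f x \<oplus>\<^bsub>N\<^esub> f y) \<and>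
     (\<forall>c. \<forall>x\<in>carrier M. f (c \<odot>\<^bsub>M\<^esub> x) = c \<odot>\<^bsub>N\<^esub> f x)"

abbreviation base_algebra :: "('k::field, 'k) module" where
  "base_algebra \<equiv> type_algebra (*)"

text \<open>The locale \<^locale>\<open>algebra\<close> already contains commutativity of the multiplication.\<close>

locale commutative_bialgebra =
  fixes H :: "('k::field, 'h) module" (structure)
    and \<Delta> :: "'h \<Rightarrow> (('h \<times> 'h) \<Rightarrow>\<^sub>0 'k) set"
    and \<epsilon> :: "'h \<Rightarrow> 'k"
  assumes algebra: "algebra base_algebra H"
    and comult_linear: "linear_map H (tensor H H) \<Delta>"
    and comult_ring_hom: "\<Delta> \<in> ring_hom H (tensor H H)"
    and counit_linear: "linear_map H base_algebra \<epsilon>"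
    and counit_ring_hom: "\<epsilon> \<in> ring_hom H base_algebra"
    and coassociative: "h \<in> carrier H \<Longrightarrow>
      tensor_assoc H H H (tensor_map (tensor H H) H \<Delta> id (\<Delta> h)) =
        tensor_map H (tensor H H) id \<Delta> (\<Delta> h)"
    and counital_left: "h \<in> carrier H \<Longrightarrow> tensor_lift H (\<lambda>x y. \<epsilon> x \<odot> y) (\<Delta> h) = h"
    and counital_right: "h \<in> carrier H \<Longrightarrow> tensor_lift H (\<lambda>x y. \<epsilon> y \<odot> x) (\<Delta> h) = h"

locale commutative_hopf_algebra = commutative_bialgebra H \<Delta> \<epsilon>
  for H :: "('k::field, 'h) module" (structure) and \<Delta> \<epsilon> +
  fixes S :: "'h \<Rightarrow> 'h"
  assumes antipode_linear: "linear_map H H S"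
    and antipode_left: "h \<in> carrier H \<Longrightarrow> tensor_lift H (\<lambda>x y. S x \<otimes> y) (\<Delta> h) = \<epsilon> h \<odot> \<one>"
    and antipode_right: "h \<in> carrier H \<Longrightarrow> tensor_lift H (\<lambda>x y. x \<otimes> S y) (\<Delta> h) = \<epsilon> h \<odot> \<one>"

locale graded_commutative_hopf_algebra = commutative_hopf_algebra H \<Delta> \<epsilon> S
  for H :: "('k::field, 'h) module" (structure) and \<Delta> \<epsilon> S +
  fixes A :: "nat \<Rightarrow> 'h set"
  assumes grade_submodule: "submodule (A n) base_algebra H"
    and grade_direct_sum: "h \<in> carrier H \<Longrightarrow>
      \<exists>!f. (\<forall>n. f n \<in> A n) \<and> finite {n. f n \<noteq> \<zero>} \<and> h = (\<Oplus>n\<in>{n. f n \<noteq> \<zero>}. f n)"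
    and grade_one: "\<one> \<in> A 0"
    and grade_mult: "x \<in> A m \<Longrightarrow> y \<in> A n \<Longrightarrow> x \<otimes> y \<in> A (m + n)"
    and grade_comult: "x \<in> A n \<Longrightarrow>
      \<Delta> x \<in> tensor_class H H ` {t. Poly_Mapping.keys t \<subseteq> (\<Union>i\<le>n. A i \<times> A (n - i))}"
    and grade_counit: "x \<in> A n \<Longrightarrow> n > 0 \<Longrightarrow> \<epsilon> x = 0"
    and grade_antipode: "x \<in> A n \<Longrightarrow> S x \<in> A n"


section \<open>The bialgebra of mixed quivers\<close>

definition H_c :: "('k::field, 'k quiver_loc) module" where
  "H_c = type_algebra loc_scale"

text \<open>The coproduct of a quiver G is the sum of H \<open>\<otimes>\<close> G/H; it is extended linearly and by
  grouplikeness of the bullet, so the denominator is copied to both tensor factors.\<close>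

definition coproduct :: "'k::field quiver_loc \<Rightarrow> (('k quiver_loc \<times> 'k quiver_loc) \<Rightarrow>\<^sub>0 'k) set" where
  "coproduct z = (\<Union>(a, m)\<in>{(a, m). frac a m = z}. tensor_class H_c H_c
     (\<Sum>C\<in>Poly_Mapping.keys a. \<Sum>H\<in>{H. H \<preceq> quiver_rep C}.
        Poly_Mapping.single
          (frac (Poly_Mapping.single (quiver_class H) 1) m,
           frac (Poly_Mapping.single (quiver_class (contract (quiver_rep C) H)) 1) m)
          (Poly_Mapping.lookup a C)))"

end

theory Submission
  imports Defs
begin

text \<open>
  All structure maps are determined by their values on the generators \<open>C/\<bullet>\<^sup>m\<close>, where \<open>C\<close> is an
  isomorphism class, so every axiom reduces to an identity between sums over the cuts of a quiver.
  Three such identities carry the proof. Cuts of a disjoint union are pairs of cuts, which makes the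
  coproduct multiplicative (\<open>cut_sum_plus\<close>). Cutting the left or the right part once more gives the
  same triples, since a pair of edge sets \<open>K \<subseteq> E\<close> is the same as a pair of disjoint sets \<open>K\<close> and
  \<open>L = E - K\<close>, and contracting \<open>K\<close> and then \<open>L\<close> amounts to contracting \<open>K \<union> L\<close>; this is
  coassociativity (\<open>cut_sum_coassoc\<close>). Exactly one cut has no edge on the left, and exactly one has
  no edge on the right; this is the counit law.

  All isomorphisms of contractions follow from one characterization (\<open>quiver_iso_contract\<close>): the
  fibres of the quotient map are the classes of vertices that are not separated by any predicate
  that is constant on the ends of each contracted edge.

  For the antipode, functions from isomorphism classes to the localization are convolved along cuts.
  In \<open>f * i\<close>, where \<open>i\<close> sends a class to its generator, the cut with \<open>G\<close> on the left contributes
  \<open>f(G)\<close> times a power of the bullet, which is invertible, and all other cuts have fewer edges on the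
  left. Hence a left inverse \<open>s\<close> of \<open>i\<close> can be defined by recursion on the number of edges, and \<open>i\<close>
  can be cancelled on the right (\<open>conv_incl_cancel\<close>). Cancellation shows that \<open>s\<close> is also a right
  inverse, that it is multiplicative, and that every antipode agrees with the one built from \<open>s\<close>.
  The recursion formula for a connected quiver is the left antipode law, where the contraction of
  the whole quiver is a single point.

  The tensor product is a quotient of a free vector space. A bilinear map induces a well-defined
  linear map on it (\<open>linear_map_tensor_lift\<close>), and linear maps that agree on pure tensors are
  equal (\<open>linear_map_tensor_eqI\<close>). The coproduct lifts to a linear map into the free vector space
  (\<open>coproduct_eq\<close>), because multiplying the generator and the denominator by the bullet does not
  change the summands.
\<close>


section \<open>Cut-subquivers and contractions\<close>

text \<open>The cut-subquiver with a given set of edges.\<close>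

definition edge_sub :: "('v, 'e) mquiver \<Rightarrow> 'e set \<Rightarrow> ('v, 'e) mquiver" where
  "edge_sub G E = \<lparr>verts = verts G, edges = E, incid = restrict (incid G) E\<rparr>"

lemma edge_sub_simps [simp]:
  "verts (edge_sub G E) = verts G" "edges (edge_sub G E) = E"
  "incid (edge_sub G E) = restrict (incid G) E"
  by (simp_all add: edge_sub_def)

lemma contract_simps [simp]:
  "verts (contract G H) = verts G // conn_rel H" "edges (contract G H) = edges G - edges H"
  "incid (contract G H) = restrict (map_ends (\<lambda>v. conn_rel H `` {v}) \<circ> incid G) (edges G - edges H)"
  by (simp_all add: contract_def)

lemma disj_union_simps [simp]:
  "verts (disj_union G G') = verts G <+> verts G'" "edges (disj_union G G') = edges G <+> edges G'"
  by (simp_all add: disj_union_def)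

lemma bij_betw_edge_sub: "bij_betw (edge_sub G) (Pow (edges G)) {H. H \<preceq> G}"
proof (rule bij_betw_byWitness[where f' = edges])
  show "edge_sub G ` Pow (edges G) \<subseteq> {H. H \<preceq> G}" by (auto simp: cut_sub_def)
  show "edges ` {H. H \<preceq> G} \<subseteq> Pow (edges G)" by (auto simp: cut_sub_def)
  show "\<forall>H\<in>{H. H \<preceq> G}. edge_sub G (edges H) = H"
    by (auto simp: cut_sub_def edge_sub_def)
qed auto

lemma sum_cut_sub: "(\<Sum>H\<in>{H. H \<preceq> G}. f H) = (\<Sum>E\<in>Pow (edges G). f (edge_sub G E))"
  by (rule sum.reindex_bij_betw[OF bij_betw_edge_sub, symmetric])

lemma finite_cut_sub: "finite (edges G) \<Longrightarrow> finite {H. H \<preceq> G}"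
  using bij_betw_finite[OF bij_betw_edge_sub, of G] by simp

lemma mixed_quiver_edge_sub:
  "mixed_quiver G \<Longrightarrow> E \<subseteq> edges G \<Longrightarrow> mixed_quiver (edge_sub G E)"
  by (auto simp: mixed_quiver_def dest: finite_subset)

lemma mixed_quiver_finite: "mixed_quiver G \<Longrightarrow> finite (edges G)" "mixed_quiver G \<Longrightarrow> finite (verts G)"
  by (auto simp: mixed_quiver_def)

lemma mixed_quiver_cut_sub: "mixed_quiver G \<Longrightarrow> H \<preceq> G \<Longrightarrow> mixed_quiver H"
  by (auto simp: cut_sub_def mixed_quiver_def dest: finite_subset)

lemma ends_set_map_ends: "ends_set (map_ends f x) = f ` ends_set x"
  by (cases x) (auto simp: ends_set_def map_ends_def)

lemma ends_set_subset: "x \<in> ends_space X \<Longrightarrow> ends_set x \<subseteq> X"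
  by (cases x) (auto simp: ends_set_def ends_space_def)

text \<open>Predicates on the vertices that are constant on the ends of each edge.\<close>

definition edge_invariant :: "('v, 'e) mquiver \<Rightarrow> ('v \<Rightarrow> bool) \<Rightarrow> bool" where
  "edge_invariant H P \<longleftrightarrow> (\<forall>e\<in>edges H. \<forall>x\<in>ends_set (incid H e). \<forall>y\<in>ends_set (incid H e). P x = P y)"

lemma edge_invariantD:
  "edge_invariant H P \<Longrightarrow> e \<in> edges H \<Longrightarrow> x \<in> ends_set (incid H e) \<Longrightarrow> y \<in> ends_set (incid H e) \<Longrightarrow> P x = P y"
  unfolding edge_invariant_def by blast

lemma edge_invariant_pullback:
  assumes "edge_invariant H' P"
    and "\<And>e. e \<in> edges H \<Longrightarrow> \<exists>e'\<in>edges H'. h ` ends_set (incid H e) \<subseteq> ends_set (incid H' e')"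
  shows "edge_invariant H (\<lambda>v. P (h v))"
  unfolding edge_invariant_def
proof (intro ballI)
  fix e x y assume *: "e \<in> edges H" "x \<in> ends_set (incid H e)" "y \<in> ends_set (incid H e)"
  obtain e' where "e' \<in> edges H'" "h ` ends_set (incid H e) \<subseteq> ends_set (incid H' e')"
    using assms(2)[OF *(1)] by blast
  then show "P (h x) = P (h y)"
    using edge_invariantD[OF assms(1), of e' "h x" "h y"] *(2,3) by blast
qed

text \<open>Two vertices are connected if and only if no invariant predicate separates them; for the
  converse, being connected to \<open>u\<close> is itself an invariant predicate.\<close>

lemma conn_rel_iff:
  assumes "mixed_quiver H"
  shows "(u, v) \<in> conn_rel H \<longleftrightarrow>
    u \<in> verts H \<and> v \<in> verts H \<and> (\<forall>P. edge_invariant H P \<longrightarrow> P u = P v)"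
proof -
  define S where "S = (\<Union>e\<in>edges H. ends_set (incid H e) \<times> ends_set (incid H e))"
  have R: "conn_rel H = Id_on (verts H) \<union> S\<^sup>+" by (simp add: conn_rel_def S_def)
  have sub: "S \<subseteq> verts H \<times> verts H"
    unfolding S_def using ends_set_subset[OF incid_in[OF assms]] by blast
  have step: "P u = P v" if "edge_invariant H P" "(u, v) \<in> S" for P u v
    using that edge_invariantD[OF that(1)] unfolding S_def by blast
  have inv: "P u = P v" if "edge_invariant H P" "(u, v) \<in> S\<^sup>+" for P u v
    using that(2) by induction (use step[OF that(1)] in metis)+
  show ?thesis
  proof (intro iffI conjI)
    assume uv: "(u, v) \<in> conn_rel H"
    show "u \<in> verts H" "v \<in> verts H" using uv trancl_subset_Sigma[OF sub] unfolding R by blast+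
    show "\<forall>P. edge_invariant H P \<longrightarrow> P u = P v" using uv inv unfolding R by blast
  next
    assume *: "u \<in> verts H \<and> v \<in> verts H \<and> (\<forall>P. edge_invariant H P \<longrightarrow> P u = P v)"
    have "edge_invariant H (\<lambda>x. (u, x) \<in> conn_rel H)"
      unfolding edge_invariant_def
    proof (intro ballI)
      have "(u, y) \<in> conn_rel H"
        if "e \<in> edges H" "x \<in> ends_set (incid H e)" "y \<in> ends_set (incid H e)" "(u, x) \<in> conn_rel H" for e x y
      proof -
        have "(x, y) \<in> S" using that by (auto simp: S_def)
        then show ?thesis
          using that(4) trancl_into_trancl[of u x S y] r_into_trancl[of x y S] unfolding R by blast
      qed
      then show "((u, x) \<in> conn_rel H) = ((u, y) \<in> conn_rel H)"
        if "e \<in> edges H" "x \<in> ends_set (incid H e)" "y \<in> ends_set (incid H e)" for e x y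
        using that by blast
    qed
    moreover have "(u, u) \<in> conn_rel H" using * by (auto simp: R)
    ultimately show "(u, v) \<in> conn_rel H" using * by blast
  qed
qed

lemma equiv_conn_rel:
  assumes "mixed_quiver H"
  shows "equiv (verts H) (conn_rel H)"
  by (rule equivI) (auto simp: refl_on_def sym_def trans_def conn_rel_iff[OF assms])

lemma conn_class_eq_iff:
  assumes "mixed_quiver H" "u \<in> verts H" "v \<in> verts H"
  shows "conn_rel H `` {u} = conn_rel H `` {v} \<longleftrightarrow> (\<forall>P. edge_invariant H P \<longrightarrow> P u = P v)"
  using eq_equiv_class_iff[OF equiv_conn_rel[OF assms(1)] assms(2,3)] conn_rel_iff[OF assms(1)] assms
  by simp

lemma quotient_eq_image: "A // r = (\<lambda>v. r `` {v}) ` A"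
  by (auto simp: quotient_def)

lemma mixed_quiver_contract:
  assumes "mixed_quiver G" "verts H = verts G"
  shows "mixed_quiver (contract G H)"
  unfolding mixed_quiver_def
proof (intro conjI)
  show "finite (verts (contract G H))" "finite (edges (contract G H))"
    using assms(1) by (auto simp: mixed_quiver_def quotient_def)
  show "incid (contract G H) \<in> edges (contract G H) \<rightarrow>\<^sub>E ends_space (verts (contract G H))"
    using incid_in[OF assms(1)]
    by (auto intro!: map_ends_in[of _ "verts G"] simp: quotient_def)
qed

text \<open>The contraction of \<open>G\<close> by \<open>H\<close> is characterized up to isomorphism by a surjection \<open>p\<close> on the
  vertices whose fibres are the components of \<open>H\<close>, and by a compatible bijection on the edges
  outside \<open>H\<close>.\<close>

lemma quiver_iso_contract:
  fixes p :: "'v \<Rightarrow> 'w"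
  assumes G: "mixed_quiver G" "mixed_quiver H" "verts H = verts G"
    and p: "p ` verts G = verts Q"
    and ker: "\<And>u v. u \<in> verts G \<Longrightarrow> v \<in> verts G \<Longrightarrow>
        p u = p v \<longleftrightarrow> (\<forall>P. edge_invariant H P \<longrightarrow> P u = P v)"
    and g: "bij_betw g (edges G - edges H) (edges Q)"
    and inc: "\<And>e. e \<in> edges G - edges H \<Longrightarrow> incid Q (g e) = map_ends p (incid G e)"
  shows "quiver_iso (contract G H) Q"
proof -
  define c where "c v = conn_rel H `` {v}" for v
  have eq: "c u = c v \<longleftrightarrow> p u = p v" if "u \<in> verts G" "v \<in> verts G" for u v
    using conn_class_eq_iff[OF G(2)] ker that by (simp add: c_def G(3))
  have verts: "verts (contract G H) = c ` verts G" by (auto simp: quotient_def c_def)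
  define f where "f X = p (inv_into (verts G) c X)" for X
  have f: "f (c v) = p v" if "v \<in> verts G" for v
    using eq[of "inv_into (verts G) c (c v)" v] that
    by (simp add: f_def inv_into_into f_inv_into_f)
  have "bij_betw f (verts (contract G H)) (verts Q)"
    unfolding bij_betw_def verts using f p eq by (auto simp: inj_on_def image_iff) (metis imageE)+
  moreover have "incid Q (g e) = map_ends f (incid (contract G H) e)" if "e \<in> edges (contract G H)" for e
  proof -
    have e: "e \<in> edges G - edges H" using that by simp
    have "map_ends f (incid (contract G H) e) = map_ends (f \<circ> c) (incid G e)"
      using e by (simp add: map_ends_comp c_def[abs_def])
    also have "\<dots> = map_ends p (incid G e)"
      by (rule map_ends_cong[OF incid_in[OF G(1)]]) (use e f in auto)
    finally show ?thesis using inc[OF e] by simp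
  qed
  ultimately show ?thesis unfolding quiver_iso_def using g by auto
qed

lemma contract_iso_transport:
  assumes G: "mixed_quiver G" "mixed_quiver G'"
    and f: "bij_betw f (verts G) (verts G')" and g: "bij_betw g (edges G) (edges G')"
    and inc: "\<And>e. e \<in> edges G \<Longrightarrow> incid G' (g e) = map_ends f (incid G e)"
    and E: "E \<subseteq> edges G"
  shows "quiver_iso (edge_sub G E) (edge_sub G' (g ` E))"
    and "quiver_iso (contract G (edge_sub G E)) (contract G' (edge_sub G' (g ` E)))"
proof -
  have gE: "g ` E \<subseteq> edges G'" using g E by (metis bij_betw_imp_surj_on image_mono)
  have gb: "bij_betw g E (g ` E)" using g E by (rule bij_betw_subset) simp
  have gd: "bij_betw g (edges G - E) (edges G' - g ` E)"
    using g E inj_on_image_set_diff[of g "edges G" "edges G" E]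
    by (simp add: bij_betw_def inj_on_diff)
  show "quiver_iso (edge_sub G E) (edge_sub G' (g ` E))"
    unfolding quiver_iso_def using f gb inc E by (intro exI[of _ f] exI[of _ g]) auto
  let ?H = "edge_sub G E" and ?H' = "edge_sub G' (g ` E)"
  define f' where "f' = inv_into (verts G) f"
  have f': "f' (f v) = v" if "v \<in> verts G" for v
    using f that by (simp add: f'_def bij_betw_inv_into_left)
  note mq = mixed_quiver_edge_sub[OF G(1) E] mixed_quiver_edge_sub[OF G(2) gE]
  have ends: "ends_set (incid G' (g e)) = f ` ends_set (incid G e)" if "e \<in> E" for e
    using inc that E by (auto simp: ends_set_map_ends)
  have endsV: "ends_set (incid G e) \<subseteq> verts G" if "e \<in> E" for e
    using ends_set_subset[OF incid_in[OF G(1)]] that E by blast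
  show "quiver_iso (contract G ?H) (contract G' ?H')"
  proof (rule quiver_iso_contract[where p = "\<lambda>v. conn_rel ?H' `` {f v}" and g = g])
    show "(\<lambda>v. conn_rel ?H' `` {f v}) ` verts G = verts (contract G' ?H')"
      by (simp add: quotient_eq_image image_image flip: bij_betw_imp_surj_on[OF f])
    fix u v assume uv: "u \<in> verts G" "v \<in> verts G"
    have inv: "edge_invariant ?H (\<lambda>v. P (f v))" if "edge_invariant ?H' P" for P
      by (rule edge_invariant_pullback[OF that]) (use ends in auto)
    have inv': "edge_invariant ?H' (\<lambda>v. P (f' v))" if "edge_invariant ?H P" for P
    proof (rule edge_invariant_pullback[OF that])
      fix e assume "e \<in> edges ?H'"
      then obtain d where d: "d \<in> E" "e = g d" by auto
      have "f' ` f ` ends_set (incid G d) \<subseteq> ends_set (incid G d)"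
        using f' endsV[OF d(1)] by (auto simp: subset_iff)
      then show "\<exists>e'\<in>edges ?H. f' ` ends_set (incid ?H' e) \<subseteq> ends_set (incid ?H e')"
        using d ends by (intro bexI[of _ d]) simp_all
    qed
    have "conn_rel ?H' `` {f u} = conn_rel ?H' `` {f v} \<longleftrightarrow> (\<forall>P. edge_invariant ?H' P \<longrightarrow> P (f u) = P (f v))"
      using f uv by (intro conn_class_eq_iff mq) (auto simp: bij_betw_def)
    also have "\<dots> \<longleftrightarrow> (\<forall>P. edge_invariant ?H P \<longrightarrow> P u = P v)"
      using inv inv' f' uv by metis
    finally show "conn_rel ?H' `` {f u} = conn_rel ?H' `` {f v} \<longleftrightarrow> \<dots>" .
  next
    show "bij_betw g (edges G - edges ?H) (edges (contract G' ?H'))"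
      using gd by simp
  next
    fix e assume "e \<in> edges G - edges ?H"
    moreover from this have "g e \<in> edges G' - g ` E" using bij_betwE[OF gd] by simp
    ultimately show "incid (contract G' ?H') (g e) = map_ends (\<lambda>v. conn_rel ?H' `` {f v}) (incid G e)"
      using inc by (simp add: map_ends_comp o_def)
  qed (use G mq in simp_all)
qed

lemma contract_empty_iso:
  assumes "mixed_quiver G"
  shows "quiver_iso (contract G (edge_sub G {})) G"
proof (rule quiver_iso_contract[where p = id and g = id])
  fix u v
  show "id u = id v \<longleftrightarrow> (\<forall>P. edge_invariant (edge_sub G {}) P \<longrightarrow> P u = P v)"
    by (auto simp: edge_invariant_def)
qed (use assms in \<open>auto simp: map_ends_id mixed_quiver_edge_sub\<close>)

lemma contract_contract_iso:
  assumes G: "mixed_quiver G" and KL: "K \<subseteq> edges G" "L \<subseteq> edges G - K"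
  shows "quiver_iso (contract G (edge_sub G (K \<union> L)))
    (contract (contract G (edge_sub G K)) (edge_sub (contract G (edge_sub G K)) L))"
proof -
  let ?K = "edge_sub G K" and ?M = "edge_sub G (K \<union> L)"
  let ?Q = "contract G ?K"
  let ?L = "edge_sub ?Q L"
  define c where "c v = conn_rel ?K `` {v}" for v
  define d where "d X = conn_rel ?L `` {X}" for X
  have mK: "mixed_quiver ?K" and mM: "mixed_quiver ?M"
    using G KL by (auto intro!: mixed_quiver_edge_sub)
  have mQ: "mixed_quiver ?Q" using G by (simp add: mixed_quiver_contract)
  have mL: "mixed_quiver ?L" using mQ KL by (auto intro!: mixed_quiver_edge_sub)
  have vQ: "verts ?Q = c ` verts G" by (auto simp: quotient_def c_def)
  have endsV: "ends_set (incid G e) \<subseteq> verts G" if "e \<in> edges G" for e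
    using ends_set_subset[OF incid_in[OF G that]] .
  have ends: "ends_set (incid ?L e) = c ` ends_set (incid G e)" if "e \<in> L" for e
    using that KL by (auto simp: ends_set_map_ends c_def)
  show ?thesis
  proof (rule quiver_iso_contract[where p = "d \<circ> c" and g = id])
    show "(d \<circ> c) ` verts G = verts (contract ?Q ?L)"
      unfolding image_comp[symmetric] vQ[symmetric] by (auto simp: quotient_def d_def)
    fix u v assume uv: "u \<in> verts G" "v \<in> verts G"
    have inv: "edge_invariant ?M (\<lambda>v. P (c v))" if "edge_invariant ?L P" for P
      unfolding edge_invariant_def
    proof (intro ballI)
      fix e x y assume *: "e \<in> edges ?M" "x \<in> ends_set (incid ?M e)" "y \<in> ends_set (incid ?M e)"
      then have xy: "x \<in> verts G" "y \<in> verts G" using endsV[of e] KL by auto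
      show "P (c x) = P (c y)"
      proof (cases "e \<in> K")
        case True
        then have "c x = c y"
          unfolding c_def using * xy edge_invariantD[of ?K _ e x y]
          by (subst conn_class_eq_iff[OF mK]) simp_all
        then show ?thesis by simp
      next
        case False
        then have e: "e \<in> L" using *(1) by simp
        have "c x \<in> ends_set (incid ?L e)" "c y \<in> ends_set (incid ?L e)"
          unfolding ends[OF e] using * e by simp_all
        moreover have "e \<in> edges ?L" using e by simp
        ultimately show ?thesis by (intro edge_invariantD[OF that])
      qed
    qed
    \<comment> \<open>A predicate that is constant on the components of \<open>K\<close> descends to the contraction by \<open>K\<close>.\<close>
    have inv': "\<exists>P'. edge_invariant ?L P' \<and> (\<forall>v\<in>verts G. P' (c v) = P v)" if P: "edge_invariant ?M P" for P
    proof -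
      have PK: "edge_invariant ?K P" using P by (auto simp: edge_invariant_def)
      define P' where "P' X = P (inv_into (verts G) c X)" for X
      have P': "P' (c v) = P v" if "v \<in> verts G" for v
      proof -
        let ?w = "inv_into (verts G) c (c v)"
        have "?w \<in> verts G" "c ?w = c v" using that by (auto simp: inv_into_into f_inv_into_f)
        then show ?thesis
          using that PK unfolding P'_def c_def by (subst (asm) conn_class_eq_iff[OF mK]) auto
      qed
      moreover have "edge_invariant ?L P'"
        unfolding edge_invariant_def
      proof (intro ballI)
        fix e X Y assume *: "e \<in> edges ?L" "X \<in> ends_set (incid ?L e)" "Y \<in> ends_set (incid ?L e)"
        then have e: "e \<in> L" by simp
        from *(2,3) obtain x y
          where xy: "x \<in> ends_set (incid G e)" "y \<in> ends_set (incid G e)" "X = c x" "Y = c y"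
          unfolding ends[OF e] by blast
        have "P x = P y" by (rule edge_invariantD[OF P, of e]) (use xy e in simp_all)
        moreover have "x \<in> verts G" "y \<in> verts G" using xy e endsV[of e] KL by auto
        ultimately show "P' X = P' Y" using P' xy by simp
      qed
      ultimately show ?thesis by blast
    qed
    have "(d \<circ> c) u = (d \<circ> c) v \<longleftrightarrow> (\<forall>P. edge_invariant ?L P \<longrightarrow> P (c u) = P (c v))"
      unfolding d_def comp_def using uv vQ by (intro conn_class_eq_iff mL) auto
    also have "\<dots> \<longleftrightarrow> (\<forall>P. edge_invariant ?M P \<longrightarrow> P u = P v)"
      using inv inv' uv by metis
    finally show "(d \<circ> c) u = (d \<circ> c) v \<longleftrightarrow> \<dots>" .
  next
    fix e assume "e \<in> edges G - edges ?M"
    then show "incid (contract ?Q ?L) (id e) = map_ends (d \<circ> c) (incid G e)"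
      by (simp add: map_ends_comp[symmetric] c_def[abs_def] d_def[abs_def])
  next
    show "bij_betw id (edges G - edges ?M) (edges (contract ?Q ?L))"
      by (auto simp: bij_betw_def)
  qed (use G mM KL in auto)
qed

text \<open>Contracting inside a subquiver gives a subquiver of the contraction. This is an equality and
  not only an isomorphism, because the vertex classes depend on the contracted edges only.\<close>

lemma contract_edge_sub_edge_sub:
  assumes "K \<subseteq> E" "E \<subseteq> edges G"
  shows "contract (edge_sub G E) (edge_sub (edge_sub G E) K) = edge_sub (contract G (edge_sub G K)) (E - K)"
proof -
  have eq: "edge_sub (edge_sub G E) K = edge_sub G K"
    using assms by (simp add: edge_sub_def restrict_restrict Int_absorb1)
  show ?thesis
    unfolding eq using assms by (simp add: contract_def edge_sub_def fun_eq_iff subset_iff)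
qed

lemma edge_sub_disj_union:
  "edge_sub (disj_union G G') (E <+> E') = disj_union (edge_sub G E) (edge_sub G' E')" if "E \<subseteq> edges G" "E' \<subseteq> edges G'"
  using that by (auto simp: edge_sub_def disj_union_def fun_eq_iff restrict_def subset_iff split: sum.split)

lemma contract_disj_union_iso:
  assumes G: "mixed_quiver G" "mixed_quiver G'" and E: "E \<subseteq> edges G" "E' \<subseteq> edges G'"
  shows "quiver_iso (contract (disj_union G G') (edge_sub (disj_union G G') (E <+> E')))
    (disj_union (contract G (edge_sub G E)) (contract G' (edge_sub G' E')))"
proof -
  let ?D = "disj_union G G'" and ?H = "edge_sub G E" and ?H' = "edge_sub G' E'"
  let ?S = "edge_sub ?D (E <+> E')"
  define c where "c v = conn_rel ?H `` {v}" for v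
  define c' where "c' v = conn_rel ?H' `` {v}" for v
  have mD: "mixed_quiver ?D" using G by (rule mixed_quiver_disj_union)
  have mS: "mixed_quiver ?S" using mD E by (auto intro!: mixed_quiver_edge_sub)
  have mH: "mixed_quiver ?H" "mixed_quiver ?H'" using G E by (auto intro!: mixed_quiver_edge_sub)
  have inv: "edge_invariant ?S P \<longleftrightarrow> edge_invariant ?H (P \<circ> Inl) \<and> edge_invariant ?H' (P \<circ> Inr)" for P
    using E by (simp add: edge_invariant_def disj_union_def subset_iff ends_set_map_ends ball_Un Plus_def)
  show ?thesis
  proof (rule quiver_iso_contract[where p = "map_sum c c'" and g = id])
    show "map_sum c c' ` verts ?D = verts (disj_union (contract G ?H) (contract G' ?H'))"
      by (auto simp: quotient_def c_def c'_def Plus_def image_Un image_image)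
    fix u v assume uv: "u \<in> verts ?D" "v \<in> verts ?D"
    have triv: "edge_invariant H (\<lambda>_. True)" for H :: "('x, 'y) mquiver"
      by (simp add: edge_invariant_def)
    have Inl: "c a = c b \<longleftrightarrow> (\<forall>P. edge_invariant ?S P \<longrightarrow> P (Inl a) = P (Inl b))"
      if "a \<in> verts G" "b \<in> verts G" for a b
    proof -
      have "edge_invariant ?H P \<Longrightarrow> \<exists>P'. edge_invariant ?S P' \<and> (\<forall>x. P' (Inl x) = P x)" for P
        unfolding inv by (rule exI[of _ "case_sum P (\<lambda>_. True)"]) (simp add: triv case_sum_o_inj)
      moreover have "edge_invariant ?S P \<Longrightarrow> edge_invariant ?H (\<lambda>x. P (Inl x))" for P
        unfolding inv comp_def by blast
      ultimately have "(\<forall>P. edge_invariant ?H P \<longrightarrow> P a = P b) \<longleftrightarrow>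
          (\<forall>P. edge_invariant ?S P \<longrightarrow> P (Inl a) = P (Inl b))"
        by (smt (verit))
      then show ?thesis unfolding c_def using conn_class_eq_iff[OF mH(1)] that by simp
    qed
    have Inr: "c' a = c' b \<longleftrightarrow> (\<forall>P. edge_invariant ?S P \<longrightarrow> P (Inr a) = P (Inr b))"
      if "a \<in> verts G'" "b \<in> verts G'" for a b
    proof -
      have "edge_invariant ?H' P \<Longrightarrow> \<exists>P'. edge_invariant ?S P' \<and> (\<forall>x. P' (Inr x) = P x)" for P
        unfolding inv by (rule exI[of _ "case_sum (\<lambda>_. True) P"]) (simp add: triv case_sum_o_inj)
      moreover have "edge_invariant ?S P \<Longrightarrow> edge_invariant ?H' (\<lambda>x. P (Inr x))" for P
        unfolding inv comp_def by blast
      ultimately have "(\<forall>P. edge_invariant ?H' P \<longrightarrow> P a = P b) \<longleftrightarrow>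
          (\<forall>P. edge_invariant ?S P \<longrightarrow> P (Inr a) = P (Inr b))"
        by (smt (verit))
      then show ?thesis unfolding c'_def using conn_class_eq_iff[OF mH(2)] that by simp
    qed
    \<comment> \<open>The predicate that separates the two summands.\<close>
    have isl: "edge_invariant ?S isl" unfolding inv by (simp add: edge_invariant_def)
    show "map_sum c c' u = map_sum c c' v \<longleftrightarrow> (\<forall>P. edge_invariant ?S P \<longrightarrow> P u = P v)"
      using uv unfolding disj_union_simps
      by (elim PlusE; simp add: Inl Inr; intro exI[of _ isl]; simp add: isl)
  next
    show "bij_betw id (edges ?D - edges ?S) (edges (disj_union (contract G ?H) (contract G' ?H')))"
      by (auto simp: bij_betw_def)
  next
    fix e assume e: "e \<in> edges ?D - edges ?S"
    have comp: "map_sum f g \<circ> Inl = Inl \<circ> f" "map_sum f g \<circ> Inr = Inr \<circ> g"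
      for f :: "'a \<Rightarrow> 'a set" and g :: "'c \<Rightarrow> 'c set"
      by auto
    show "incid (disj_union (contract G ?H) (contract G' ?H')) (id e) = map_ends (map_sum c c') (incid ?D e)"
      using e by (cases e) (auto simp: disj_union_def map_ends_comp comp c_def[abs_def] c'_def[abs_def])
  qed (use mD mS in auto)
qed


section \<open>Summation over the cuts of an isomorphism class\<close>

text \<open>The sum over all cuts \<open>H\<close> of a representative \<open>G\<close> of the class, where \<open>f\<close> is applied to the
  classes of \<open>H\<close> and of \<open>G/H\<close>. The representative does not matter, and it may have any types of
  vertices and edges (\<open>cut_sum_class\<close>).\<close>

definition cut_sum :: "iso_class \<Rightarrow> (iso_class \<Rightarrow> iso_class \<Rightarrow> 'b) \<Rightarrow> 'b::comm_monoid_add" where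
  "cut_sum C f = (\<Sum>H\<in>{H. H \<preceq> quiver_rep C}. f (quiver_class H) (quiver_class (contract (quiver_rep C) H)))"

lemma quiver_class_eqI:
  "quiver_iso G G' \<Longrightarrow> mixed_quiver G \<Longrightarrow> mixed_quiver G' \<Longrightarrow> quiver_class G = quiver_class G'"
  using quiver_class_eq_iff by blast

lemma cut_sum_class:
  assumes G: "mixed_quiver G"
  shows "cut_sum (quiver_class G) f = (\<Sum>H\<in>{H. H \<preceq> G}. f (quiver_class H) (quiver_class (contract G H)))"
proof -
  let ?Q = "quiver_rep (quiver_class G)"
  have Q: "mixed_quiver ?Q" by (rule quiver_rep)
  have "quiver_iso G ?Q" using quiver_class_eq_iff[OF G Q] quiver_rep(2) by metis
  then obtain h g where hg: "bij_betw h (verts G) (verts ?Q)" "bij_betw g (edges G) (edges ?Q)"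
    "\<And>e. e \<in> edges G \<Longrightarrow> incid ?Q (g e) = map_ends h (incid G e)"
    unfolding quiver_iso_def by blast
  have eq: "quiver_class (edge_sub ?Q (g ` E)) = quiver_class (edge_sub G E)"
    "quiver_class (contract ?Q (edge_sub ?Q (g ` E))) = quiver_class (contract G (edge_sub G E))"
    if E: "E \<subseteq> edges G" for E
  proof -
    have gE: "g ` E \<subseteq> edges ?Q" using hg(2) E by (metis bij_betw_imp_surj_on image_mono)
    show "quiver_class (edge_sub ?Q (g ` E)) = quiver_class (edge_sub G E)"
      by (rule quiver_class_eqI[OF contract_iso_transport(1)[OF G Q hg E], symmetric])
        (use G Q E gE in \<open>simp_all add: mixed_quiver_edge_sub\<close>)
    show "quiver_class (contract ?Q (edge_sub ?Q (g ` E))) = quiver_class (contract G (edge_sub G E))"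
      by (rule quiver_class_eqI[OF contract_iso_transport(2)[OF G Q hg E], symmetric])
        (use G Q E gE in \<open>simp_all add: mixed_quiver_contract\<close>)
  qed
  have "cut_sum (quiver_class G) f =
      (\<Sum>E\<in>Pow (edges ?Q). f (quiver_class (edge_sub ?Q E)) (quiver_class (contract ?Q (edge_sub ?Q E))))"
    by (simp add: cut_sum_def sum_cut_sub)
  also have "\<dots> = (\<Sum>E\<in>Pow (edges G). f (quiver_class (edge_sub ?Q (g ` E)))
      (quiver_class (contract ?Q (edge_sub ?Q (g ` E)))))"
    by (rule sum.reindex_bij_betw[OF bij_betw_Pow[OF hg(2)], symmetric])
  also have "\<dots> = (\<Sum>E\<in>Pow (edges G). f (quiver_class (edge_sub G E)) (quiver_class (contract G (edge_sub G E))))"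
    using eq by (intro sum.cong refl) auto
  finally show ?thesis by (simp add: sum_cut_sub)
qed

lemma cut_sum_edges:
  "mixed_quiver G \<Longrightarrow> cut_sum (quiver_class G) f =
    (\<Sum>E\<in>Pow (edges G). f (quiver_class (edge_sub G E)) (quiver_class (contract G (edge_sub G E))))"
  by (simp add: cut_sum_class sum_cut_sub)

lemma iso_class_cases: obtains G :: "(nat, nat) mquiver" where "mixed_quiver G" "C = quiver_class G"
  using quiver_rep by metis

lemma cut_sum_hom:
  assumes "h 0 = 0" "\<And>x y. h (x + y) = h x + h y"
  shows "h (cut_sum C f) = cut_sum C (\<lambda>A B. h (f A B))"
proof -
  have "h (sum g X) = sum (h \<circ> g) X" for g and X :: "'x set"
    by (induction X rule: infinite_finite_induct) (auto simp: assms)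
  then show ?thesis by (simp add: cut_sum_def)
qed

lemma cut_sum_plus_distrib: "cut_sum C (\<lambda>A B. f A B + g A B) = cut_sum C f + cut_sum C g"
  by (simp add: cut_sum_def sum.distrib)

lemma cut_sum_mult_left: "cut_sum C (\<lambda>A B. c * f A B) = c * cut_sum C f" for f :: "_ \<Rightarrow> _ \<Rightarrow> 'a::comm_ring_1"
  by (simp add: cut_sum_def sum_distrib_left)

lemma cut_sum_mult_right: "cut_sum C (\<lambda>A B. f A B * c) = cut_sum C f * c" for f :: "_ \<Rightarrow> _ \<Rightarrow> 'a::comm_ring_1"
  by (simp add: cut_sum_def sum_distrib_right)

lemma cut_sum_plus:
  "cut_sum (C + D) f = cut_sum C (\<lambda>A B. cut_sum D (\<lambda>A' B'. f (A + A') (B + B')))"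
proof -
  obtain G :: "(nat, nat) mquiver" where G: "mixed_quiver G" "C = quiver_class G" by (rule iso_class_cases)
  obtain G' :: "(nat, nat) mquiver" where G': "mixed_quiver G'" "D = quiver_class G'" by (rule iso_class_cases)
  let ?D = "disj_union G G'"
  have bij: "bij_betw (\<lambda>(E, E'). E <+> E') (Pow (edges G) \<times> Pow (edges G')) (Pow (edges ?D))"
    by (rule bij_betw_byWitness[where f' = "\<lambda>S. (Inl -` S, Inr -` S)"]) auto
  have "cut_sum (C + D) f =
      (\<Sum>S\<in>Pow (edges ?D). f (quiver_class (edge_sub ?D S)) (quiver_class (contract ?D (edge_sub ?D S))))"
    unfolding G(2) G'(2) quiver_class_disj_union[OF G(1) G'(1), symmetric]
    by (rule cut_sum_edges[OF mixed_quiver_disj_union[OF G(1) G'(1)]])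
  also have "\<dots> = (\<Sum>(E, E')\<in>Pow (edges G) \<times> Pow (edges G').
      f (quiver_class (edge_sub ?D (E <+> E'))) (quiver_class (contract ?D (edge_sub ?D (E <+> E')))))"
    by (subst sum.reindex_bij_betw[OF bij, symmetric]) (simp add: case_prod_unfold)
  also have "\<dots> = (\<Sum>(E, E')\<in>Pow (edges G) \<times> Pow (edges G').
      f (quiver_class (edge_sub G E) + quiver_class (edge_sub G' E'))
        (quiver_class (contract G (edge_sub G E)) + quiver_class (contract G' (edge_sub G' E'))))"
  proof (intro sum.cong refl, clarify)
    fix E E' assume E: "E \<subseteq> edges G" "E' \<subseteq> edges G'"
    note m = mixed_quiver_edge_sub[OF G(1) E(1)] mixed_quiver_edge_sub[OF G'(1) E(2)]
      mixed_quiver_disj_union[OF G(1) G'(1)] mixed_quiver_contract mixed_quiver_disj_union G(1) G'(1)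
    have "quiver_class (contract ?D (edge_sub ?D (E <+> E'))) =
        quiver_class (disj_union (contract G (edge_sub G E)) (contract G' (edge_sub G' E')))"
      by (rule quiver_class_eqI[OF contract_disj_union_iso[OF G(1) G'(1) E]]) (simp_all add: m)
    then show "f (quiver_class (edge_sub ?D (E <+> E'))) (quiver_class (contract ?D (edge_sub ?D (E <+> E')))) =
      f (quiver_class (edge_sub G E) + quiver_class (edge_sub G' E'))
        (quiver_class (contract G (edge_sub G E)) + quiver_class (contract G' (edge_sub G' E')))"
      by (simp add: edge_sub_disj_union[OF E] quiver_class_disj_union m)
  qed
  also have "\<dots> = cut_sum C (\<lambda>A B. cut_sum D (\<lambda>A' B'. f (A + A') (B + B')))"
    by (simp add: G G' cut_sum_edges sum.cartesian_product)
  finally show ?thesis .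
qed

lemma cut_sum_coassoc:
  "cut_sum C (\<lambda>A B. cut_sum A (\<lambda>K L. f K L B)) = cut_sum C (\<lambda>A B. cut_sum B (\<lambda>L M. f A L M))"
proof -
  obtain G :: "(nat, nat) mquiver" where G: "mixed_quiver G" "C = quiver_class G" by (rule iso_class_cases)
  define s where "s = edge_sub G"
  define q where "q E = contract G (s E)" for E
  have m: "mixed_quiver (s E)" "mixed_quiver (q E)" if "E \<subseteq> edges G" for E
    using G that by (auto simp: s_def q_def mixed_quiver_edge_sub mixed_quiver_contract)
  \<comment> \<open>Both sides become sums of \<open>F K L\<close> over pairs of disjoint edge sets.\<close>
  define F where "F K L = f (quiver_class (s K)) (quiver_class (edge_sub (q K) L)) (quiver_class (q (K \<union> L)))" for K L
  have 1: "cut_sum (quiver_class (s E)) (\<lambda>K L. f K L (quiver_class (q E))) =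
      (\<Sum>K\<in>Pow E. F K (E - K))" if E: "E \<subseteq> edges G" for E
    unfolding cut_sum_edges[OF m(1)[OF E]]
  proof (rule sum.cong)
    show "Pow (edges (s E)) = Pow E" by (simp add: s_def)
    fix K assume K: "K \<in> Pow E"
    then have "edge_sub (s E) K = s K" by (simp add: s_def edge_sub_def restrict_restrict Int_absorb1)
    moreover have "contract (s E) (edge_sub (s E) K) = edge_sub (q K) (E - K)"
      using contract_edge_sub_edge_sub[of K E G] K E by (simp add: s_def q_def)
    moreover have "K \<union> (E - K) = E" using K by auto
    ultimately show "f (quiver_class (edge_sub (s E) K))
        (quiver_class (contract (s E) (edge_sub (s E) K))) (quiver_class (q E)) = F K (E - K)"
      by (simp add: F_def)
  qed
  have 2: "cut_sum (quiver_class (q K)) (\<lambda>L M. f (quiver_class (s K)) L M) =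
      (\<Sum>L\<in>Pow (edges G - K). F K L)" if K: "K \<subseteq> edges G" for K
    unfolding cut_sum_edges[OF m(2)[OF K]]
  proof (rule sum.cong)
    show "Pow (edges (q K)) = Pow (edges G - K)" by (simp add: s_def q_def)
    fix L assume L: "L \<in> Pow (edges G - K)"
    have "quiver_class (contract (q K) (edge_sub (q K) L)) = quiver_class (q (K \<union> L))"
      unfolding q_def s_def
      by (rule quiver_class_eqI[OF contract_contract_iso[OF G(1) K], symmetric])
        (use L G in \<open>simp_all add: mixed_quiver_contract\<close>)
    then show "f (quiver_class (s K)) (quiver_class (edge_sub (q K) L))
        (quiver_class (contract (q K) (edge_sub (q K) L))) = F K L"
      by (simp add: F_def)
  qed
  have bij: "bij_betw (\<lambda>(E, K). (K, E - K)) (Sigma (Pow (edges G)) Pow)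
      (Sigma (Pow (edges G)) (\<lambda>K. Pow (edges G - K)))"
    by (rule bij_betw_byWitness[where f' = "\<lambda>(K, L). (K \<union> L, K)"]) auto
  have fin: "finite (edges G)" using G by (simp add: mixed_quiver_def)
  have "cut_sum C (\<lambda>A B. cut_sum A (\<lambda>K L. f K L B)) = (\<Sum>E\<in>Pow (edges G). \<Sum>K\<in>Pow E. F K (E - K))"
    unfolding G(2) cut_sum_edges[OF G(1)] by (rule sum.cong) (use 1 in \<open>auto simp: s_def q_def\<close>)
  also have "\<dots> = (\<Sum>(E, K)\<in>Sigma (Pow (edges G)) Pow. F K (E - K))"
    using fin by (intro sum.Sigma) (auto intro: finite_subset)
  also have "\<dots> = (\<Sum>(K, L)\<in>Sigma (Pow (edges G)) (\<lambda>K. Pow (edges G - K)). F K L)"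
    by (subst sum.reindex_bij_betw[OF bij, symmetric]) (simp add: case_prod_unfold)
  also have "\<dots> = (\<Sum>K\<in>Pow (edges G). \<Sum>L\<in>Pow (edges G - K). F K L)"
    using fin by (intro sum.Sigma[symmetric]) auto
  also have "\<dots> = cut_sum C (\<lambda>A B. cut_sum B (\<lambda>L M. f A L M))"
    unfolding G(2) cut_sum_edges[OF G(1)] by (rule sum.cong) (use 2 in \<open>auto simp: s_def q_def\<close>)
  finally show ?thesis .
qed

text \<open>The number of edges of a class.\<close>

definition nedges :: "iso_class \<Rightarrow> nat" where
  "nedges C = card (edges (quiver_rep C))"

lemma nedges_class:
  assumes "mixed_quiver G"
  shows "nedges (quiver_class G) = card (edges G)"
proof -
  have "quiver_iso G (quiver_rep (quiver_class G))"
    using quiver_class_eq_iff[OF assms] quiver_rep by metis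
  then show ?thesis unfolding nedges_def quiver_iso_def by (auto dest: bij_betw_same_card)
qed

lemma nedges_plus: "nedges (C + D) = nedges C + nedges D"
proof -
  obtain G :: "(nat, nat) mquiver" where G: "mixed_quiver G" "C = quiver_class G" by (rule iso_class_cases)
  obtain G' :: "(nat, nat) mquiver" where G': "mixed_quiver G'" "D = quiver_class G'" by (rule iso_class_cases)
  have "quiver_class (disj_union G G') = C + D"
    using G G' by (simp add: quiver_class_disj_union)
  then show ?thesis
    using G G' mixed_quiver_disj_union[OF G(1) G'(1)]
    by (metis nedges_class disj_union_simps(2) card_Plus mixed_quiver_finite(1))
qed

text \<open>The class of \<open>n\<close> isolated vertices.\<close>

definition points :: "nat \<Rightarrow> iso_class" where
  "points n = ((+) (quiver_class point_quiver) ^^ n) 0"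

lemma points_simps [simp]: "points 0 = 0" "points (Suc n) = quiver_class point_quiver + points n"
  by (simp_all add: points_def)

lemma mixed_quiver_empty: "mixed_quiver empty_quiver"
  by (simp add: empty_quiver_def mixed_quiver_def)

lemma mixed_quiver_point: "mixed_quiver point_quiver"
  by (simp add: point_quiver_def mixed_quiver_def)

lemma nedges_zero [simp]: "nedges 0 = 0"
  using nedges_class[OF mixed_quiver_empty] by (simp add: zero_iso_class_def empty_quiver_def)

lemma nedges_point [simp]: "nedges (quiver_class point_quiver) = 0"
  using nedges_class[OF mixed_quiver_point] by (simp add: point_quiver_def)

lemma nedges_points [simp]: "nedges (points n) = 0"
  by (induction n) (simp_all add: nedges_plus)

lemma edgeless_iso:
  assumes "edges G = {}" "edges G' = {}" "finite (verts G)" "finite (verts G')" "card (verts G) = card (verts G')"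
  shows "quiver_iso G G'"
proof -
  obtain h where "bij_betw h (verts G) (verts G')" using assms finite_same_card_bij by blast
  then show ?thesis
    unfolding quiver_iso_def using assms by (intro exI[of _ h] exI[of _ undefined]) (simp add: bij_betw_def)
qed

lemma class_edgeless:
  assumes "mixed_quiver G" "edges G = {}"
  shows "quiver_class G = points (card (verts G))"
proof -
  \<comment> \<open>A standard edgeless quiver with \<open>n\<close> vertices.\<close>
  define P :: "nat \<Rightarrow> (nat, nat) mquiver" where "P n = \<lparr>verts = {..<n}, edges = {}, incid = \<lambda>_. undefined\<rparr>" for n
  have P: "mixed_quiver (P n)" for n by (simp add: P_def mixed_quiver_def)
  have "quiver_class (P n) = points n" for n
  proof (induction n)
    case 0
    have "P 0 = empty_quiver" by (simp add: P_def empty_quiver_def)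
    then show ?case by (simp add: zero_iso_class_def)
  next
    case (Suc n)
    have "quiver_iso (P (Suc n)) (disj_union point_quiver (P n))"
      by (rule edgeless_iso) (auto simp: P_def point_quiver_def card_Plus)
    then have "quiver_class (P (Suc n)) = quiver_class (disj_union point_quiver (P n))"
      by (rule quiver_class_eqI) (simp_all add: P mixed_quiver_disj_union mixed_quiver_point)
    then show ?case by (simp add: quiver_class_disj_union P mixed_quiver_point Suc)
  qed
  moreover have "quiver_iso G (P (card (verts G)))"
    using assms by (intro edgeless_iso) (auto simp: P_def mixed_quiver_def)
  ultimately show ?thesis using assms P by (metis quiver_class_eq_iff)
qed

text \<open>The number of vertices of a class.\<close>

definition nverts :: "iso_class \<Rightarrow> nat" where
  "nverts C = card (verts (quiver_rep C))"

text \<open>The number of connected components of a class: the number of vertices that remain when all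
  edges are contracted.\<close>

definition ncomps :: "iso_class \<Rightarrow> nat" where
  "ncomps C = card (verts (contract (quiver_rep C) (quiver_rep C)))"

lemma edge_sub_edges:
  assumes "mixed_quiver G"
  shows "edge_sub G (edges G) = G"
proof -
  have "restrict (incid G) (edges G) = incid G"
    using assms by (auto simp: mixed_quiver_def intro: extensional_restrict simp: PiE_def)
  then show ?thesis by (simp add: edge_sub_def)
qed

text \<open>The unique cut without edges on the left is \<open>(\<bullet>\<^sup>n, C)\<close> with \<open>n\<close> the number of vertices, and the
  unique cut without edges on the right is \<open>(C, \<bullet>\<^sup>k)\<close> with \<open>k\<close> the number of components.\<close>

lemma cut_sum_left_points:
  "cut_sum C (\<lambda>A B. if nedges A = 0 then f A B else 0) = f (points (nverts C)) C"
proof -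
  let ?G = "quiver_rep C"
  have G: "mixed_quiver ?G" "quiver_class ?G = C" by (rule quiver_rep)+
  have fin: "finite (edges ?G)" using G by (simp add: mixed_quiver_def)
  have "cut_sum C (\<lambda>A B. if nedges A = 0 then f A B else 0) =
      (\<Sum>E\<in>Pow (edges ?G). if E = {} then f (quiver_class (edge_sub ?G E)) (quiver_class (contract ?G (edge_sub ?G E))) else 0)"
    unfolding cut_sum_edges[OF G(1), unfolded G(2)]
  proof (rule sum.cong[OF refl])
    fix E assume E: "E \<in> Pow (edges ?G)"
    then have "finite E" using fin by (auto intro: finite_subset)
    then show "(if nedges (quiver_class (edge_sub ?G E)) = 0
        then f (quiver_class (edge_sub ?G E)) (quiver_class (contract ?G (edge_sub ?G E))) else 0) =
      (if E = {} then f (quiver_class (edge_sub ?G E)) (quiver_class (contract ?G (edge_sub ?G E))) else 0)"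
      using E G by (simp add: nedges_class mixed_quiver_edge_sub)
  qed
  also have "\<dots> = f (quiver_class (edge_sub ?G {})) (quiver_class (contract ?G (edge_sub ?G {})))"
    using fin by (simp add: sum.delta)
  also have "quiver_class (edge_sub ?G {}) = points (nverts C)"
    using class_edgeless[of "edge_sub ?G {}"] G by (simp add: mixed_quiver_edge_sub nverts_def)
  also have "quiver_class (contract ?G (edge_sub ?G {})) = C"
    using quiver_class_eqI[OF contract_empty_iso[OF G(1)] mixed_quiver_contract[OF G(1)] G(1)] G(2) by simp
  finally show ?thesis .
qed

lemma cut_sum_right_points:
  "cut_sum C (\<lambda>A B. if nedges B = 0 then f A B else 0) = f C (points (ncomps C))"
proof -
  let ?G = "quiver_rep C"
  have G: "mixed_quiver ?G" "quiver_class ?G = C" by (rule quiver_rep)+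
  have fin: "finite (edges ?G)" using G by (simp add: mixed_quiver_def)
  have "cut_sum C (\<lambda>A B. if nedges B = 0 then f A B else 0) =
      (\<Sum>E\<in>Pow (edges ?G). if E = edges ?G then f (quiver_class (edge_sub ?G E)) (quiver_class (contract ?G (edge_sub ?G E))) else 0)"
    unfolding cut_sum_edges[OF G(1), unfolded G(2)]
  proof (rule sum.cong[OF refl])
    fix E assume E: "E \<in> Pow (edges ?G)"
    then have "edges ?G - E = {} \<longleftrightarrow> E = edges ?G" by auto
    then show "(if nedges (quiver_class (contract ?G (edge_sub ?G E))) = 0
        then f (quiver_class (edge_sub ?G E)) (quiver_class (contract ?G (edge_sub ?G E))) else 0) =
      (if E = edges ?G then f (quiver_class (edge_sub ?G E)) (quiver_class (contract ?G (edge_sub ?G E))) else 0)"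
      using fin G by (simp add: nedges_class mixed_quiver_contract)
  qed
  also have "\<dots> = f (quiver_class ?G) (quiver_class (contract ?G ?G))"
    using fin G(1) by (simp add: sum.delta edge_sub_edges)
  also have "quiver_class (contract ?G ?G) = points (ncomps C)"
    using class_edgeless[of "contract ?G ?G"] G by (simp add: mixed_quiver_contract ncomps_def)
  finally show ?thesis by (simp add: G)
qed

lemma nedges_cut:
  assumes "H \<preceq> quiver_rep C"
  shows "nedges (quiver_class H) + nedges (quiver_class (contract (quiver_rep C) H)) = nedges C"
proof -
  let ?G = "quiver_rep C"
  have G: "mixed_quiver ?G" by (rule quiver_rep)
  have H: "edges H \<subseteq> edges ?G" "verts H = verts ?G" using assms by (auto simp: cut_sub_def)
  have "card (edges H) + card (edges ?G - edges H) = card (edges ?G)"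
    using H mixed_quiver_finite[OF G] by (simp add: card_Diff_subset card_mono finite_subset)
  then show ?thesis
    using G H mixed_quiver_cut_sub[OF G assms]
    by (simp add: nedges_class mixed_quiver_contract nedges_def[of C])
qed

text \<open>As a congruence rule for function definitions, this provides the decrease of the number of
  edges that the termination of \<open>antipode_class\<close> needs.\<close>

lemma cut_sum_cong [fundef_cong]:
  assumes "C = D" "\<And>A B. nedges A + nedges B = nedges D \<Longrightarrow> f A B = g A B"
  shows "cut_sum C f = cut_sum D g"
  unfolding cut_sum_def assms(1) by (intro sum.cong refl assms(2)) (simp add: nedges_cut)

lemma cut_sum_closed:
  assumes "P 0" "\<And>x y. P x \<Longrightarrow> P y \<Longrightarrow> P (x + y)"
    and "\<And>A B. nedges A + nedges B = nedges C \<Longrightarrow> P (f A B)"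
  shows "P (cut_sum C f)"
proof -
  have "P (sum g X)" if "\<And>x. x \<in> X \<Longrightarrow> P (g x)" for g and X :: "'x set"
    using that by (induction X rule: infinite_finite_induct) (auto simp: assms(1,2))
  then show ?thesis unfolding cut_sum_def using assms(3) nedges_cut by (metis (no_types, lifting) mem_Collect_eq)
qed

lemma cut_sum_edgeless:
  assumes "nedges C = 0"
  shows "cut_sum C f = f C C"
proof -
  have C: "C = points (nverts C)"
    using assms class_edgeless[OF quiver_rep(1)] quiver_rep(1)[of C]
    by (simp add: nedges_def nverts_def quiver_rep(2) mixed_quiver_def)
  have "cut_sum C f = cut_sum C (\<lambda>A B. if nedges A = 0 then f A B else 0)"
    by (rule cut_sum_cong) (use assms in auto)
  then show ?thesis by (simp add: cut_sum_left_points flip: C)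
qed


section \<open>Modules and linear maps\<close>

abbreviation kmodule :: "('k::field, 'a) module \<Rightarrow> bool" where
  "kmodule M \<equiv> Module.module base_algebra M"

lemma type_algebra_simps [simp]:
  "carrier (type_algebra s) = UNIV" "mult (type_algebra s) = (*)" "one (type_algebra s) = 1"
  "ring.zero (type_algebra s) = 0" "add (type_algebra s) = (+)" "smult (type_algebra s) = s"
  by (simp_all add: type_algebra_def)

lemma cring_type_algebra: "cring (type_algebra s :: ('k, 'a::comm_ring_1) module)"
proof (rule cringI)
  show "abelian_group (type_algebra s :: ('k, 'a) module)"
    by (rule abelian_groupI) (auto simp: algebra_simps intro: exI[of _ "- x" for x])
  show "Group.comm_monoid (type_algebra s :: ('k, 'a) module)"
    by (rule comm_monoidI) (auto simp: algebra_simps)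
qed (auto simp: algebra_simps)

lemma algebra_type_algebra:
  fixes s :: "'k::field \<Rightarrow> 'a::comm_ring_1 \<Rightarrow> 'a"
  assumes "Modules.module s" "\<And>c x y. s c x * y = s c (x * y)"
  shows "algebra base_algebra (type_algebra s)"
  using assms
  by (intro algebraI cring_type_algebra)
    (simp_all add: module.scale_left_distrib module.scale_right_distrib module.scale_scale module.scale_one)

lemma finsum_type_algebra:
  fixes f :: "'x \<Rightarrow> 'a::comm_ring_1" and s :: "'k \<Rightarrow> 'a \<Rightarrow> 'a"
  shows "finsum (type_algebra s) f A = sum f A"
proof -
  interpret cring "type_algebra s :: ('k, 'a) module" by (rule cring_type_algebra)
  show ?thesis by (induction A rule: infinite_finite_induct) (simp_all add: finsum_infinite)
qed

lemma linear_mapI: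
  assumes "\<And>x. x \<in> carrier M \<Longrightarrow> f x \<in> carrier N"
    "\<And>x y. x \<in> carrier M \<Longrightarrow> y \<in> carrier M \<Longrightarrow> f (x \<oplus>\<^bsub>M\<^esub> y) = f x \<oplus>\<^bsub>N\<^esub> f y"
    "\<And>c x. x \<in> carrier M \<Longrightarrow> f (c \<odot>\<^bsub>M\<^esub> x) = c \<odot>\<^bsub>N\<^esub> f x"
  shows "linear_map M N f"
  using assms by (simp add: linear_map_def)

lemma linear_mapD:
  assumes "linear_map M N f"
  shows "x \<in> carrier M \<Longrightarrow> f x \<in> carrier N"
    "x \<in> carrier M \<Longrightarrow> y \<in> carrier M \<Longrightarrow> f (x \<oplus>\<^bsub>M\<^esub> y) = f x \<oplus>\<^bsub>N\<^esub> f y"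
    "x \<in> carrier M \<Longrightarrow> f (c \<odot>\<^bsub>M\<^esub> x) = c \<odot>\<^bsub>N\<^esub> f x"
  using assms by (auto simp: linear_map_def)

lemma linear_map_compose:
  "linear_map M N f \<Longrightarrow> linear_map N P g \<Longrightarrow> linear_map M P (\<lambda>x. g (f x))"
  by (auto simp: linear_map_def Pi_iff)

lemma linear_map_id: "linear_map M M id"
  by (simp add: linear_map_def)

text \<open>Linearity in each argument separately, where the arguments range over the carriers.\<close>

definition bilinear_map :: "('k::field, 'a) module \<Rightarrow> ('k, 'b) module \<Rightarrow> ('k, 'c) module \<Rightarrow> ('a \<Rightarrow> 'b \<Rightarrow> 'c) \<Rightarrow> bool" where
  "bilinear_map M N P f \<longleftrightarrow>
     (\<forall>y\<in>carrier N. linear_map M P (\<lambda>x. f x y)) \<and> (\<forall>x\<in>carrier M. linear_map N P (f x))"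

lemma bilinear_mapD:
  assumes "bilinear_map M N P f" "x \<in> carrier M" "y \<in> carrier N"
  shows "f x y \<in> carrier P"
    "x' \<in> carrier M \<Longrightarrow> f (x \<oplus>\<^bsub>M\<^esub> x') y = f x y \<oplus>\<^bsub>P\<^esub> f x' y"
    "y' \<in> carrier N \<Longrightarrow> f x (y \<oplus>\<^bsub>N\<^esub> y') = f x y \<oplus>\<^bsub>P\<^esub> f x y'"
    "f (c \<odot>\<^bsub>M\<^esub> x) y = c \<odot>\<^bsub>P\<^esub> f x y" "f x (c \<odot>\<^bsub>N\<^esub> y) = c \<odot>\<^bsub>P\<^esub> f x y"
  using assms unfolding bilinear_map_def by (auto simp: linear_map_def)

lemma bilinear_map_linear_left: "bilinear_map M N P f \<Longrightarrow> y \<in> carrier N \<Longrightarrow> linear_map M P (\<lambda>x. f x y)"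
  by (simp add: bilinear_map_def)

lemma bilinear_map_compose:
  assumes "bilinear_map M N P f" "linear_map M' M g" "linear_map N' N h"
  shows "bilinear_map M' N' P (\<lambda>x y. f (g x) (h y))"
  using assms unfolding bilinear_map_def
  by (auto intro: linear_map_compose dest: linear_mapD(1) intro!: linear_map_compose[where f = g and g = "\<lambda>x. f x y" for y])


section \<open>Free vector spaces\<close>

lemma lookup_pm_scale [simp]: "Poly_Mapping.lookup (pm_scale c t) p = c * Poly_Mapping.lookup t p"
  by transfer (simp add: when_def)

lemma pm_scale_single [simp]: "pm_scale c (Poly_Mapping.single p d) = Poly_Mapping.single p (c * d)"
  by (rule poly_mapping_eqI) (simp add: lookup_single when_def)

lemma module_pm_scale: "Modules.module (pm_scale :: 'k::field \<Rightarrow> ('x \<Rightarrow>\<^sub>0 'k) \<Rightarrow> _)"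
  by unfold_locales (auto intro!: poly_mapping_eqI simp: lookup_add algebra_simps)

interpretation pm: Modules.module "pm_scale :: 'k::field \<Rightarrow> ('x \<Rightarrow>\<^sub>0 'k) \<Rightarrow> _"
  by (rule module_pm_scale)

lemma keys_pm_scale: "Poly_Mapping.keys (pm_scale c t) \<subseteq> Poly_Mapping.keys t"
  by (auto simp: in_keys_iff)

lemma sum_single_keys:
  assumes "finite A" "Poly_Mapping.keys t \<subseteq> A"
  shows "(\<Sum>p\<in>A. Poly_Mapping.single p (Poly_Mapping.lookup t p)) = t"
proof (rule poly_mapping_eqI)
  fix q
  have "Poly_Mapping.lookup (\<Sum>p\<in>A. Poly_Mapping.single p (Poly_Mapping.lookup t p)) q =
      (\<Sum>p\<in>A. if p = q then Poly_Mapping.lookup t p else 0)"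
    by (simp add: lookup_sum lookup_single when_def)
  also have "\<dots> = Poly_Mapping.lookup t q"
    using assms by (auto simp: sum.delta in_keys_iff)
  finally show "Poly_Mapping.lookup (\<Sum>p\<in>A. Poly_Mapping.single p (Poly_Mapping.lookup t p)) q = Poly_Mapping.lookup t q" .
qed

lemma free_induct [consumes 1, case_names zero single add]:
  fixes t :: "'x \<Rightarrow>\<^sub>0 'k::field"
  assumes "Poly_Mapping.keys t \<subseteq> X" "P 0" "\<And>x c. x \<in> X \<Longrightarrow> P (Poly_Mapping.single x c)"
    "\<And>t u. Poly_Mapping.keys t \<subseteq> X \<Longrightarrow> Poly_Mapping.keys u \<subseteq> X \<Longrightarrow> P t \<Longrightarrow> P u \<Longrightarrow> P (t + u)"
  shows "P t"
proof -
  have "finite A \<Longrightarrow> A \<subseteq> X \<Longrightarrow>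
      Poly_Mapping.keys (\<Sum>p\<in>A. Poly_Mapping.single p (Poly_Mapping.lookup t p)) \<subseteq> X \<and>
      P (\<Sum>p\<in>A. Poly_Mapping.single p (Poly_Mapping.lookup t p))" for A
  proof (induction A rule: finite_induct)
    case (insert a A)
    moreover have "Poly_Mapping.keys (Poly_Mapping.single a (Poly_Mapping.lookup t a)) \<subseteq> X"
      using insert by simp
    moreover have "Poly_Mapping.keys (u + v) \<subseteq> X" if "Poly_Mapping.keys u \<subseteq> X" "Poly_Mapping.keys v \<subseteq> X"
      for u v :: "'x \<Rightarrow>\<^sub>0 'k" using that keys_add[of u v] by blast
    ultimately show ?case using assms(3,4) by simp
  qed (simp add: assms(2))
  from this[of "Poly_Mapping.keys t"] show ?thesis using assms(1) by (simp add: sum_single_keys)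
qed

text \<open>The linear extension of \<open>f\<close> from the basis to the free vector space.\<close>

definition lin_eval :: "('k::field, 'c) module \<Rightarrow> ('x \<Rightarrow> 'c) \<Rightarrow> ('x \<Rightarrow>\<^sub>0 'k) \<Rightarrow> 'c" where
  "lin_eval P f t = (\<Oplus>\<^bsub>P\<^esub>p\<in>Poly_Mapping.keys t. Poly_Mapping.lookup t p \<odot>\<^bsub>P\<^esub> f p)"

context
  fixes P :: "('k::field, 'c) module" and f :: "'x \<Rightarrow> 'c" and X
  assumes P: "kmodule P" and f: "f ` X \<subseteq> carrier P"
begin

interpretation P: Module.module base_algebra P by (rule P)

lemma eval_closed: "x \<in> X \<Longrightarrow> f x \<in> carrier P" "x \<in> X \<Longrightarrow> c \<odot>\<^bsub>P\<^esub> f x \<in> carrier P"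
  using f P.smult_closed[of c "f x"] by auto

lemma lin_eval_superset:
  assumes "finite A" "A \<subseteq> X" "Poly_Mapping.keys t \<subseteq> A"
  shows "lin_eval P f t = (\<Oplus>\<^bsub>P\<^esub>p\<in>A. Poly_Mapping.lookup t p \<odot>\<^bsub>P\<^esub> f p)"
  unfolding lin_eval_def
proof (rule P.add.finprod_mono_neutral_cong_left[OF assms(1,3)])
  fix p assume "p \<in> A - Poly_Mapping.keys t"
  then have "f p \<in> carrier P" "Poly_Mapping.lookup t p = \<zero>\<^bsub>(base_algebra :: ('k, 'k) module)\<^esub>"
    using assms f by (auto simp: in_keys_iff)
  then show "Poly_Mapping.lookup t p \<odot>\<^bsub>P\<^esub> f p = \<zero>\<^bsub>P\<^esub>" using P.smult_l_null by metis
qed (use eval_closed assms in auto)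

lemma lin_eval_closed: "Poly_Mapping.keys t \<subseteq> X \<Longrightarrow> lin_eval P f t \<in> carrier P"
  unfolding lin_eval_def using eval_closed by (intro P.finsum_closed) auto

lemma lin_eval_zero: "lin_eval P f 0 = \<zero>\<^bsub>P\<^esub>"
  by (simp add: lin_eval_def)

lemma lin_eval_single: "x \<in> X \<Longrightarrow> lin_eval P f (Poly_Mapping.single x c) = c \<odot>\<^bsub>P\<^esub> f x"
  using f by (subst lin_eval_superset[of "{x}"]) auto

lemma lin_eval_add:
  assumes "Poly_Mapping.keys t \<subseteq> X" "Poly_Mapping.keys u \<subseteq> X"
  shows "lin_eval P f (t + u) = lin_eval P f t \<oplus>\<^bsub>P\<^esub> lin_eval P f u"
proof -
  let ?A = "Poly_Mapping.keys t \<union> Poly_Mapping.keys u"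
  have fA: "f p \<in> carrier P" if "p \<in> ?A" for p using that f assms by auto
  have A: "finite ?A" "?A \<subseteq> X" using assms by auto
  have "lin_eval P f (t + u) = (\<Oplus>\<^bsub>P\<^esub>p\<in>?A. Poly_Mapping.lookup (t + u) p \<odot>\<^bsub>P\<^esub> f p)"
    by (rule lin_eval_superset) (use A keys_add[of t u] in auto)
  also have "\<dots> = (\<Oplus>\<^bsub>P\<^esub>p\<in>?A. Poly_Mapping.lookup t p \<odot>\<^bsub>P\<^esub> f p \<oplus>\<^bsub>P\<^esub> Poly_Mapping.lookup u p \<odot>\<^bsub>P\<^esub> f p)"
  proof (rule P.finsum_cong')
    fix p assume "p \<in> ?A"
    then show "Poly_Mapping.lookup (t + u) p \<odot>\<^bsub>P\<^esub> f p =
        Poly_Mapping.lookup t p \<odot>\<^bsub>P\<^esub> f p \<oplus>\<^bsub>P\<^esub> Poly_Mapping.lookup u p \<odot>\<^bsub>P\<^esub> f p"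
      using fA P.smult_l_distr[of "Poly_Mapping.lookup t p" "Poly_Mapping.lookup u p" "f p"]
      by (simp add: lookup_add)
  qed (use fA in auto)
  also have "\<dots> = lin_eval P f t \<oplus>\<^bsub>P\<^esub> lin_eval P f u"
    using fA A by (subst P.finsum_addf) (auto simp: lin_eval_superset[of ?A])
  finally show ?thesis .
qed

lemma lin_eval_scale:
  assumes "Poly_Mapping.keys t \<subseteq> X"
  shows "lin_eval P f (pm_scale c t) = c \<odot>\<^bsub>P\<^esub> lin_eval P f t"
proof -
  have fA: "f p \<in> carrier P" if "p \<in> Poly_Mapping.keys t" for p using that f assms by auto
  have "lin_eval P f (pm_scale c t) = (\<Oplus>\<^bsub>P\<^esub>p\<in>Poly_Mapping.keys t. Poly_Mapping.lookup (pm_scale c t) p \<odot>\<^bsub>P\<^esub> f p)"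
    by (rule lin_eval_superset) (use assms keys_pm_scale[of c t] in auto)
  also have "\<dots> = (\<Oplus>\<^bsub>P\<^esub>p\<in>Poly_Mapping.keys t. c \<odot>\<^bsub>P\<^esub> (Poly_Mapping.lookup t p \<odot>\<^bsub>P\<^esub> f p))"
  proof (rule P.finsum_cong')
    fix p assume "p \<in> Poly_Mapping.keys t"
    then show "Poly_Mapping.lookup (pm_scale c t) p \<odot>\<^bsub>P\<^esub> f p = c \<odot>\<^bsub>P\<^esub> (Poly_Mapping.lookup t p \<odot>\<^bsub>P\<^esub> f p)"
      using fA P.smult_assoc1[of c "Poly_Mapping.lookup t p" "f p"] by simp
  qed (use fA in auto)
  also have "\<dots> = c \<odot>\<^bsub>P\<^esub> lin_eval P f t"
    unfolding lin_eval_def using fA by (subst P.finsum_smult_ldistr) auto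
  finally show ?thesis .
qed

end


section \<open>The tensor product\<close>

lemma mem_tensor_class: "u \<in> tensor_class M N t \<longleftrightarrow> u - t \<in> pm.span (bilinear_relations M N)"
  by (simp add: tensor_class_def)

lemma tensor_class_self: "t \<in> tensor_class M N t"
  by (simp add: mem_tensor_class pm.span_zero)

lemma tensor_class_eq_iff:
  "tensor_class M N t = tensor_class M N u \<longleftrightarrow> t - u \<in> pm.span (bilinear_relations M N)"
proof
  assume "tensor_class M N t = tensor_class M N u"
  then show "t - u \<in> pm.span (bilinear_relations M N)"
    using tensor_class_self[of t M N] mem_tensor_class by blast
next
  assume d: "t - u \<in> pm.span (bilinear_relations M N)"
  have "v - u \<in> pm.span (bilinear_relations M N) \<longleftrightarrow> v - t \<in> pm.span (bilinear_relations M N)" for v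
    using pm.span_add[OF _ d, of "v - t"] pm.span_diff[OF _ d, of "v - u"] by auto
  then show "tensor_class M N t = tensor_class M N u" by (auto simp: mem_tensor_class)
qed

lemma UN_tensor_class:
  assumes "\<And>u. u \<in> tensor_class M N t \<Longrightarrow> F u = F t"
  shows "(\<Union>u\<in>tensor_class M N t. F u) = F t"
  by (rule UN_constant_eq[OF tensor_class_self]) (use assms in simp)

lemma UN_UN_tensor_class:
  assumes "\<And>u v. u \<in> tensor_class M N t \<Longrightarrow> v \<in> tensor_class M' N' t' \<Longrightarrow> F u v = F t t'"
  shows "(\<Union>u\<in>tensor_class M N t. \<Union>v\<in>tensor_class M' N' t'. F u v) = F t t'"
proof -
  have "(\<Union>v\<in>tensor_class M' N' t'. F u v) = F t t'" if "u \<in> tensor_class M N t" for u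
    by (rule UN_constant_eq[OF tensor_class_self]) (use assms that in simp)
  then show ?thesis
    by (intro UN_constant_eq[OF tensor_class_self]) simp
qed

lemma tensor_add:
  "tensor_class M N t \<oplus>\<^bsub>tensor M N\<^esub> tensor_class M N u = tensor_class M N (t + u)"
proof -
  have "tensor_class M N (t' + u') = tensor_class M N (t + u)"
    if "t' \<in> tensor_class M N t" "u' \<in> tensor_class M N u" for t' u'
    using pm.span_add[OF that[unfolded mem_tensor_class]] by (simp add: tensor_class_eq_iff algebra_simps)
  then have "(\<Union>t'\<in>tensor_class M N t. \<Union>u'\<in>tensor_class M N u. tensor_class M N (t' + u')) = tensor_class M N (t + u)"
    by (rule UN_UN_tensor_class)
  then show ?thesis by (simp add: tensor_def)
qed

lemma tensor_smult: "c \<odot>\<^bsub>tensor M N\<^esub> tensor_class M N t = tensor_class M N (pm_scale c t)"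
proof -
  have "tensor_class M N (pm_scale c t') = tensor_class M N (pm_scale c t)" if "t' \<in> tensor_class M N t" for t'
    using pm.span_scale[OF that[unfolded mem_tensor_class], of c]
    by (simp add: tensor_class_eq_iff pm.scale_right_diff_distrib)
  then have "(\<Union>t'\<in>tensor_class M N t. tensor_class M N (pm_scale c t')) = tensor_class M N (pm_scale c t)"
    by (rule UN_tensor_class)
  then show ?thesis by (simp add: tensor_def)
qed

lemma tensor_carrier: "carrier (tensor M N) = tensor_class M N ` free_pairs M N"
  and tensor_zero: "\<zero>\<^bsub>tensor M N\<^esub> = tensor_class M N 0"
  and tensor_one: "\<one>\<^bsub>tensor M N\<^esub> = pure_tensor M N \<one>\<^bsub>M\<^esub> \<one>\<^bsub>N\<^esub>"
  by (simp_all add: tensor_def)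

lemma free_pairsD: "t \<in> free_pairs M N \<Longrightarrow> Poly_Mapping.keys t \<subseteq> carrier M \<times> carrier N"
  by (simp add: free_pairs_def)

lemma free_pairs_closed:
  "0 \<in> free_pairs M N" "t \<in> free_pairs M N \<Longrightarrow> u \<in> free_pairs M N \<Longrightarrow> t + u \<in> free_pairs M N"
  "t \<in> free_pairs M N \<Longrightarrow> pm_scale c t \<in> free_pairs M N"
  "x \<in> carrier M \<Longrightarrow> y \<in> carrier N \<Longrightarrow> Poly_Mapping.single (x, y) c \<in> free_pairs M N"
  using keys_add[of t u] keys_pm_scale[of c t] by (auto simp: free_pairs_def)

lemma free_pairs_diff: "t \<in> free_pairs M N \<Longrightarrow> u \<in> free_pairs M N \<Longrightarrow> t - u \<in> free_pairs M N"
  using free_pairs_closed(2)[of t M N "pm_scale (-1) u"] free_pairs_closed(3)[of u M N "-1"] by simp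

lemma free_pairs_sum: "(\<And>i. i \<in> I \<Longrightarrow> t i \<in> free_pairs M N) \<Longrightarrow> (\<Sum>i\<in>I. t i) \<in> free_pairs M N"
  by (induction I rule: infinite_finite_induct) (auto intro: free_pairs_closed)

text \<open>No assumption on the factors is needed: the carrier is the image of a subspace of a free
  vector space under the quotient map.\<close>

lemma kmodule_tensor: "kmodule (tensor M N)"
proof (rule moduleI)
  note s = tensor_add tensor_smult tensor_carrier tensor_zero
  show "cring (base_algebra :: ('a, 'a) module)" by (rule cring_type_algebra)
  show "abelian_group (tensor M N)"
  proof (rule abelian_groupI)
    fix T assume "T \<in> carrier (tensor M N)"
    then obtain t where t: "t \<in> free_pairs M N" "T = tensor_class M N t" by (auto simp: s)
    show "\<exists>U\<in>carrier (tensor M N). U \<oplus>\<^bsub>tensor M N\<^esub> T = \<zero>\<^bsub>tensor M N\<^esub>"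
      by (rule bexI[of _ "tensor_class M N (pm_scale (-1) t)"])
        (use t free_pairs_closed(3)[of t M N "-1"] in \<open>auto simp: s\<close>)
  qed (auto simp: s add_ac intro!: free_pairs_closed)
qed (auto simp: tensor_zero tensor_add tensor_smult tensor_carrier pm.scale_left_distrib pm.scale_right_distrib intro!: free_pairs_closed)

lemma finsum_tensor:
  assumes "finite I" "\<And>i. i \<in> I \<Longrightarrow> t i \<in> free_pairs M N"
  shows "(\<Oplus>\<^bsub>tensor M N\<^esub>i\<in>I. tensor_class M N (t i)) = tensor_class M N (\<Sum>i\<in>I. t i)"
proof -
  interpret T: Module.module base_algebra "tensor M N" by (rule kmodule_tensor)
  show ?thesis
    using assms
  proof (induction I rule: finite_induct)
    case (insert i I)
    then have "(\<lambda>i. tensor_class M N (t i)) \<in> I \<rightarrow> carrier (tensor M N)" by (auto simp: tensor_carrier)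
    then show ?case using insert by (simp add: T.finsum_insert tensor_add tensor_carrier)
  qed (simp add: tensor_zero)
qed

lemma pure_tensor_closed: "x \<in> carrier M \<Longrightarrow> y \<in> carrier N \<Longrightarrow> pure_tensor M N x y \<in> carrier (tensor M N)"
  by (auto simp: tensor_carrier pure_tensor_def intro: free_pairs_closed)

lemma smult_pure_tensor: "c \<odot>\<^bsub>tensor M N\<^esub> pure_tensor M N x y = tensor_class M N (Poly_Mapping.single (x, y) c)"
  by (simp add: pure_tensor_def tensor_smult)

lemma bilinear_relations_cases [consumes 1]:
  assumes "r \<in> bilinear_relations M N"
  obtains
    (1) u u' v where "r = gen (u \<oplus>\<^bsub>M\<^esub> u') v - gen u v - gen u' v" "u \<in> carrier M" "u' \<in> carrier M" "v \<in> carrier N"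
  | (2) u v v' where "r = gen u (v \<oplus>\<^bsub>N\<^esub> v') - gen u v - gen u v'" "u \<in> carrier M" "v \<in> carrier N" "v' \<in> carrier N"
  | (3) c u v where "r = gen (c \<odot>\<^bsub>M\<^esub> u) v - pm_scale c (gen u v)" "u \<in> carrier M" "v \<in> carrier N"
  | (4) c u v where "r = gen u (c \<odot>\<^bsub>N\<^esub> v) - pm_scale c (gen u v)" "u \<in> carrier M" "v \<in> carrier N"
  using assms unfolding bilinear_relations_def by blast

lemma bilinear_pure_tensor:
  "bilinear_map M N (tensor M N) (pure_tensor M N)"
proof -
  let ?R = "bilinear_relations M N"
  have "gen (x \<oplus>\<^bsub>M\<^esub> x') y - (gen x y + gen x' y) \<in> pm.span ?R"
    if "x \<in> carrier M" "x' \<in> carrier M" "y \<in> carrier N" for x x' y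
    using that unfolding diff_diff_eq[symmetric] bilinear_relations_def by (intro pm.span_base) blast
  moreover have "gen x (y \<oplus>\<^bsub>N\<^esub> y') - (gen x y + gen x y') \<in> pm.span ?R"
    if "x \<in> carrier M" "y \<in> carrier N" "y' \<in> carrier N" for x y y'
    using that unfolding diff_diff_eq[symmetric] bilinear_relations_def by (intro pm.span_base) blast
  moreover have "gen (c \<odot>\<^bsub>M\<^esub> x) y - pm_scale c (gen x y) \<in> pm.span ?R"
    if "x \<in> carrier M" "y \<in> carrier N" for c x y
    using that unfolding bilinear_relations_def by (intro pm.span_base) blast
  moreover have "gen x (c \<odot>\<^bsub>N\<^esub> y) - pm_scale c (gen x y) \<in> pm.span ?R"
    if "x \<in> carrier M" "y \<in> carrier N" for c x y
    using that unfolding bilinear_relations_def by (intro pm.span_base) blast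
  ultimately show ?thesis
    unfolding bilinear_map_def
    by (intro conjI ballI linear_mapI pure_tensor_closed)
      (simp_all add: pure_tensor_def tensor_add tensor_smult tensor_class_eq_iff)
qed

lemma linear_map_zero:
  assumes "linear_map M P f" "kmodule M" "kmodule P"
  shows "f \<zero>\<^bsub>M\<^esub> = \<zero>\<^bsub>P\<^esub>"
proof -
  interpret M: Module.module base_algebra M by (rule assms)
  interpret P: Module.module base_algebra P by (rule assms)
  show ?thesis
    using linear_mapD(3)[OF assms(1) M.zero_closed, of 0] linear_mapD(1)[OF assms(1) M.zero_closed]
      M.smult_l_null[OF M.zero_closed] P.smult_l_null by simp
qed

lemma linear_map_tensor_eqI:
  assumes g: "linear_map (tensor M N) P g" and h: "linear_map (tensor M N) P h" and P: "kmodule P"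
    and eq: "\<And>x y. x \<in> carrier M \<Longrightarrow> y \<in> carrier N \<Longrightarrow> g (pure_tensor M N x y) = h (pure_tensor M N x y)"
    and T: "T \<in> carrier (tensor M N)"
  shows "g T = h T"
proof -
  obtain t where t: "t \<in> free_pairs M N" "T = tensor_class M N t" using T by (auto simp: tensor_carrier)
  have "Poly_Mapping.keys t \<subseteq> carrier M \<times> carrier N" using t by (simp add: free_pairs_def)
  then have "g (tensor_class M N t) = h (tensor_class M N t)"
  proof (induction t rule: free_induct)
    case zero
    show ?case
      using linear_map_zero[OF g kmodule_tensor P] linear_map_zero[OF h kmodule_tensor P] by (simp add: tensor_zero)
  next
    case (single p c)
    then obtain x y where p: "p = (x, y)" "x \<in> carrier M" "y \<in> carrier N" by auto
    note pc = pure_tensor_closed[OF p(2,3)]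
    show ?case
      unfolding p(1) smult_pure_tensor[symmetric]
      by (simp add: linear_mapD(3)[OF g pc] linear_mapD(3)[OF h pc] eq p)
  next
    case (add t u)
    then have c: "tensor_class M N t \<in> carrier (tensor M N)" "tensor_class M N u \<in> carrier (tensor M N)"
      by (auto simp: tensor_carrier free_pairs_def)
    show ?case
      unfolding tensor_add[symmetric] by (simp add: linear_mapD(2)[OF g c] linear_mapD(2)[OF h c] add)
  qed
  then show ?thesis by (simp add: t)
qed

context
  fixes M :: "('k::field, 'a) module" and N :: "('k, 'b) module" and P :: "('k, 'c) module" and f
  assumes M: "kmodule M" and N: "kmodule N" and P: "kmodule P" and f: "bilinear_map M N P f"
begin

interpretation M: Module.module base_algebra M by (rule M)
interpretation N: Module.module base_algebra N by (rule N)
interpretation P: Module.module base_algebra P by (rule P)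

private abbreviation "X \<equiv> carrier M \<times> carrier N"
private abbreviation "ev \<equiv> lin_eval P (\<lambda>p. f (fst p) (snd p))"

lemma image_eval: "(\<lambda>p. f (fst p) (snd p)) ` X \<subseteq> carrier P"
  using bilinear_mapD(1)[OF f] by auto

lemmas ev_single = lin_eval_single[OF P image_eval]
  and ev_add = lin_eval_add[OF P image_eval free_pairsD free_pairsD]
  and ev_scale = lin_eval_scale[OF P image_eval free_pairsD]
  and ev_closed = lin_eval_closed[OF P image_eval free_pairsD]

lemma ev_gen: "x \<in> carrier M \<Longrightarrow> y \<in> carrier N \<Longrightarrow> ev (gen x y) = f x y"
  using bilinear_mapD(1)[OF f] P.smult_one by (simp add: ev_single)

lemma ev_diff:
  assumes "t \<in> free_pairs M N" "u \<in> free_pairs M N"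
  shows "ev (t - u) = \<zero>\<^bsub>P\<^esub> \<longleftrightarrow> ev t = ev u"
proof -
  note * = assms free_pairs_diff[OF assms]
  have "ev t = ev (t - u) \<oplus>\<^bsub>P\<^esub> ev u" using ev_add[OF *(3,2)] by simp
  then show ?thesis using ev_closed[OF *(1)] ev_closed[OF *(2)] ev_closed[OF *(3)]
    by (simp add: P.add.r_cancel_one)
qed

text \<open>Evaluation of a bilinear map annihilates the bilinearity relations, so it is well defined on
  cosets.\<close>

lemma eval_span:
  assumes "t \<in> pm.span (bilinear_relations M N)"
  shows "t \<in> free_pairs M N \<and> ev t = \<zero>\<^bsub>P\<^esub>"
  using assms
proof (induction rule: pm.span_induct)
  case base
  show ?case unfolding pm.subspace_def
    by (simp add: lin_eval_zero[OF P image_eval] ev_add ev_scale free_pairs_closed)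
next
  case (step t)
  have fc: "f x y \<in> carrier P" "c \<odot>\<^bsub>P\<^esub> f x y \<in> carrier P" if "x \<in> carrier M" "y \<in> carrier N" for x y c
    using bilinear_mapD(1)[OF f that] P.smult_closed[of c "f x y"] by auto
  have zeroI: "t - u \<in> free_pairs M N \<and> ev (t - u) = \<zero>\<^bsub>P\<^esub>"
    if "t \<in> free_pairs M N" "u \<in> free_pairs M N" "ev t = ev u" for t u
    using that ev_diff free_pairs_diff by blast
  have smc: "c \<odot>\<^bsub>M\<^esub> x \<in> carrier M" if "x \<in> carrier M" for c x using that M.smult_closed by simp
  have snc: "c \<odot>\<^bsub>N\<^esub> x \<in> carrier N" if "x \<in> carrier N" for c x using that N.smult_closed by simp
  have sm1: "1 \<odot>\<^bsub>P\<^esub> z = z" if "z \<in> carrier P" for z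
    using P.smult_one[OF that] by simp
  note fp = free_pairs_closed(2-4)
  note simps = ev_add ev_single sm1 fc bilinear_mapD[OF f] smc snc fp
  from step show ?case
  proof (cases rule: bilinear_relations_cases)
    case (1 u u' v)
    then show ?thesis unfolding 1(1) diff_diff_eq by (intro zeroI) (simp_all add: simps)
  next
    case (2 u v v')
    then show ?thesis unfolding 2(1) diff_diff_eq by (intro zeroI) (simp_all add: simps)
  next
    case (3 c u v)
    then show ?thesis unfolding 3(1) by (intro zeroI) (simp_all add: simps)
  next
    case (4 c u v)
    then show ?thesis unfolding 4(1) by (intro zeroI) (simp_all add: simps)
  qed
qed

lemma tensor_lift_class:
  assumes "t \<in> free_pairs M N"
  shows "tensor_lift P f (tensor_class M N t) = ev t"
proof -
  have "ev u = ev t" if "u \<in> tensor_class M N t" for u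
  proof -
    have *: "u - t \<in> free_pairs M N" "ev (u - t) = \<zero>\<^bsub>P\<^esub>" using eval_span that by (auto simp: mem_tensor_class)
    moreover have "u \<in> free_pairs M N" using free_pairs_closed(2)[OF *(1) assms] by simp
    ultimately show ?thesis using ev_diff assms by blast
  qed
  then have "ev ` tensor_class M N t = {ev t}" using tensor_class_self by blast
  then show ?thesis by (simp add: tensor_lift_def lin_eval_def)
qed

lemma tensor_lift_pure:
  "x \<in> carrier M \<Longrightarrow> y \<in> carrier N \<Longrightarrow> tensor_lift P f (pure_tensor M N x y) = f x y"
  by (simp add: pure_tensor_def tensor_lift_class free_pairs_closed ev_gen)

lemma linear_map_tensor_lift: "linear_map (tensor M N) P (tensor_lift P f)"
proof (rule linear_mapI)
  show "tensor_lift P f T \<in> carrier P" if "T \<in> carrier (tensor M N)" for T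
    using that by (auto simp: tensor_carrier tensor_lift_class intro!: ev_closed)
  show "tensor_lift P f (T \<oplus>\<^bsub>tensor M N\<^esub> U) = tensor_lift P f T \<oplus>\<^bsub>P\<^esub> tensor_lift P f U"
    if "T \<in> carrier (tensor M N)" "U \<in> carrier (tensor M N)" for T U
    using that by (auto simp: tensor_carrier tensor_add tensor_lift_class free_pairs_closed ev_add)
  show "tensor_lift P f (c \<odot>\<^bsub>tensor M N\<^esub> T) = c \<odot>\<^bsub>P\<^esub> tensor_lift P f T"
    if "T \<in> carrier (tensor M N)" for c T
    using that by (auto simp: tensor_carrier tensor_smult tensor_lift_class free_pairs_closed ev_scale)
qed

end

lemma linear_map_tensor_map:
  assumes "kmodule A" "kmodule B" "linear_map A M f" "linear_map B N g"
  shows "linear_map (tensor A B) (tensor M N) (tensor_map M N f g)"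
  unfolding tensor_map_def
  by (intro linear_map_tensor_lift assms kmodule_tensor bilinear_map_compose[OF bilinear_pure_tensor])

lemma tensor_map_pure:
  assumes "kmodule A" "kmodule B" "linear_map A M f" "linear_map B N g" "x \<in> carrier A" "y \<in> carrier B"
  shows "tensor_map M N f g (pure_tensor A B x y) = pure_tensor M N (f x) (g y)"
  unfolding tensor_map_def
  by (intro tensor_lift_pure assms kmodule_tensor bilinear_map_compose[OF bilinear_pure_tensor])

lemma linear_map_add:
  assumes P: "kmodule P" and f: "linear_map M P f" and g: "linear_map M P g"
  shows "linear_map M P (\<lambda>x. f x \<oplus>\<^bsub>P\<^esub> g x)"
proof -
  interpret P: Module.module base_algebra P by (rule P)
  show ?thesis
    by (rule linear_mapI)
      (simp_all add: linear_mapD[OF f] linear_mapD[OF g] P.add.m_ac P.smult_r_distr)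
qed

lemma linear_map_scale:
  assumes P: "kmodule P" and f: "linear_map M P f"
  shows "linear_map M P (\<lambda>x. c \<odot>\<^bsub>P\<^esub> f x)"
proof -
  interpret P: Module.module base_algebra P by (rule P)
  show ?thesis
    using P.smult_closed P.smult_assoc1[symmetric]
    by (intro linear_mapI) (simp_all add: linear_mapD[OF f] P.smult_r_distr mult.commute)
qed

context
  fixes L :: "('k::field, 'a) module" and M :: "('k, 'b) module" and N :: "('k, 'c) module"
  assumes L: "kmodule L" and M: "kmodule M" and N: "kmodule N"
begin

private abbreviation "Q \<equiv> tensor L (tensor M N)"
private abbreviation "inner z x y \<equiv> pure_tensor L (tensor M N) x (pure_tensor M N y z)"

lemma bilinear_inner: "z \<in> carrier N \<Longrightarrow> bilinear_map L M Q (inner z)"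
  using bilinear_map_compose[OF bilinear_pure_tensor linear_map_id
      bilinear_map_linear_left[OF bilinear_pure_tensor]]
  by simp

text \<open>The map to which the associator is the lift: it is linear in \<open>T\<close> as a lift, and in \<open>z\<close> because
  it is so on pure tensors \<open>T\<close>.\<close>

lemma bilinear_outer: "bilinear_map (tensor L M) N Q (\<lambda>T z. tensor_lift Q (inner z) T)"
proof -
  note lin = linear_map_tensor_lift[OF L M kmodule_tensor bilinear_inner]
  note pure = tensor_lift_pure[OF L M kmodule_tensor bilinear_inner]
  note pc = pure_tensor_closed
  interpret N: Module.module base_algebra N by (rule N)
  have smult: "c \<odot>\<^bsub>N\<^esub> z \<in> carrier N" if "z \<in> carrier N" for c z using that N.smult_closed by simp
  have "linear_map N Q (\<lambda>z. tensor_lift Q (inner z) T)" if T: "T \<in> carrier (tensor L M)" for T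
  proof (rule linear_mapI)
    fix z assume z: "z \<in> carrier N"
    show "tensor_lift Q (inner z) T \<in> carrier Q" using linear_mapD(1)[OF lin[OF z] T] .
    fix z' assume z': "z' \<in> carrier N"
    show "tensor_lift Q (inner (z \<oplus>\<^bsub>N\<^esub> z')) T = tensor_lift Q (inner z) T \<oplus>\<^bsub>Q\<^esub> tensor_lift Q (inner z') T"
      by (rule linear_map_tensor_eqI[OF lin linear_map_add[OF kmodule_tensor lin lin] kmodule_tensor _ T])
        (simp_all add: z z' pure pc bilinear_mapD[OF bilinear_pure_tensor])
  next
    fix c z assume z: "z \<in> carrier N"
    show "tensor_lift Q (inner (c \<odot>\<^bsub>N\<^esub> z)) T = c \<odot>\<^bsub>Q\<^esub> tensor_lift Q (inner z) T"
      by (rule linear_map_tensor_eqI[OF lin linear_map_scale[OF kmodule_tensor lin] kmodule_tensor _ T])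
        (simp_all add: z smult pure pc bilinear_mapD[OF bilinear_pure_tensor])
  qed
  then show ?thesis unfolding bilinear_map_def using lin by blast
qed

lemma linear_map_tensor_assoc: "linear_map (tensor (tensor L M) N) Q (tensor_assoc L M N)"
  unfolding tensor_assoc_def by (intro linear_map_tensor_lift kmodule_tensor N bilinear_outer)

lemma tensor_assoc_pure:
  assumes "x \<in> carrier L" "y \<in> carrier M" "z \<in> carrier N"
  shows "tensor_assoc L M N (pure_tensor (tensor L M) N (pure_tensor L M x y) z) = inner z x y"
  unfolding tensor_assoc_def
  using assms by (simp add: tensor_lift_pure[OF kmodule_tensor N kmodule_tensor bilinear_outer]
      tensor_lift_pure[OF L M kmodule_tensor bilinear_inner] pure_tensor_closed)

end


section \<open>Multiplication on a tensor product of algebras\<close>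

lemma free_mult_superset:
  assumes "finite A" "Poly_Mapping.keys t \<subseteq> A" "finite B" "Poly_Mapping.keys u \<subseteq> B"
  shows "free_mult M N t u = (\<Sum>p\<in>A. \<Sum>q\<in>B.
    Poly_Mapping.single (fst p \<otimes>\<^bsub>M\<^esub> fst q, snd p \<otimes>\<^bsub>N\<^esub> snd q) (Poly_Mapping.lookup t p * Poly_Mapping.lookup u q))"
proof -
  have "free_mult M N t u = (\<Sum>p\<in>Poly_Mapping.keys t. \<Sum>q\<in>Poly_Mapping.keys u.
    Poly_Mapping.single (fst p \<otimes>\<^bsub>M\<^esub> fst q, snd p \<otimes>\<^bsub>N\<^esub> snd q) (Poly_Mapping.lookup t p * Poly_Mapping.lookup u q))"
    by (simp add: free_mult_def case_prod_unfold)
  also have "\<dots> = (\<Sum>p\<in>Poly_Mapping.keys t. \<Sum>q\<in>B.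
    Poly_Mapping.single (fst p \<otimes>\<^bsub>M\<^esub> fst q, snd p \<otimes>\<^bsub>N\<^esub> snd q) (Poly_Mapping.lookup t p * Poly_Mapping.lookup u q))"
    by (intro sum.cong refl sum.mono_neutral_left assms) (auto simp: in_keys_iff)
  also have "\<dots> = (\<Sum>p\<in>A. \<Sum>q\<in>B.
    Poly_Mapping.single (fst p \<otimes>\<^bsub>M\<^esub> fst q, snd p \<otimes>\<^bsub>N\<^esub> snd q) (Poly_Mapping.lookup t p * Poly_Mapping.lookup u q))"
    by (intro sum.mono_neutral_left assms) (auto simp: in_keys_iff)
  finally show ?thesis .
qed

lemma free_mult_zero [simp]: "free_mult M N 0 u = 0" "free_mult M N t 0 = 0"
  by (simp_all add: free_mult_def)

lemma free_mult_single:
  "free_mult M N (Poly_Mapping.single (x, y) c) (Poly_Mapping.single (x', y') d) =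
    Poly_Mapping.single (x \<otimes>\<^bsub>M\<^esub> x', y \<otimes>\<^bsub>N\<^esub> y') (c * d)"
  by (subst free_mult_superset[of "{(x, y)}" _ "{(x', y')}"]) auto

lemma free_mult_add:
  "free_mult M N (t + u) v = free_mult M N t v + free_mult M N u v"
  "free_mult M N v (t + u) = free_mult M N v t + free_mult M N v u"
proof -
  let ?A = "Poly_Mapping.keys t \<union> Poly_Mapping.keys u" and ?B = "Poly_Mapping.keys v"
  note fm = free_mult_superset[of ?A _ ?B] free_mult_superset[of ?B _ ?A]
  show "free_mult M N (t + u) v = free_mult M N t v + free_mult M N u v"
    "free_mult M N v (t + u) = free_mult M N v t + free_mult M N v u"
    using keys_add[of t u] by (simp_all add: fm lookup_add algebra_simps single_add sum.distrib)
qed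

lemma free_mult_scale:
  "free_mult M N (pm_scale c t) u = pm_scale c (free_mult M N t u)"
  "free_mult M N t (pm_scale c u) = pm_scale c (free_mult M N t u)"
proof -
  let ?A = "Poly_Mapping.keys t" and ?B = "Poly_Mapping.keys u"
  have *: "pm_scale c (free_mult M N t u) = (\<Sum>p\<in>?A. \<Sum>q\<in>?B.
    Poly_Mapping.single (fst p \<otimes>\<^bsub>M\<^esub> fst q, snd p \<otimes>\<^bsub>N\<^esub> snd q)
      (c * (Poly_Mapping.lookup t p * Poly_Mapping.lookup u q)))"
    by (simp add: free_mult_superset[of ?A _ ?B] pm.scale_sum_right)
  show "free_mult M N (pm_scale c t) u = pm_scale c (free_mult M N t u)"
    "free_mult M N t (pm_scale c u) = pm_scale c (free_mult M N t u)"
    unfolding * using keys_pm_scale[of c t] keys_pm_scale[of c u]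
    by (simp_all add: free_mult_superset[of ?A _ ?B] mult_ac)
qed

lemma free_mult_diff:
  "free_mult M N (t - u) v = free_mult M N t v - free_mult M N u v"
  using free_mult_add(1)[of M N "t - u" u v] by simp

context
  fixes M :: "('k::field, 'a) module" and N :: "('k, 'b) module"
  assumes M: "algebra base_algebra M" and N: "algebra base_algebra N"
begin

interpretation M: algebra base_algebra M by (rule M)
interpretation N: algebra base_algebra N by (rule N)

lemma free_mult_commute:
  assumes "t \<in> free_pairs M N" "u \<in> free_pairs M N"
  shows "free_mult M N t u = free_mult M N u t"
proof -
  have t: "Poly_Mapping.keys t \<subseteq> carrier M \<times> carrier N" and u: "Poly_Mapping.keys u \<subseteq> carrier M \<times> carrier N"
    using assms by (auto simp: free_pairs_def)
  from t show ?thesis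
  proof (induction t rule: free_induct)
    case (single p c)
    from u show ?case
    proof (induction u rule: free_induct)
      case (single q d)
      then show ?case
        using \<open>p \<in> _\<close> by (cases p; cases q) (auto simp: free_mult_single M.m_comm N.m_comm mult.commute)
    qed (simp_all add: free_mult_add)
  qed (simp_all add: free_mult_add)
qed

lemma free_mult_relation:
  assumes "r \<in> bilinear_relations M N" "x \<in> carrier M" "y \<in> carrier N"
  shows "free_mult M N r (gen x y) \<in> bilinear_relations M N"
proof -
  have a: "(c \<odot>\<^bsub>M\<^esub> a) \<otimes>\<^bsub>M\<^esub> x = c \<odot>\<^bsub>M\<^esub> (a \<otimes>\<^bsub>M\<^esub> x)" if "a \<in> carrier M" for c a
    using M.smult_assoc2[of c a x] that assms by simp
  have a': "(c \<odot>\<^bsub>N\<^esub> a) \<otimes>\<^bsub>N\<^esub> y = c \<odot>\<^bsub>N\<^esub> (a \<otimes>\<^bsub>N\<^esub> y)" if "a \<in> carrier N" for c a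
    using N.smult_assoc2[of c a y] that assms by simp
  have mc: "a \<otimes>\<^bsub>M\<^esub> x \<in> carrier M" if "a \<in> carrier M" for a using that assms by simp
  have nc: "a \<otimes>\<^bsub>N\<^esub> y \<in> carrier N" if "a \<in> carrier N" for a using that assms by simp
  from assms(1) show ?thesis
  proof (cases rule: bilinear_relations_cases)
    case (1 u u' v)
    then have "free_mult M N r (gen x y) = gen (u \<otimes>\<^bsub>M\<^esub> x \<oplus>\<^bsub>M\<^esub> u' \<otimes>\<^bsub>M\<^esub> x) (v \<otimes>\<^bsub>N\<^esub> y)
        - gen (u \<otimes>\<^bsub>M\<^esub> x) (v \<otimes>\<^bsub>N\<^esub> y) - gen (u' \<otimes>\<^bsub>M\<^esub> x) (v \<otimes>\<^bsub>N\<^esub> y)"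
      using assms by (simp add: free_mult_diff free_mult_single M.l_distr)
    then show ?thesis unfolding bilinear_relations_def using mc[OF 1(2)] mc[OF 1(3)] nc[OF 1(4)] by blast
  next
    case (2 u v v')
    then have "free_mult M N r (gen x y) = gen (u \<otimes>\<^bsub>M\<^esub> x) (v \<otimes>\<^bsub>N\<^esub> y \<oplus>\<^bsub>N\<^esub> v' \<otimes>\<^bsub>N\<^esub> y)
        - gen (u \<otimes>\<^bsub>M\<^esub> x) (v \<otimes>\<^bsub>N\<^esub> y) - gen (u \<otimes>\<^bsub>M\<^esub> x) (v' \<otimes>\<^bsub>N\<^esub> y)"
      using assms by (simp add: free_mult_diff free_mult_single N.l_distr)
    then show ?thesis unfolding bilinear_relations_def using mc[OF 2(2)] nc[OF 2(3)] nc[OF 2(4)] by blast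
  next
    case (3 c u v)
    then have "free_mult M N r (gen x y) = gen (c \<odot>\<^bsub>M\<^esub> (u \<otimes>\<^bsub>M\<^esub> x)) (v \<otimes>\<^bsub>N\<^esub> y)
        - pm_scale c (gen (u \<otimes>\<^bsub>M\<^esub> x) (v \<otimes>\<^bsub>N\<^esub> y))"
      using assms by (simp add: free_mult_diff free_mult_single a)
    then show ?thesis unfolding bilinear_relations_def using mc[OF 3(2)] nc[OF 3(3)] by blast
  next
    case (4 c u v)
    then have "free_mult M N r (gen x y) = gen (u \<otimes>\<^bsub>M\<^esub> x) (c \<odot>\<^bsub>N\<^esub> (v \<otimes>\<^bsub>N\<^esub> y))
        - pm_scale c (gen (u \<otimes>\<^bsub>M\<^esub> x) (v \<otimes>\<^bsub>N\<^esub> y))"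
      using assms by (simp add: free_mult_diff free_mult_single a')
    then show ?thesis unfolding bilinear_relations_def using mc[OF 4(2)] nc[OF 4(3)] by blast
  qed
qed

text \<open>The span of the bilinearity relations is an ideal of the free vector space.\<close>

lemma free_mult_span:
  assumes "r \<in> pm.span (bilinear_relations M N)" "t \<in> free_pairs M N"
  shows "free_mult M N r t \<in> pm.span (bilinear_relations M N)"
  using assms(1)
proof (induction rule: pm.span_induct)
  case base
  show ?case unfolding pm.subspace_def
    by (simp add: free_mult_add free_mult_scale pm.span_zero pm.span_add pm.span_scale)
next
  case (step r)
  have "Poly_Mapping.keys t \<subseteq> carrier M \<times> carrier N" using assms(2) by (simp add: free_pairs_def)
  then show ?case
  proof (induction t rule: free_induct)
    case (single p c)
    then obtain x y where p: "p = (x, y)" "x \<in> carrier M" "y \<in> carrier N" by auto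
    have "free_mult M N r (Poly_Mapping.single p c) = pm_scale c (free_mult M N r (gen x y))"
      unfolding free_mult_scale(2)[symmetric] by (simp add: p)
    then show ?case
      using pm.span_scale[OF pm.span_base[OF free_mult_relation[OF step p(2,3)]]] by simp
  qed (simp_all add: free_mult_add pm.span_zero pm.span_add)
qed

lemma tensor_mult:
  assumes t: "t \<in> free_pairs M N" and u: "u \<in> free_pairs M N"
  shows "tensor_class M N t \<otimes>\<^bsub>tensor M N\<^esub> tensor_class M N u = tensor_class M N (free_mult M N t u)"
proof -
  note span = eval_span[OF M.module N.module kmodule_tensor bilinear_pure_tensor, THEN conjunct1]
  have "tensor_class M N (free_mult M N t' u') = tensor_class M N (free_mult M N t u)"
    if "t' \<in> tensor_class M N t" "u' \<in> tensor_class M N u" for t' u'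
  proof -
    have r: "t' - t \<in> pm.span (bilinear_relations M N)" "u' - u \<in> pm.span (bilinear_relations M N)"
      using that by (auto simp: mem_tensor_class)
    have t': "t' \<in> free_pairs M N" using free_pairs_closed(2)[OF span[OF r(1)] t] by simp
    have u': "u' \<in> free_pairs M N" using free_pairs_closed(2)[OF span[OF r(2)] u] by simp
    have "free_mult M N t' u' - free_mult M N t u = free_mult M N (t' - t) u' + free_mult M N (u' - u) t"
      using free_mult_commute[OF t u] free_mult_commute[OF t u'] by (simp add: free_mult_diff)
    also have "\<dots> \<in> pm.span (bilinear_relations M N)"
      by (intro pm.span_add free_mult_span r t u')
    finally show ?thesis by (simp add: tensor_class_eq_iff)
  qed
  then have "(\<Union>t'\<in>tensor_class M N t. \<Union>u'\<in>tensor_class M N u. tensor_class M N (free_mult M N t' u')) =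
      tensor_class M N (free_mult M N t u)"
    by (rule UN_UN_tensor_class)
  then show ?thesis by (simp add: tensor_def)
qed

end


section \<open>Linear extension from the generators of the localization\<close>

text \<open>The generator \<open>C/\<bullet>\<^sup>m\<close>.\<close>

definition qfrac :: "iso_class \<Rightarrow> nat \<Rightarrow> 'k::field quiver_loc" where
  "qfrac C m = frac (Poly_Mapping.single C 1) m"

abbreviation bullet_class :: iso_class where
  "bullet_class \<equiv> quiver_class point_quiver"

lemma qfrac_mult: "qfrac C m * qfrac D n = qfrac (C + D) (m + n)"
  by (simp add: qfrac_def frac_ops mult_single)

lemma qfrac_zero: "qfrac 0 0 = 1"
  by (simp add: qfrac_def frac_ops)

lemma qfrac_bullet: "qfrac (bullet_class + C) (Suc m) = (qfrac C m :: 'k::field quiver_loc)"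
proof -
  have "Poly_Mapping.single (bullet_class + C) (1 :: 'k) = bullet * Poly_Mapping.single C 1"
    by (simp add: bullet_def mult_single)
  then have "bullet ^ m * Poly_Mapping.single (bullet_class + C) (1 :: 'k) = bullet ^ Suc m * Poly_Mapping.single C 1"
    by (simp add: mult_ac)
  then show ?thesis unfolding qfrac_def frac_eq_iff by (intro exI[of _ 0]) simp
qed

lemma points_add: "points (m + n) = points m + points n"
  by (induction m) (simp_all add: add.assoc)

lemma qfrac_points: "qfrac (points n + C) (n + m) = qfrac C m"
  by (induction n) (simp_all add: qfrac_bullet add.assoc)

lemma qfrac_points_inverse: "qfrac (points n) 0 * qfrac 0 n = (1 :: 'k::field quiver_loc)"
  using qfrac_points[of n 0 0] by (simp add: qfrac_mult qfrac_zero)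

lemma module_loc_scale: "Modules.module (loc_scale :: 'k::field \<Rightarrow> _)"
proof -
  have add: "frac a 0 + frac b 0 = frac (a + b) 0" for a b :: "'k quiver_algebra" by (simp add: frac_ops)
  show ?thesis
    by unfold_locales
      (simp_all add: loc_scale_def ring_distribs single_add flip: add,
        simp_all add: frac_ops(5) mult_single flip: mult.assoc frac_ops(2))
qed

interpretation loc: Modules.module "loc_scale :: 'k::field \<Rightarrow> _"
  by (rule module_loc_scale)

lemma loc_scale_mult: "loc_scale c x * y = loc_scale c (x * y)"
  by (simp add: loc_scale_def mult.assoc)

lemma loc_scale_mult_right: "x * loc_scale c y = loc_scale c (x * y)"
  by (simp add: loc_scale_def mult_ac)

lemma loc_scale_qfrac: "loc_scale c (qfrac C m) = frac (Poly_Mapping.single C c) m"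
  by (simp add: loc_scale_def qfrac_def frac_ops mult_single)

lemma frac_add_same: "frac (a + b) m = frac a m + frac b m"
  by (simp add: frac_ops) (auto simp: frac_eq_iff power_add algebra_simps)

lemma quiver_loc_induct [case_names single add]:
  fixes x :: "'k::field quiver_loc"
  assumes "\<And>c C m. P (loc_scale c (qfrac C m))" "\<And>x y. P x \<Longrightarrow> P y \<Longrightarrow> P (x + y)"
  shows "P x"
proof -
  obtain a m where x: "x = frac a m" by (rule frac_cases)
  have "P (frac a m)"
    by (rule free_induct[of a UNIV "\<lambda>a. P (frac a m)"])
      (use assms(1)[of 0 0 m] assms in \<open>auto simp: loc_scale_qfrac frac_add_same\<close>)
  then show ?thesis by (simp add: x)
qed

text \<open>The linear map with value \<open>g C m\<close> at \<open>C/\<bullet>\<^sup>m\<close>. It is computed from an arbitrary fraction that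
  represents the argument, which is meaningful if \<open>g\<close> is invariant under cancellation of a bullet;
  the lemmas about it assume this.\<close>

definition lin_ext :: "('k::field \<Rightarrow> 'b \<Rightarrow> 'b) \<Rightarrow> (iso_class \<Rightarrow> nat \<Rightarrow> 'b) \<Rightarrow> 'k quiver_loc \<Rightarrow> 'b::ab_group_add" where
  "lin_ext s g z = (case rep_quiver_loc z of (a, m) \<Rightarrow>
     (\<Sum>C\<in>Poly_Mapping.keys a. s (Poly_Mapping.lookup a C) (g C m)))"

context
  fixes s :: "'k::field \<Rightarrow> 'b \<Rightarrow> 'b::ab_group_add" and g :: "iso_class \<Rightarrow> nat \<Rightarrow> 'b"
  assumes s: "Modules.module s" and compat: "\<And>C m. g (bullet_class + C) (Suc m) = g C m"
begin

interpretation s: Modules.module s by (rule s)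

text \<open>The value at the fraction of \<open>a\<close> by the \<open>m\<close>-th power of the bullet.\<close>

private definition "E a m = (\<Sum>C\<in>Poly_Mapping.keys a. s (Poly_Mapping.lookup a C) (g C m))"

private lemma E_add: "E (a + b) m = E a m + E b m"
  unfolding E_def by (rule setsum_keys_plus_distrib) (simp_all add: s.scale_left_distrib)

private lemma E_single: "E (Poly_Mapping.single C c) m = s c (g C m)"
  by (cases "c = 0") (simp_all add: E_def)

private lemma E_bullet: "E (bullet * a) (Suc m) = E a m"
proof -
  have "Poly_Mapping.keys a \<subseteq> UNIV" by simp
  then show ?thesis
  proof (induction a rule: free_induct)
    case zero
    show ?case by (simp add: E_def)
  next
    case (single C c)
    show ?case by (simp add: bullet_def mult_single E_single compat)
  qed (simp add: E_add distrib_left)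
qed

private lemma E_bullet_power: "E (bullet ^ n * a) (n + m) = E a m"
  by (induction n) (simp_all add: E_bullet mult.assoc)

private lemma E_frac: "frac a m = frac b n \<Longrightarrow> E a m = E b n"
proof -
  assume "frac a m = frac b n"
  then obtain l where "bullet ^ l * (bullet ^ n * a) = bullet ^ l * (bullet ^ m * b)"
    by (auto simp: frac_eq_iff)
  then have "E (bullet ^ (l + n) * a) (l + n + m) = E (bullet ^ (l + m) * b) (l + m + n)"
    by (simp add: power_add mult.assoc add_ac)
  then show ?thesis by (simp only: E_bullet_power)
qed

text \<open>The value does not depend on the fraction.\<close>

lemma lin_ext_frac:
  "lin_ext s g (frac a m) = (\<Sum>C\<in>Poly_Mapping.keys a. s (Poly_Mapping.lookup a C) (g C m))"
proof -
  obtain b n where bn: "rep_quiver_loc (frac a m) = (b, n)" by (metis surj_pair)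
  then have "frac b n = frac a m"
    unfolding frac_def by (metis Quotient3_quiver_loc Quotient3_abs_rep)
  then have "E b n = E a m" by (rule E_frac)
  then show ?thesis by (simp add: lin_ext_def bn E_def)
qed

lemma lin_ext_add: "lin_ext s g (x + y) = lin_ext s g x + lin_ext s g y"
proof -
  obtain a m where x: "x = frac a m" by (rule frac_cases)
  obtain b n where y: "y = frac b n" by (rule frac_cases)
  have "E (bullet ^ n * a) (m + n) = E a m" using E_bullet_power[of n a m] by (simp add: add.commute)
  moreover have "E (bullet ^ m * b) (m + n) = E b n" by (rule E_bullet_power)
  ultimately show ?thesis by (simp add: x y frac_ops lin_ext_frac E_add flip: E_def)
qed

lemma lin_ext_scale: "lin_ext s g (loc_scale c x) = s c (lin_ext s g x)"
proof (induction x rule: quiver_loc_induct)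
  case (single d C m)
  show ?case
    unfolding loc.scale_scale
    unfolding loc_scale_qfrac lin_ext_frac E_def[symmetric] E_single s.scale_scale ..
qed (simp add: loc.scale_right_distrib s.scale_right_distrib lin_ext_add)

lemma lin_ext_qfrac: "lin_ext s g (qfrac C m) = g C m"
  by (simp add: qfrac_def lin_ext_frac)

end

lemma H_c_simps [simp]:
  "carrier H_c = UNIV" "mult H_c = (*)" "one H_c = 1" "ring.zero H_c = 0" "add H_c = (+)" "smult H_c = loc_scale"
  by (simp_all add: H_c_def)

lemma algebra_H_c: "algebra base_algebra (H_c :: ('k::field, _) module)"
  unfolding H_c_def by (rule algebra_type_algebra) (simp_all add: module_loc_scale loc_scale_mult)

lemma kmodule_H_c: "kmodule (H_c :: ('k::field, _) module)"
  by (rule algebra.module[OF algebra_H_c])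

lemma finsum_H_c: "finsum H_c f A = sum f A"
  by (simp add: H_c_def finsum_type_algebra)

lemma free_pairs_H_c [simp]: "t \<in> free_pairs H_c H_c"
  by (simp add: free_pairs_def)

lemma linear_map_H_c_eqI:
  assumes "linear_map H_c P f" "linear_map H_c P g" "\<And>C m. f (qfrac C m) = g (qfrac C m)"
  shows "f x = g x"
  by (induction x rule: quiver_loc_induct)
    (use linear_mapD(2,3)[OF assms(1)] linear_mapD(2,3)[OF assms(2)] assms(3) in auto)

lemma bilinear_map_mult_H_c:
  assumes "linear_map H_c H_c f" "linear_map H_c H_c g"
  shows "bilinear_map H_c H_c H_c (\<lambda>x y. f x * g y)"
  using linear_mapD(2,3)[OF assms(1)] linear_mapD(2,3)[OF assms(2)] unfolding bilinear_map_def
  by (auto intro!: linear_mapI simp: ring_distribs loc_scale_mult loc_scale_mult_right)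

lemma linear_map_eta: "linear_map H_c base_algebra f \<Longrightarrow> linear_map H_c H_c (\<lambda>x. loc_scale (f x) 1)"
  using linear_mapD(2,3)[of H_c base_algebra f]
  by (auto intro!: linear_mapI simp: loc.scale_left_distrib loc.scale_scale)


section \<open>The coproduct\<close>

text \<open>The coproduct of the generator \<open>C/\<bullet>\<^sup>m\<close> as a formal sum of pairs, before passing to cosets.\<close>

definition cut_tensor :: "iso_class \<Rightarrow> nat \<Rightarrow> ('k::field quiver_loc \<times> 'k quiver_loc) \<Rightarrow>\<^sub>0 'k" where
  "cut_tensor C m = cut_sum C (\<lambda>A B. gen (qfrac A m) (qfrac B m))"

text \<open>The linear lift of the coproduct to the free vector space on pairs.\<close>

definition free_coproduct :: "'k::field quiver_loc \<Rightarrow> ('k quiver_loc \<times> 'k quiver_loc) \<Rightarrow>\<^sub>0 'k" where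
  "free_coproduct = lin_ext pm_scale cut_tensor"

lemma cut_sum_bullet: "cut_sum (bullet_class + C) f = cut_sum C (\<lambda>A B. f (bullet_class + A) (bullet_class + B))"
  by (simp add: cut_sum_plus cut_sum_edgeless)

lemma cut_tensor_bullet: "cut_tensor (bullet_class + C) (Suc m) = cut_tensor C m"
  by (simp add: cut_tensor_def cut_sum_bullet qfrac_bullet)

lemma free_coproduct_ext:
  "free_coproduct (frac a m) = (\<Sum>C\<in>Poly_Mapping.keys a. pm_scale (Poly_Mapping.lookup a C) (cut_tensor C m))"
  "free_coproduct (x + y) = free_coproduct x + free_coproduct y"
  "free_coproduct (loc_scale c x) = pm_scale c (free_coproduct x)"
  "free_coproduct (qfrac C m) = cut_tensor C m"
  unfolding free_coproduct_def
  by (rule lin_ext_frac lin_ext_add lin_ext_scale lin_ext_qfrac; rule module_pm_scale cut_tensor_bullet)+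

lemma coproduct_eq: "coproduct z = tensor_class H_c H_c (free_coproduct z)"
proof -
  define F where "F a m = tensor_class H_c H_c
     (\<Sum>C\<in>Poly_Mapping.keys a. \<Sum>H\<in>{H. H \<preceq> quiver_rep C}.
        Poly_Mapping.single
          (frac (Poly_Mapping.single (quiver_class H) 1) m,
           frac (Poly_Mapping.single (quiver_class (contract (quiver_rep C) H)) 1) m)
          (Poly_Mapping.lookup a C))" for a :: "'a quiver_algebra" and m
  have F: "F a m = tensor_class H_c H_c (free_coproduct (frac a m))" for a m
    by (simp add: F_def free_coproduct_ext(1) cut_tensor_def cut_sum_def pm.scale_sum_right flip: qfrac_def)
  obtain a m where am: "frac a m = z" by (metis frac_cases)
  have "coproduct z = (\<Union>p\<in>{(a, m). frac a m = z}. F (fst p) (snd p))"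
    by (simp add: coproduct_def F_def case_prod_unfold)
  also have "\<dots> = tensor_class H_c H_c (free_coproduct z)"
    by (rule UN_constant_eq[of "(a, m)"]) (auto simp: F am)
  finally show ?thesis .
qed

lemma coproduct_qfrac: "coproduct (qfrac C m) = tensor_class H_c H_c (cut_tensor C m)"
  by (simp add: coproduct_eq free_coproduct_ext)

lemma linear_map_coproduct: "linear_map H_c (tensor H_c H_c) coproduct"
  by (rule linear_mapI)
    (simp_all add: coproduct_eq tensor_carrier tensor_add tensor_smult free_coproduct_ext)

lemma free_coproduct_mult:
  fixes x y :: "'k::field quiver_loc"
  shows "free_coproduct (x * y) = free_mult H_c H_c (free_coproduct x) (free_coproduct y)"
proof (induction x rule: quiver_loc_induct)
  case (single c C m)
  show ?case
  proof (induction y rule: quiver_loc_induct)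
    case (single d D n)
    have "free_mult H_c H_c (cut_tensor C m) (cut_tensor D n :: _ \<Rightarrow>\<^sub>0 'k) =
        cut_sum C (\<lambda>A B. free_mult H_c H_c (gen (qfrac A m) (qfrac B m)) (cut_tensor D n))"
      unfolding cut_tensor_def by (rule cut_sum_hom) (simp_all add: free_mult_add)
    also have "\<dots> = cut_sum C (\<lambda>A B. cut_sum D (\<lambda>A' B'.
        free_mult H_c H_c (gen (qfrac A m) (qfrac B m)) (gen (qfrac A' n) (qfrac B' n))))"
      unfolding cut_tensor_def
      by (intro cut_sum_cong refl cut_sum_hom[of "free_mult _ _ _"]) (simp_all add: free_mult_add)
    also have "\<dots> = cut_tensor (C + D) (m + n)"
      by (simp add: cut_tensor_def cut_sum_plus free_mult_single qfrac_mult)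
    finally show ?case
      by (simp add: loc_scale_mult loc_scale_mult_right qfrac_mult free_coproduct_ext free_mult_scale
          del: loc.scale_scale pm.scale_scale)
  qed (simp_all add: distrib_left free_coproduct_ext free_mult_add)
qed (simp_all add: distrib_right free_coproduct_ext free_mult_add)

lemma ring_hom_coproduct: "coproduct \<in> ring_hom H_c (tensor H_c H_c)"
proof (rule ring_hom_memI)
  show "coproduct (x \<otimes>\<^bsub>H_c\<^esub> y) = coproduct x \<otimes>\<^bsub>tensor H_c H_c\<^esub> coproduct y" for x y
    by (simp add: coproduct_eq tensor_mult[OF algebra_H_c algebra_H_c] free_coproduct_mult)
  show "coproduct \<one>\<^bsub>H_c\<^esub> = \<one>\<^bsub>tensor H_c H_c\<^esub>"
    by (simp add: coproduct_qfrac tensor_one pure_tensor_def cut_tensor_def cut_sum_edgeless qfrac_zero flip: qfrac_zero)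
qed (simp_all add: linear_mapD[OF linear_map_coproduct, simplified])

text \<open>Evaluation of a linear map of tensor products on a sum over cuts, where each value at a pure
  tensor is known as the class of a formal sum.\<close>

lemma linear_map_tensor_cut_sum:
  assumes g: "linear_map (tensor M N) (tensor M' N') g"
    and val: "\<And>A B. a A B \<in> carrier M \<and> b A B \<in> carrier N \<and>
      g (pure_tensor M N (a A B) (b A B)) = tensor_class M' N' (h A B)"
  shows "g (tensor_class M N (cut_sum C (\<lambda>A B. gen (a A B) (b A B)))) = tensor_class M' N' (cut_sum C h)"
proof -
  have sub: "cut_sum C (\<lambda>A B. gen (a A B) (b A B)) \<in> free_pairs M N" for C
    by (rule cut_sum_closed[where P = "\<lambda>t. t \<in> free_pairs M N"]) (use val in \<open>auto intro!: free_pairs_closed\<close>)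
  have "g (tensor_class M N (\<Sum>i\<in>I. gen (a (p i) (q i)) (b (p i) (q i)))) =
      tensor_class M' N' (\<Sum>i\<in>I. h (p i) (q i))" for I :: "'x set" and p q
  proof (induction I rule: infinite_finite_induct)
    case (insert i I)
    have "tensor_class M N (\<Sum>i\<in>I. gen (a (p i) (q i)) (b (p i) (q i))) \<in> carrier (tensor M N)"
      "tensor_class M N (gen (a (p i) (q i)) (b (p i) (q i))) \<in> carrier (tensor M N)"
      unfolding tensor_carrier using val by (auto intro!: imageI free_pairs_sum free_pairs_closed)
    then show ?case
      using insert val[of "p i" "q i"]
      by (simp add: tensor_add[symmetric] linear_mapD[OF g] pure_tensor_def)
  qed (use linear_map_zero[OF g kmodule_tensor kmodule_tensor] in \<open>simp_all add: tensor_zero\<close>)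
  then show ?thesis by (simp add: cut_sum_def)
qed

lemma tensor_lift_coproduct:
  assumes "bilinear_map H_c H_c H_c f"
  shows "tensor_lift H_c f (coproduct (qfrac C m)) = cut_sum C (\<lambda>A B. f (qfrac A m) (qfrac B m))"
proof -
  have im: "(\<lambda>p. f (fst p) (snd p)) ` UNIV \<subseteq> carrier H_c" by simp
  let ?ev = "lin_eval H_c (\<lambda>p. f (fst p) (snd p))"
  have "tensor_lift H_c f (coproduct (qfrac C m)) = ?ev (cut_tensor C m)"
    by (simp add: coproduct_qfrac tensor_lift_class[OF kmodule_H_c kmodule_H_c kmodule_H_c assms])
  also have "\<dots> = cut_sum C (\<lambda>A B. ?ev (gen (qfrac A m) (qfrac B m)))"
    unfolding cut_tensor_def
    by (rule cut_sum_hom)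
      (simp_all add: lin_eval_zero[OF kmodule_H_c im, simplified] lin_eval_add[OF kmodule_H_c im, simplified])
  also have "\<dots> = cut_sum C (\<lambda>A B. f (qfrac A m) (qfrac B m))"
    by (simp add: lin_eval_single[OF kmodule_H_c im, simplified])
  finally show ?thesis .
qed

lemma linear_map_tensor_lift_coproduct:
  assumes "bilinear_map H_c H_c H_c f"
  shows "linear_map H_c H_c (\<lambda>h. tensor_lift H_c f (coproduct h))"
  by (rule linear_map_compose[OF linear_map_coproduct
        linear_map_tensor_lift[OF kmodule_H_c kmodule_H_c kmodule_H_c assms]])

lemma coproduct_coassoc:
  fixes h :: "'k::field quiver_loc"
  shows "tensor_assoc H_c H_c H_c (tensor_map (tensor H_c H_c) H_c coproduct id (coproduct h)) =
    tensor_map H_c (tensor H_c H_c) id coproduct (coproduct h)"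
proof -
  let ?H = "H_c :: ('k, 'k quiver_loc) module"
  let ?T = "tensor ?H ?H"
  note km = kmodule_H_c kmodule_tensor
  note lin = linear_map_coproduct linear_map_id
  note pc = pure_tensor_closed
  have cl: "coproduct x \<in> carrier ?T" for x :: "'k quiver_loc"
    using linear_mapD(1)[OF linear_map_coproduct] by simp
  let ?l = "tensor_map ?T ?H coproduct id" and ?r = "tensor_map ?H ?T id coproduct"
  have l: "linear_map ?T (tensor ?T ?H) ?l" and r: "linear_map ?T (tensor ?H ?T) ?r"
    by (intro linear_map_tensor_map km lin)+
  have as: "linear_map (tensor ?T ?H) (tensor ?H ?T) (tensor_assoc ?H ?H ?H)"
    by (intro linear_map_tensor_assoc km)
  show ?thesis
  proof (rule linear_map_H_c_eqI[of "tensor ?H ?T"])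
    show "linear_map ?H (tensor ?H ?T) (\<lambda>h. tensor_assoc ?H ?H ?H (?l (coproduct h)))"
      by (intro linear_map_compose[OF linear_map_coproduct] linear_map_compose[OF l] as)
    show "linear_map ?H (tensor ?H ?T) (\<lambda>h. ?r (coproduct h))"
      by (intro linear_map_compose[OF linear_map_coproduct] r)
    fix C m
    let ?q = "\<lambda>A. qfrac A m :: 'k quiver_loc"
    have l': "?l (coproduct (?q C)) = tensor_class ?T ?H (cut_sum C (\<lambda>A B. gen (coproduct (?q A)) (?q B)))"
      unfolding coproduct_qfrac[of C] cut_tensor_def
      by (rule linear_map_tensor_cut_sum[OF l]) (simp add: tensor_map_pure km lin pure_tensor_def[of ?T])
    have a1: "tensor_assoc ?H ?H ?H (pure_tensor ?T ?H (coproduct (?q A)) (?q B)) =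
        tensor_class ?H ?T (cut_sum A (\<lambda>K L. gen (?q K) (pure_tensor ?H ?H (?q L) (?q B))))" for A B
      unfolding coproduct_qfrac[of A] cut_tensor_def
      by (rule linear_map_tensor_cut_sum[OF linear_map_compose[OF bilinear_map_linear_left[OF bilinear_pure_tensor] as]])
        (simp_all add: tensor_assoc_pure km pure_tensor_def[of ?H ?T])
    have "tensor_assoc ?H ?H ?H (?l (coproduct (?q C))) =
        tensor_class ?H ?T (cut_sum C (\<lambda>A B. cut_sum A (\<lambda>K L. gen (?q K) (pure_tensor ?H ?H (?q L) (?q B)))))"
      unfolding l' by (rule linear_map_tensor_cut_sum[OF as]) (simp add: a1 cl)
    also have "\<dots> = tensor_class ?H ?T (cut_sum C (\<lambda>A B. cut_sum B (\<lambda>L M. gen (?q A) (pure_tensor ?H ?H (?q L) (?q M)))))"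
      by (simp only: cut_sum_coassoc)
    also have "\<dots> = ?r (coproduct (?q C))"
    proof -
      have r1: "pure_tensor ?H ?T (?q A) (coproduct (?q B)) =
          tensor_class ?H ?T (cut_sum B (\<lambda>L M. gen (?q A) (pure_tensor ?H ?H (?q L) (?q M))))" for A B
        unfolding coproduct_qfrac[of B] cut_tensor_def
        by (rule linear_map_tensor_cut_sum[of _ _ _ _ "pure_tensor ?H ?T (?q A)"])
          (use bilinear_pure_tensor[of ?H ?T] in \<open>simp_all add: bilinear_map_def pure_tensor_def[of ?H ?T]\<close>)
      show ?thesis
        unfolding coproduct_qfrac[of C] cut_tensor_def
        by (rule linear_map_tensor_cut_sum[OF r, symmetric]) (simp add: tensor_map_pure km lin r1)
    qed
    finally show "tensor_assoc ?H ?H ?H (?l (coproduct (?q C))) = ?r (coproduct (?q C))" .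
  qed
qed


section \<open>The counit\<close>

text \<open>The counit of the Hopf algebra: 1 on edgeless quivers and 0 on quivers with edges.\<close>

definition counit :: "'k::field quiver_loc \<Rightarrow> 'k" where
  "counit = lin_ext (*) (\<lambda>C m. if nedges C = 0 then 1 else 0)"

lemma module_times: "Modules.module ((*) :: 'k::field \<Rightarrow> _)"
  by unfold_locales (simp_all add: algebra_simps)

lemma counit_ext:
  "counit (x + y) = counit x + counit y"
  "counit (loc_scale c x) = c * counit x"
  "counit (qfrac C m) = (if nedges C = 0 then 1 else 0)"
  unfolding counit_def
  by (rule lin_ext_add lin_ext_scale lin_ext_qfrac, rule module_times, simp add: nedges_plus)+

lemma counit_mult: "counit (x * y) = counit x * counit y"
proof (induction x rule: quiver_loc_induct)
  case (single c C m)
  show ?case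
  proof (induction y rule: quiver_loc_induct)
    case (single d D n)
    show ?case
      by (simp add: loc_scale_mult loc_scale_mult_right qfrac_mult counit_ext nedges_plus del: loc.scale_scale)
  next
    case (add x y)
    then show ?case by (simp only: distrib_left counit_ext(1))
  qed
qed (simp_all add: distrib_right counit_ext)

lemma linear_map_counit: "linear_map H_c base_algebra counit"
  by (rule linear_mapI) (simp_all add: counit_ext)

lemma counit_one: "counit 1 = 1"
  by (simp add: counit_ext flip: qfrac_zero)

lemma ring_hom_counit: "counit \<in> ring_hom H_c base_algebra"
  by (rule ring_hom_memI) (simp_all add: counit_ext counit_mult counit_one)

lemma bilinear_map_scale:
  assumes "linear_map H_c base_algebra f"
  shows "bilinear_map H_c H_c H_c (\<lambda>x y. loc_scale (f x) y)" "bilinear_map H_c H_c H_c (\<lambda>x y. loc_scale (f y) x)"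
  using linear_mapD(2,3)[OF assms] unfolding bilinear_map_def
  by (auto intro!: linear_mapI simp: loc.scale_left_distrib loc.scale_right_distrib loc.scale_scale mult.commute)

lemma linear_map_ident: "linear_map M M (\<lambda>x. x)"
  by (simp add: linear_map_def)

lemma counital_left_H_c: "tensor_lift H_c (\<lambda>x y. loc_scale (counit x) y) (coproduct h) = h"
proof (rule linear_map_H_c_eqI[OF linear_map_tensor_lift_coproduct linear_map_ident])
  note b = bilinear_map_scale(1)[OF linear_map_counit]
  show "bilinear_map H_c H_c H_c (\<lambda>x y. loc_scale (counit x) y)" by (rule b)
  fix C m
  have "tensor_lift H_c (\<lambda>x y. loc_scale (counit x) y) (coproduct (qfrac C m)) =
      cut_sum C (\<lambda>A B. if nedges A = 0 then qfrac B m else 0)"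
    unfolding tensor_lift_coproduct[OF b] by (intro cut_sum_cong) (simp_all add: counit_ext)
  also have "\<dots> = qfrac C m" by (rule cut_sum_left_points)
  finally show "tensor_lift H_c (\<lambda>x y. loc_scale (counit x) y) (coproduct (qfrac C m)) = qfrac C m" .
qed

lemma counital_right_H_c: "tensor_lift H_c (\<lambda>x y. loc_scale (counit y) x) (coproduct h) = h"
proof (rule linear_map_H_c_eqI[OF linear_map_tensor_lift_coproduct linear_map_ident])
  note b = bilinear_map_scale(2)[OF linear_map_counit]
  show "bilinear_map H_c H_c H_c (\<lambda>x y. loc_scale (counit y) x)" by (rule b)
  fix C m
  have "tensor_lift H_c (\<lambda>x y. loc_scale (counit y) x) (coproduct (qfrac C m)) =
      cut_sum C (\<lambda>A B. if nedges B = 0 then qfrac A m else 0)"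
    unfolding tensor_lift_coproduct[OF b] by (intro cut_sum_cong) (simp_all add: counit_ext)
  also have "\<dots> = qfrac C m" by (rule cut_sum_right_points)
  finally show "tensor_lift H_c (\<lambda>x y. loc_scale (counit y) x) (coproduct (qfrac C m)) = qfrac C m" .
qed


section \<open>The convolution inverse of the inclusion\<close>

text \<open>Convolution along the cuts of a class.\<close>

definition conv :: "(iso_class \<Rightarrow> 'k::field quiver_loc) \<Rightarrow> (iso_class \<Rightarrow> 'k quiver_loc) \<Rightarrow> iso_class \<Rightarrow> 'k quiver_loc" where
  "conv f g C = cut_sum C (\<lambda>A B. f A * g B)"

text \<open>The unit of convolution: the counit followed by the inclusion of scalars.\<close>

definition conv_unit :: "iso_class \<Rightarrow> 'k::field quiver_loc" where
  "conv_unit C = (if nedges C = 0 then 1 else 0)"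

text \<open>The map that sends a class to the corresponding element of the localization.\<close>

definition incl :: "iso_class \<Rightarrow> 'k::field quiver_loc" where
  "incl C = qfrac C 0"

lemma conv_assoc: "conv (conv f g) h = conv f (conv g h)"
proof
  fix C
  show "conv (conv f g) h C = conv f (conv g h) C"
    using cut_sum_coassoc[of C "\<lambda>K L M. f K * g L * h M"]
    by (simp add: conv_def flip: cut_sum_mult_left cut_sum_mult_right) (simp add: mult.assoc)
qed

lemma conv_unit_left: "conv conv_unit f = f"
proof
  fix C
  show "conv conv_unit f C = f C"
    using cut_sum_left_points[of C "\<lambda>A B. f B"] by (simp add: conv_def conv_unit_def if_distrib[of "\<lambda>x. x * _"] cong: if_cong)
qed

lemma conv_unit_right: "conv f conv_unit = f"
proof
  fix C
  show "conv f conv_unit C = f C"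
    using cut_sum_right_points[of C "\<lambda>A B. f A"] by (simp add: conv_def conv_unit_def if_distrib[of "\<lambda>x. _ * x"] cong: if_cong)
qed

lemma incl_plus: "incl (C + D) = incl C * incl D"
  by (simp add: incl_def qfrac_mult)

lemma conv_unit_plus: "conv_unit (C + D) = conv_unit C * conv_unit D"
  by (simp add: conv_unit_def nedges_plus)

lemma conv_incl_expand:
  "conv f incl C = f C * qfrac (points (ncomps C)) 0 + cut_sum C (\<lambda>A B. if nedges B = 0 then 0 else f A * incl B)"
proof -
  have "conv f incl C = cut_sum C (\<lambda>A B. (if nedges B = 0 then f A * incl B else 0) +
      (if nedges B = 0 then 0 else f A * incl B))"
    unfolding conv_def by (intro cut_sum_cong) simp_all
  then show ?thesis by (simp add: cut_sum_plus_distrib cut_sum_right_points incl_def)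
qed

text \<open>By induction on the number of edges: the cut with \<open>C\<close> on the left determines \<open>f C\<close>,
  because its right side is an invertible power of the bullet.\<close>

lemma conv_incl_cancel:
  assumes "conv f incl = conv g incl"
  shows "f = g"
proof
  fix C
  show "f C = g C"
  proof (induction "nedges C" arbitrary: C rule: less_induct)
    case less
    have "cut_sum C (\<lambda>A B. if nedges B = 0 then 0 else f A * incl B) =
        cut_sum C (\<lambda>A B. if nedges B = 0 then 0 else g A * incl B)"
      by (intro cut_sum_cong refl) (use less in auto)
    then have "f C * qfrac (points (ncomps C)) 0 = g C * qfrac (points (ncomps C)) 0"
      using fun_cong[OF assms, of C] by (simp add: conv_incl_expand)
    then have "f C * (qfrac (points (ncomps C)) 0 * qfrac 0 (ncomps C)) =
        g C * (qfrac (points (ncomps C)) 0 * qfrac 0 (ncomps C))"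
      by (simp only: mult.assoc[symmetric])
    then show "f C = g C" by (simp add: qfrac_points_inverse)
  qed
qed

text \<open>The left convolution inverse of \<open>incl\<close>. The equation \<open>conv antipode_class incl = conv_unit\<close> is
  solved for the term with \<open>C\<close> on the left, whose right side is \<open>\<bullet>\<^sup>k\<close> with \<open>k\<close> the number of
  components.\<close>

function antipode_class :: "iso_class \<Rightarrow> 'k::field quiver_loc" where
  "antipode_class C = (conv_unit C -
     cut_sum C (\<lambda>A B. if nedges B = 0 then 0 else antipode_class A * incl B)) * qfrac 0 (ncomps C)"
  by auto
termination by (relation "measure nedges") auto

declare antipode_class.simps [simp del]

lemma conv_antipode_left: "conv antipode_class incl = (conv_unit :: iso_class \<Rightarrow> 'k::field quiver_loc)"
proof
  fix C
  define r :: "'k quiver_loc" where "r = cut_sum C (\<lambda>A B. if nedges B = 0 then 0 else antipode_class A * incl B)"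
  have "antipode_class C * qfrac (points (ncomps C)) 0 = (conv_unit C - r) * (qfrac (points (ncomps C)) 0 * qfrac 0 (ncomps C))"
    by (subst antipode_class.simps) (simp add: r_def mult_ac)
  then have "antipode_class C * qfrac (points (ncomps C)) 0 = conv_unit C - r"
    by (simp add: qfrac_points_inverse)
  then show "conv antipode_class incl C = (conv_unit C :: 'k quiver_loc)"
    unfolding conv_incl_expand r_def by simp
qed

text \<open>A left inverse of \<open>incl\<close> is a right inverse, because \<open>(i * s) * i = i * (s * i) = i\<close> and \<open>i\<close> can be
  cancelled.\<close>

lemma conv_antipode_right: "conv incl antipode_class = conv_unit"
proof (rule conv_incl_cancel)
  show "conv (conv incl antipode_class) incl = conv conv_unit incl"
    by (simp add: conv_assoc conv_antipode_left conv_unit_left conv_unit_right)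
qed

text \<open>Both sides are convolution inverses of \<open>incl (C + D) = incl C * incl D\<close> in two variables;
  \<open>incl\<close> is cancelled first in \<open>C\<close> and then in \<open>D\<close>.\<close>

lemma antipode_class_plus:
  "antipode_class (C + D) = (antipode_class C * antipode_class D :: 'k::field quiver_loc)"
proof -
  let ?s = "antipode_class :: iso_class \<Rightarrow> 'k quiver_loc"
  have "(\<lambda>C. conv (\<lambda>D. ?s (C + D)) incl D) = (\<lambda>C. ?s C * conv_unit D)" for D
  proof (rule conv_incl_cancel, rule ext)
    fix C
    have "conv (\<lambda>C. conv (\<lambda>D. ?s (C + D)) incl D) incl C = conv ?s incl (C + D)"
      by (simp add: conv_def cut_sum_plus incl_plus flip: cut_sum_mult_right) (simp add: mult_ac)
    also have "\<dots> = conv ?s incl C * conv_unit D"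
      by (simp add: conv_antipode_left conv_unit_plus)
    also have "\<dots> = conv (\<lambda>C. ?s C * conv_unit D) incl C"
      by (simp add: conv_def flip: cut_sum_mult_right) (simp add: mult_ac)
    finally show "conv (\<lambda>C. conv (\<lambda>D. ?s (C + D)) incl D) incl C = conv (\<lambda>C. ?s C * conv_unit D) incl C" .
  qed
  then have 1: "conv (\<lambda>D. ?s (C + D)) incl D = ?s C * conv_unit D" for C D by (rule fun_cong)
  have "(\<lambda>D. ?s (C + D)) = (\<lambda>D. ?s C * ?s D)"
  proof (rule conv_incl_cancel, rule ext)
    fix D
    have "conv (\<lambda>D. ?s C * ?s D) incl D = ?s C * conv ?s incl D"
      by (simp add: conv_def mult.assoc flip: cut_sum_mult_left)
    then show "conv (\<lambda>D. ?s (C + D)) incl D = conv (\<lambda>D. ?s C * ?s D) incl D"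
      by (simp add: 1 conv_antipode_left)
  qed
  then show ?thesis by (rule fun_cong)
qed

lemma antipode_class_edgeless:
  assumes "nedges C = 0"
  shows "antipode_class C * qfrac C 0 = 1"
  using fun_cong[OF conv_antipode_left, of C] assms by (simp add: conv_def cut_sum_edgeless conv_unit_def incl_def)


section \<open>The antipode\<close>

text \<open>The antipode: \<open>C/\<bullet>\<^sup>m\<close> is sent to \<open>\<bullet>\<^sup>m S(C)\<close>.\<close>

definition antipode :: "'k::field quiver_loc \<Rightarrow> 'k quiver_loc" where
  "antipode = lin_ext loc_scale (\<lambda>C m. qfrac (points m) 0 * antipode_class C)"

text \<open>Compatibility with cancellation of a bullet in a fraction.\<close>

lemma antipode_bullet:
  "qfrac (points (Suc m)) 0 * antipode_class (bullet_class + C) = qfrac (points m) 0 * antipode_class C"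
proof -
  have "qfrac (points (Suc m)) 0 * antipode_class (bullet_class + C) =
      (antipode_class bullet_class * qfrac bullet_class 0) * (qfrac (points m) 0 * antipode_class C)"
    by (simp add: antipode_class_plus mult_ac qfrac_mult)
  then show ?thesis by (simp add: antipode_class_edgeless)
qed

lemma antipode_ext:
  "antipode (x + y) = antipode x + antipode y"
  "antipode (loc_scale c x) = loc_scale c (antipode x)"
  "antipode (qfrac C m) = qfrac (points m) 0 * antipode_class C"
  unfolding antipode_def
  by (rule lin_ext_add lin_ext_scale lin_ext_qfrac; rule module_loc_scale antipode_bullet)+

lemma linear_map_antipode: "linear_map H_c H_c antipode"
  by (rule linear_mapI) (simp_all add: antipode_ext)

lemma antipode_mult:
  fixes x y :: "'k::field quiver_loc"
  shows "antipode (x * y) = antipode x * antipode y"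
proof (induction x rule: quiver_loc_induct)
  case (single c C m)
  show ?case
  proof (induction y rule: quiver_loc_induct)
    case (single d D n)
    have p: "qfrac (points (m + n)) 0 = qfrac (points m) 0 * (qfrac (points n) 0 :: 'k quiver_loc)"
      by (simp add: qfrac_mult points_add)
    show ?case
      unfolding loc_scale_mult loc_scale_mult_right qfrac_mult
      unfolding antipode_ext antipode_class_plus p loc_scale_mult loc_scale_mult_right
      by (simp only: mult_ac)
  qed (simp_all add: distrib_left antipode_ext)
qed (simp_all add: distrib_right antipode_ext)

lemma points_qfrac_cancel: "qfrac (points m) 0 * qfrac C m = qfrac C 0"
  using qfrac_points[of m C 0] by (simp add: qfrac_mult)

lemma conv_qfrac:
  fixes m :: nat
  shows "cut_sum C (\<lambda>A B. antipode (qfrac A m) * qfrac B m) = (conv_unit C :: 'k::field quiver_loc)"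
    and "cut_sum C (\<lambda>A B. qfrac A m * antipode (qfrac B m)) = (conv_unit C :: 'k::field quiver_loc)"
proof -
  have "antipode (qfrac A m) * qfrac B m = antipode_class A * (incl B :: 'k quiver_loc)"
    "qfrac A m * antipode (qfrac B m) = (incl A :: 'k quiver_loc) * antipode_class B" for A B
    unfolding antipode_ext incl_def points_qfrac_cancel[of m A, symmetric] points_qfrac_cancel[of m B, symmetric]
    by (simp_all only: mult_ac)
  then show "cut_sum C (\<lambda>A B. antipode (qfrac A m) * qfrac B m) = (conv_unit C :: 'k quiver_loc)"
    "cut_sum C (\<lambda>A B. qfrac A m * antipode (qfrac B m)) = (conv_unit C :: 'k quiver_loc)"
    using fun_cong[OF conv_antipode_left, of C] fun_cong[OF conv_antipode_right, of C]
    by (simp_all add: conv_def)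
qed

lemma antipode_left_H_c: "tensor_lift H_c (\<lambda>x y. antipode x * y) (coproduct h) = loc_scale (counit h) 1"
proof (rule linear_map_H_c_eqI[OF linear_map_tensor_lift_coproduct linear_map_eta[OF linear_map_counit]])
  note b = bilinear_map_mult_H_c[OF linear_map_antipode linear_map_ident]
  show "bilinear_map H_c H_c H_c (\<lambda>x y. antipode x * y)" by (rule b)
  show "tensor_lift H_c (\<lambda>x y. antipode x * y) (coproduct (qfrac C m)) = loc_scale (counit (qfrac C m)) 1" for C m
    by (simp add: tensor_lift_coproduct[OF b] conv_qfrac counit_ext conv_unit_def)
qed

lemma antipode_right_H_c: "tensor_lift H_c (\<lambda>x y. x * antipode y) (coproduct h) = loc_scale (counit h) 1"
proof (rule linear_map_H_c_eqI[OF linear_map_tensor_lift_coproduct linear_map_eta[OF linear_map_counit]])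
  note b = bilinear_map_mult_H_c[OF linear_map_ident linear_map_antipode]
  show "bilinear_map H_c H_c H_c (\<lambda>x y. x * antipode y)" by (rule b)
  show "tensor_lift H_c (\<lambda>x y. x * antipode y) (coproduct (qfrac C m)) = loc_scale (counit (qfrac C m)) 1" for C m
    by (simp add: tensor_lift_coproduct[OF b] conv_qfrac counit_ext conv_unit_def)
qed


section \<open>The grading\<close>

lemma edge_grade_eq: "edge_grade n = loc.span {qfrac C m :: 'k::field quiver_loc |C m. nedges C = n}"
proof -
  have "{frac (Poly_Mapping.single (quiver_class G) 1) m :: 'k quiver_loc |(G :: (nat, nat) mquiver) m.
        mixed_quiver G \<and> card (edges G) = n} = {qfrac C m |C m. nedges C = n}"
    unfolding qfrac_def
  proof (intro equalityI subsetI)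
    fix x :: "'k quiver_loc" assume "x \<in> {frac (Poly_Mapping.single (quiver_class G) 1) m |(G :: (nat, nat) mquiver) m.
        mixed_quiver G \<and> card (edges G) = n}"
    then show "x \<in> {frac (Poly_Mapping.single C 1) m |C m. nedges C = n}"
      using nedges_class by blast
  next
    fix x :: "'k quiver_loc" assume "x \<in> {frac (Poly_Mapping.single C 1) m |C m. nedges C = n}"
    then obtain C m where "x = frac (Poly_Mapping.single C 1) m" "nedges C = n" by blast
    then show "x \<in> {frac (Poly_Mapping.single (quiver_class G) 1) m |(G :: (nat, nat) mquiver) m.
        mixed_quiver G \<and> card (edges G) = n}"
      using quiver_rep[of C] unfolding nedges_def by (metis (mono_tags, lifting) mem_Collect_eq)
  qed
  then show ?thesis by (simp add: edge_grade_def)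
qed

lemma qfrac_in_edge_grade: "nedges C = n \<Longrightarrow> qfrac C m \<in> edge_grade n"
  unfolding edge_grade_eq by (rule loc.span_base) blast

lemma edge_grade_closed:
  "0 \<in> edge_grade n" "x \<in> edge_grade n \<Longrightarrow> y \<in> edge_grade n \<Longrightarrow> x + y \<in> edge_grade n"
  "x \<in> edge_grade n \<Longrightarrow> y \<in> edge_grade n \<Longrightarrow> x - y \<in> edge_grade n"
  "x \<in> edge_grade n \<Longrightarrow> loc_scale c x \<in> edge_grade n" "x \<in> edge_grade n \<Longrightarrow> - x \<in> edge_grade n"
  unfolding edge_grade_eq
  by (auto intro: loc.span_zero loc.span_add loc.span_diff loc.span_scale loc.span_neg)

lemma edge_grade_induct [consumes 1, case_names zero add scale qfrac]:
  assumes "x \<in> edge_grade n" "P 0" "\<And>x y. P x \<Longrightarrow> P y \<Longrightarrow> P (x + y)" "\<And>c x. P x \<Longrightarrow> P (loc_scale c x)"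
    "\<And>C m. nedges C = n \<Longrightarrow> P (qfrac C m)"
  shows "P x"
  using assms(1) unfolding edge_grade_eq
  by (rule loc.span_induct) (use assms(2-5) in \<open>auto simp: loc.subspace_def\<close>)

lemma submodule_edge_grade: "submodule (edge_grade n) base_algebra (H_c :: ('k::field, _) module)"
proof -
  interpret H: algebra base_algebra "H_c :: ('k, _) module" by (rule algebra_H_c)
  have minus: "\<ominus>\<^bsub>H_c\<^esub> x = - x" for x :: "'k quiver_loc"
    using H.minus_equality[of "- x" x] by simp
  show ?thesis by (rule H.submoduleI) (simp_all add: edge_grade_closed minus)
qed

lemma edge_grade_mult: "x \<in> edge_grade m \<Longrightarrow> y \<in> edge_grade n \<Longrightarrow> x * y \<in> edge_grade (m + n)"
proof (induction x rule: edge_grade_induct)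
  case (qfrac C k)
  from qfrac(2,1) show ?case
    by (induction y rule: edge_grade_induct)
      (auto simp: distrib_left loc_scale_mult_right qfrac_mult nedges_plus intro: edge_grade_closed qfrac_in_edge_grade)
qed (auto simp: distrib_right loc_scale_mult intro: edge_grade_closed)

text \<open>The projection onto the span of the generators with \<open>n\<close> edges. It witnesses that the
  decomposition into homogeneous components exists and is unique.\<close>

definition grade_proj :: "nat \<Rightarrow> 'k::field quiver_loc \<Rightarrow> 'k quiver_loc" where
  "grade_proj n = lin_ext loc_scale (\<lambda>C m. if nedges C = n then qfrac C m else 0)"

lemma grade_proj_ext:
  "grade_proj n (x + y) = grade_proj n x + grade_proj n y"
  "grade_proj n (loc_scale c x) = loc_scale c (grade_proj n x)"
  "grade_proj n (qfrac C m) = (if nedges C = n then qfrac C m else 0)"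
  unfolding grade_proj_def
  by (rule lin_ext_add lin_ext_scale lin_ext_qfrac, rule module_loc_scale, simp add: nedges_plus qfrac_bullet)+

lemma grade_proj_edge_grade: "x \<in> edge_grade k \<Longrightarrow> grade_proj n x = (if n = k then x else 0)"
proof (induction x rule: edge_grade_induct)
  case zero
  show ?case using grade_proj_ext(1)[of n 0 0] by simp
qed (auto simp: grade_proj_ext)

lemma grade_proj_in: "grade_proj n x \<in> edge_grade n"
  by (induction x rule: quiver_loc_induct)
    (auto simp: grade_proj_ext intro: edge_grade_closed qfrac_in_edge_grade)

lemma grade_proj_sum: "\<exists>N. (\<forall>n\<ge>N. grade_proj n x = 0) \<and> x = (\<Sum>n<N. grade_proj n x)"
proof -
  have "\<exists>N. \<forall>M\<ge>N. grade_proj M x = 0 \<and> x = (\<Sum>n<M. grade_proj n x)"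
  proof (induction x rule: quiver_loc_induct)
    case (single c C m)
    show ?case
    proof (intro exI[of _ "Suc (nedges C)"] allI impI conjI)
      fix M assume M: "Suc (nedges C) \<le> M"
      then show "grade_proj M (loc_scale c (qfrac C m)) = 0" by (simp add: grade_proj_ext)
      have "(\<Sum>n<M. grade_proj n (loc_scale c (qfrac C m))) = (\<Sum>n<M. if n = nedges C then loc_scale c (qfrac C m) else 0)"
        by (rule sum.cong) (auto simp: grade_proj_ext)
      then show "loc_scale c (qfrac C m) = (\<Sum>n<M. grade_proj n (loc_scale c (qfrac C m)))"
        using M by (simp add: sum.delta)
    qed
  next
    case (add x y)
    then obtain N N' where "\<And>M. M \<ge> N \<Longrightarrow> grade_proj M x = 0 \<and> x = (\<Sum>n<M. grade_proj n x)"
      "\<And>M. M \<ge> N' \<Longrightarrow> grade_proj M y = 0 \<and> y = (\<Sum>n<M. grade_proj n y)" by blast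
    then show ?case
      by (intro exI[of _ "max N N'"]) (simp add: grade_proj_ext sum.distrib)
  qed
  then show ?thesis by (metis order_refl)
qed

lemma edge_grade_direct_sum:
  "\<exists>!f. (\<forall>n. f n \<in> edge_grade n) \<and> finite {n. f n \<noteq> 0} \<and> h = (\<Sum>n\<in>{n. f n \<noteq> 0}. f n)"
proof (rule ex1I[of _ "\<lambda>n. grade_proj n h"])
  obtain N where N: "\<And>n. n \<ge> N \<Longrightarrow> grade_proj n h = 0" "h = (\<Sum>n<N. grade_proj n h)"
    using grade_proj_sum[of h] by blast
  then have sub: "{n. grade_proj n h \<noteq> 0} \<subseteq> {..<N}" by (auto simp: not_le[symmetric])
  have "(\<Sum>n\<in>{n. grade_proj n h \<noteq> 0}. grade_proj n h) = (\<Sum>n<N. grade_proj n h)"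
    using sub by (intro sum.mono_neutral_left) auto
  then show "(\<forall>n. grade_proj n h \<in> edge_grade n) \<and> finite {n. grade_proj n h \<noteq> 0} \<and>
      h = (\<Sum>n\<in>{n. grade_proj n h \<noteq> 0}. grade_proj n h)"
    using N(2) sub grade_proj_in by (auto intro: finite_subset)
next
  fix f assume f: "(\<forall>n. f n \<in> edge_grade n) \<and> finite {n. f n \<noteq> 0} \<and> h = (\<Sum>n\<in>{n. f n \<noteq> 0}. f n)"
  have sum: "grade_proj k (sum f I) = (\<Sum>n\<in>I. if n = k then f n else 0)" for k I
  proof (induction I rule: infinite_finite_induct)
    case (insert n I)
    then show ?case using f grade_proj_edge_grade[of "f n" n k] by (simp add: grade_proj_ext)
  qed (use grade_proj_edge_grade[OF edge_grade_closed(1)] in simp_all)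
  show "f = (\<lambda>n. grade_proj n h)"
  proof
    fix k
    have h: "h = sum f {n. f n \<noteq> 0}" using f by blast
    have "grade_proj k h = (\<Sum>n\<in>{n. f n \<noteq> 0}. if n = k then f n else 0)"
      by (subst h) (rule sum)
    then show "f k = grade_proj k h" using f by (simp add: sum.delta)
  qed
qed

lemma grade_coproduct:
  fixes x :: "'k::field quiver_loc"
  assumes "x \<in> edge_grade n"
  shows "Poly_Mapping.keys (free_coproduct x) \<subseteq> (\<Union>i\<le>n. edge_grade i \<times> edge_grade (n - i))"
  using assms
proof (induction x rule: edge_grade_induct)
  case zero
  show ?case using free_coproduct_ext(3)[of 0 "0 :: 'k quiver_loc"] by simp
next
  case (add x y)
  then show ?case using keys_add[of "free_coproduct x" "free_coproduct y"] by (auto simp: free_coproduct_ext)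
next
  case (scale c x)
  then show ?case using keys_pm_scale[of c "free_coproduct x"] by (auto simp: free_coproduct_ext)
next
  case (qfrac C m)
  let ?X = "\<Union>i\<le>n. edge_grade i \<times> edge_grade (n - i)"
  show ?case
    unfolding free_coproduct_ext cut_tensor_def
  proof (rule cut_sum_closed[where P = "\<lambda>t. Poly_Mapping.keys t \<subseteq> ?X"])
    show "Poly_Mapping.keys (t + u) \<subseteq> ?X" if "Poly_Mapping.keys t \<subseteq> ?X" "Poly_Mapping.keys u \<subseteq> ?X"
      for t u :: "('k quiver_loc \<times> 'k quiver_loc) \<Rightarrow>\<^sub>0 'k"
      using that keys_add[of t u] by blast
    fix A B assume "nedges A + nedges B = nedges C"
    then show "Poly_Mapping.keys (gen (qfrac A m) (qfrac B m) :: _ \<Rightarrow>\<^sub>0 'k) \<subseteq> ?X"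
      using qfrac by (auto intro!: bexI[of _ "nedges A"] qfrac_in_edge_grade)
  qed simp
qed

lemma antipode_class_in_edge_grade: "antipode_class C \<in> (edge_grade (nedges C) :: 'k::field quiver_loc set)"
proof (induction "nedges C" arbitrary: C rule: less_induct)
  case less
  have "cut_sum C (\<lambda>A B. if nedges B = 0 then 0 else antipode_class A * incl B) \<in> (edge_grade (nedges C) :: 'k quiver_loc set)"
  proof (rule cut_sum_closed)
    fix A B assume AB: "nedges A + nedges B = nedges C"
    show "(if nedges B = 0 then 0 else antipode_class A * incl B) \<in> (edge_grade (nedges C) :: 'k quiver_loc set)"
    proof (cases "nedges B = 0")
      case False
      then have "(antipode_class A :: 'k quiver_loc) * incl B \<in> edge_grade (nedges A + nedges B)"
        using AB by (intro edge_grade_mult less) (simp_all add: incl_def qfrac_in_edge_grade)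
      then show ?thesis using False AB by simp
    qed (simp add: edge_grade_closed)
  qed (auto intro: edge_grade_closed)
  moreover have "conv_unit C \<in> (edge_grade (nedges C) :: 'k quiver_loc set)"
    by (auto simp: conv_unit_def edge_grade_closed qfrac_in_edge_grade simp flip: qfrac_zero)
  ultimately have "(conv_unit C - cut_sum C (\<lambda>A B. if nedges B = 0 then 0 else antipode_class A * incl B)) *
      qfrac 0 (ncomps C) \<in> (edge_grade (nedges C + 0) :: 'k quiver_loc set)"
    by (intro edge_grade_mult edge_grade_closed qfrac_in_edge_grade) auto
  then show ?case by (subst antipode_class.simps) simp
qed

lemma antipode_in_edge_grade:
  fixes x :: "'k::field quiver_loc"
  shows "x \<in> edge_grade n \<Longrightarrow> antipode x \<in> edge_grade n"
proof (induction x rule: edge_grade_induct)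
  case zero
  show ?case using antipode_ext(2)[of 0 "0 :: 'k quiver_loc"] by (simp add: edge_grade_closed)
next
  case (qfrac C m)
  then show ?case
    using edge_grade_mult[OF qfrac_in_edge_grade[OF nedges_points] antipode_class_in_edge_grade, of m 0 C]
    by (simp add: antipode_ext)
qed (auto simp: antipode_ext intro: edge_grade_closed)

lemma counit_edge_grade: "x \<in> edge_grade n \<Longrightarrow> n > 0 \<Longrightarrow> counit x = 0"
proof (induction x rule: edge_grade_induct)
  case zero
  show ?case using counit_ext(2)[of 0 0] by simp
qed (auto simp: counit_ext)

theorem graded_hopf_H_c:
  "graded_commutative_hopf_algebra (H_c :: ('k::field, _) module) coproduct counit antipode edge_grade"
proof (intro graded_commutative_hopf_algebra.intro commutative_hopf_algebra.intro commutative_bialgebra.intro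
    commutative_hopf_algebra_axioms.intro graded_commutative_hopf_algebra_axioms.intro)
  let ?H = "H_c :: ('k, _) module"
  show "algebra base_algebra ?H" by (rule algebra_H_c)
  show "linear_map ?H (tensor H_c H_c) coproduct" by (rule linear_map_coproduct)
  show "coproduct \<in> ring_hom ?H (tensor H_c H_c)" by (rule ring_hom_coproduct)
  show "linear_map ?H base_algebra counit" by (rule linear_map_counit)
  show "counit \<in> ring_hom ?H base_algebra" by (rule ring_hom_counit)
  show "linear_map ?H H_c antipode" by (rule linear_map_antipode)
  show "submodule (edge_grade n) base_algebra ?H" for n by (rule submodule_edge_grade)
  show "\<one>\<^bsub>?H\<^esub> \<in> edge_grade 0"
    using qfrac_in_edge_grade[OF nedges_zero, of 0] by (simp add: qfrac_zero)
  show "coproduct x \<in> tensor_class H_c H_c ` {t. Poly_Mapping.keys t \<subseteq> (\<Union>i\<le>n. edge_grade i \<times> edge_grade (n - i))}"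
    if "x \<in> edge_grade n" for x :: "'k quiver_loc" and n
    using grade_coproduct[OF that] by (simp add: coproduct_eq)
  show "\<exists>!f. (\<forall>n. f n \<in> edge_grade n) \<and> finite {n. f n \<noteq> \<zero>\<^bsub>?H\<^esub>} \<and>
      h = (\<Oplus>\<^bsub>?H\<^esub>n\<in>{n. f n \<noteq> \<zero>\<^bsub>?H\<^esub>}. f n)" for h :: "'k quiver_loc"
    unfolding finsum_H_c H_c_simps by (rule edge_grade_direct_sum)
qed (simp_all add: coproduct_coassoc counital_left_H_c counital_right_H_c antipode_left_H_c antipode_right_H_c
    edge_grade_mult counit_edge_grade antipode_in_edge_grade)


section \<open>Uniqueness of counit and antipode\<close>

context
  fixes \<epsilon> :: "'k::field quiver_loc \<Rightarrow> 'k" and S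
  assumes hopf: "graded_commutative_hopf_algebra H_c coproduct \<epsilon> S edge_grade"
begin

interpretation hopf: graded_commutative_hopf_algebra H_c coproduct \<epsilon> S edge_grade by (rule hopf)

text \<open>At an edgeless generator \<open>x\<close> the coproduct is \<open>x \<otimes> x\<close>, so the counit law forces the value 1;
  the other generators have positive degree.\<close>

lemma counit_unique: "\<epsilon> = counit"
proof
  fix x
  show "\<epsilon> x = counit x"
  proof (rule linear_map_H_c_eqI[OF hopf.counit_linear linear_map_counit])
    fix C m
    show "\<epsilon> (qfrac C m) = counit (qfrac C m)"
    proof (cases "nedges C = 0")
      case True
      note b = bilinear_map_scale(1)[OF hopf.counit_linear]
      have "loc_scale (\<epsilon> (qfrac C m)) (qfrac C m) = qfrac C m"
        using hopf.counital_left[of "qfrac C m"] True by (simp add: tensor_lift_coproduct[OF b] cut_sum_edgeless)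
      then have "counit (loc_scale (\<epsilon> (qfrac C m)) (qfrac C m)) = counit (qfrac C m)" by simp
      then show ?thesis using True by (simp add: counit_ext)
    next
      case False
      then show ?thesis
        using hopf.grade_counit[OF qfrac_in_edge_grade[of C "nedges C" m]] by (simp add: counit_ext)
    qed
  qed
qed

text \<open>For each \<open>m\<close>, the left antipode law says that \<open>S(C/\<bullet>\<^sup>m)/\<bullet>\<^sup>m\<close> is a left convolution inverse
  of \<open>incl\<close>, and such an inverse is unique.\<close>

lemma antipode_unique: "S = antipode"
proof
  fix x
  show "S x = antipode x"
  proof (rule linear_map_H_c_eqI[OF hopf.antipode_linear linear_map_antipode])
    fix C m
    note b = bilinear_map_mult_H_c[OF hopf.antipode_linear linear_map_ident]
    have "(\<lambda>A. S (qfrac A m) * qfrac 0 m) = antipode_class"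
    proof (rule conv_incl_cancel, rule ext)
      fix C
      have "conv (\<lambda>A. S (qfrac A m) * qfrac 0 m) incl C = cut_sum C (\<lambda>A B. S (qfrac A m) * qfrac B m)"
        by (simp add: conv_def incl_def qfrac_mult mult.assoc)
      also have "\<dots> = conv_unit C"
        using hopf.antipode_left[of "qfrac C m"]
        by (simp add: tensor_lift_coproduct[OF b] counit_unique counit_ext conv_unit_def)
      finally show "conv (\<lambda>A. S (qfrac A m) * qfrac 0 m) incl C = conv antipode_class incl C"
        by (simp add: conv_antipode_left)
    qed
    then have "qfrac (points m) 0 * (S (qfrac C m) * qfrac 0 m) = antipode (qfrac C m)"
      by (simp add: antipode_ext fun_eq_iff)
    moreover have "qfrac (points m) 0 * (S (qfrac C m) * qfrac 0 m) =
        S (qfrac C m) * (qfrac (points m) 0 * qfrac 0 m)" by (simp only: mult_ac)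
    ultimately show "S (qfrac C m) = antipode (qfrac C m)" by (simp add: qfrac_points_inverse)
  qed
qed

end


section \<open>Quivers as elements of the Hopf algebra\<close>

lemma quiver_elem_eq: "quiver_elem G = qfrac (quiver_class G) 0"
  by (simp add: quiver_elem_def qfrac_def)

lemma bullet_pow_eq:
  "bullet_pow m = (if m \<ge> 0 then qfrac (points (nat m)) 0 else qfrac 0 (nat (- m)) :: 'k::field quiver_loc)"
proof -
  have "bullet ^ n = Poly_Mapping.single (points n) (1 :: 'k)" for n
    by (induction n) (simp_all add: bullet_def mult_single)
  then show ?thesis by (simp add: bullet_pow_def qfrac_def)
qed

lemma coproduct_quiver_elem:
  assumes "mixed_quiver G"
  shows "coproduct (quiver_elem G :: 'k::field quiver_loc) = (\<Oplus>\<^bsub>tensor H_c H_c\<^esub>H\<in>{H. H \<preceq> G}.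
    pure_tensor H_c H_c (quiver_elem H) (quiver_elem (contract G H)))"
  using finsum_tensor[OF finite_cut_sub[OF mixed_quiver_finite(1)[OF assms]],
      where t = "\<lambda>H. gen (quiver_elem H) (quiver_elem (contract G H)) :: _ \<Rightarrow>\<^sub>0 'k" and M = H_c and N = H_c]
  by (simp add: pure_tensor_def quiver_elem_eq coproduct_qfrac cut_tensor_def cut_sum_class[OF assms])

lemma coproduct_bullet_inverse:
  "coproduct (bullet_pow (- 1)) = pure_tensor H_c H_c (bullet_pow (- 1)) (bullet_pow (- 1))"
  by (simp add: bullet_pow_eq coproduct_qfrac cut_tensor_def cut_sum_edgeless pure_tensor_def)

lemma antipode_bullet_pow: "antipode (bullet_pow m) = (bullet_pow (- m) :: 'k::field quiver_loc)"
proof -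
  have points: "antipode (qfrac (points n) 0) = (qfrac 0 n :: 'k quiver_loc)" for n
  proof -
    have "antipode_class (points n) * (qfrac (points n) 0 * qfrac 0 n) = (qfrac 0 n :: 'k quiver_loc)"
      unfolding mult.assoc[symmetric] antipode_class_edgeless[OF nedges_points] by simp
    then show ?thesis by (simp add: antipode_ext qfrac_points_inverse qfrac_zero)
  qed
  have "antipode_class 0 = (1 :: 'k quiver_loc)"
    using antipode_class_edgeless[of 0] by (simp add: qfrac_zero)
  then have "antipode (qfrac 0 n) = (qfrac (points n) 0 :: 'k quiver_loc)" for n
    by (simp add: antipode_ext)
  then show ?thesis using points by (auto simp: bullet_pow_eq)
qed

text \<open>All edges of a connected quiver contract it to one point.\<close>

lemma contract_self_connected:
  assumes G: "mixed_quiver G" "connected_quiver G"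
  shows "quiver_class (contract G G) = points 1"
proof -
  obtain v where v: "v \<in> verts G" using G(2) by (auto simp: connected_quiver_def)
  have "conn_rel G `` {u} = verts G" if "u \<in> verts G" for u
    using that G by (auto simp: connected_quiver_def conn_rel_iff)
  then have "verts (contract G G) = {verts G}"
    using v by (auto simp: quotient_eq_image)
  then show ?thesis
    using class_edgeless[OF mixed_quiver_contract[OF G(1)], of G] by simp
qed

text \<open>The left antipode law at \<open>G\<close>, solved for the term \<open>H = G\<close>.\<close>

lemma antipode_connected:
  assumes G: "mixed_quiver G" "connected_quiver G" "edges G \<noteq> {}"
  shows "antipode (quiver_elem G :: 'k::field quiver_loc) =
    - (\<Sum>H\<in>{H. H \<preceq> G \<and> H \<noteq> G}. antipode (quiver_elem H) * quiver_elem (contract G H)) * bullet_pow (- 1)"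
proof -
  let ?f = "\<lambda>H. antipode (quiver_elem H :: 'k quiver_loc) * quiver_elem (contract G H)"
  have fin: "finite {H. H \<preceq> G}" by (rule finite_cut_sub[OF mixed_quiver_finite(1)[OF G(1)]])
  have GG: "G \<preceq> G"
    using edge_sub_edges[OF G(1)] by (metis cut_sub_def edge_sub_simps(3) order_refl)
  have "(\<Sum>H\<in>{H. H \<preceq> G}. ?f H) = 0"
    using conv_qfrac(1)[of "quiver_class G" 0] G mixed_quiver_finite(1)[OF G(1)]
    by (simp add: cut_sum_class quiver_elem_eq conv_unit_def nedges_class)
  moreover have "{H. H \<preceq> G} = insert G {H. H \<preceq> G \<and> H \<noteq> G}" using GG by auto
  ultimately have "?f G = - (\<Sum>H\<in>{H. H \<preceq> G \<and> H \<noteq> G}. ?f H)"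
    using fin by (simp add: eq_neg_iff_add_eq_0)
  moreover have "?f G * bullet_pow (- 1) = antipode (quiver_elem G)"
    using qfrac_points_inverse[of 1, where ?'k = 'k]
    by (simp only: quiver_elem_eq contract_self_connected[OF G(1,2)] bullet_pow_eq mult.assoc) simp
  ultimately show ?thesis by simp
qed

theorem theorem2p13:
  shows "(\<forall>G :: ('v, 'e) mquiver. mixed_quiver G \<longrightarrow>
        coproduct (quiver_elem G :: 'k::field_char_0 quiver_loc) =
          (\<Oplus>\<^bsub>tensor H_c H_c\<^esub>H\<in>{H. H \<preceq> G}. pure_tensor H_c H_c (quiver_elem H) (quiver_elem (contract G H))))
    \<and> coproduct (bullet_pow (- 1) :: 'k::field_char_0 quiver_loc) =
        pure_tensor H_c H_c (bullet_pow (- 1)) (bullet_pow (- 1))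
    \<and> (\<exists>\<epsilon> S. graded_commutative_hopf_algebra (H_c :: ('k::field_char_0, _) module) coproduct \<epsilon> S edge_grade)
    \<and> (\<forall>\<epsilon> S. graded_commutative_hopf_algebra (H_c :: ('k::field_char_0, _) module) coproduct \<epsilon> S edge_grade \<longrightarrow>
        \<one>\<^bsub>H_c\<^esub> = (quiver_elem empty_quiver :: 'k::field_char_0 quiver_loc)
      \<and> (\<forall>G :: ('v, 'e) mquiver. mixed_quiver G \<longrightarrow>
           \<epsilon> (quiver_elem G) = (if edges G = {} then 1 else 0))
      \<and> \<epsilon> (bullet_pow (- 1)) = 1
      \<and> (\<forall>m. S (bullet_pow m) = bullet_pow (- m))
      \<and> (\<forall>G :: ('v, 'e) mquiver. mixed_quiver G \<and> connected_quiver G \<and> edges G \<noteq> {} \<longrightarrow>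
           S (quiver_elem G) =
             - (\<Sum>H\<in>{H. H \<preceq> G \<and> H \<noteq> G}. S (quiver_elem H) * quiver_elem (contract G H))
               * bullet_pow (- 1))
      \<and> (\<forall>x y. S (x * y) = S x * S y))"
proof (intro conjI allI impI)
  fix \<epsilon> S assume hopf: "graded_commutative_hopf_algebra (H_c :: ('k::field_char_0, _) module) coproduct \<epsilon> S edge_grade"
  note unique = counit_unique[OF hopf] antipode_unique[OF hopf]
  show "\<one>\<^bsub>H_c\<^esub> = (quiver_elem empty_quiver :: 'k quiver_loc)"
    by (simp add: quiver_elem_eq qfrac_zero flip: zero_iso_class_def)
  show "\<epsilon> (quiver_elem G) = (if edges G = {} then 1 else 0)" if "mixed_quiver G" for G :: "('v, 'e) mquiver"
    using mixed_quiver_finite(1)[OF that]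
    by (simp add: unique quiver_elem_eq counit_ext nedges_class[OF that])
  show "\<epsilon> (bullet_pow (- 1)) = 1" by (simp add: unique bullet_pow_eq counit_ext)
  show "S (bullet_pow m) = bullet_pow (- m)" for m by (simp add: unique antipode_bullet_pow)
  show "S (quiver_elem G) = - (\<Sum>H\<in>{H. H \<preceq> G \<and> H \<noteq> G}. S (quiver_elem H) * quiver_elem (contract G H))
      * bullet_pow (- 1)"
    if "mixed_quiver G \<and> connected_quiver G \<and> edges G \<noteq> {}" for G :: "('v, 'e) mquiver"
    unfolding unique using that antipode_connected by blast
  show "S (x * y) = S x * S y" for x y by (simp add: unique antipode_mult)
qed (use graded_hopf_H_c in \<open>auto simp: coproduct_quiver_elem coproduct_bullet_inverse\<close>)

end
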